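(* Thompson's group $F$ is non-amenable if and only if it is $\ell^2$-invisible.
   Context: Thompson's group $F$ is the group of orientation-preserving piecewise linear homeomorphisms of $[0,1]$ with finitely many breakpoints, all at dyadic rationals, and all slopes powers of $2$. A (discrete) group $\Gamma$ is $\ell^2$-invisible if its group homology $H_i(\Gamma;\mathcal N(\Gamma))$ with coefficients in its group von Neumann algebra $\mathcal N(\Gamma)$ vanishes for all $i\ge 0$. *)

theory Defs
  imports "HOL-Analysis.Analysis" "HOL-Algebra.Algebra"
begin

definition dyadic :: "real \<Rightarrow> bool" where
  "dyadic x \<longleftrightarrow> (\<exists>(m::int) (n::nat). x = of_int m / 2 ^ n)"

text \<open>The finite set \<open>P\<close> contains the breakpoints; \<open>f\<close> is affine on every
  closed subinterval of \<open>[0,1]\<close> whose interior contains no point of \<open>P\<close>.\<close>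

definition dyadic_piecewise_linear :: "(real \<Rightarrow> real) \<Rightarrow> bool" where
  "dyadic_piecewise_linear f \<longleftrightarrow>
     (\<exists>P. finite P \<and> (\<forall>p\<in>P. dyadic p) \<and>
        (\<forall>a b. 0 \<le> a \<and> a < b \<and> b \<le> 1 \<and> {a<..<b} \<inter> P = {} \<longrightarrow>
           (\<exists>k::int. \<forall>x\<in>{a..b}. f x = f a + 2 powi k * (x - a))))"

definition thompson_F :: "(real \<Rightarrow> real) monoid" where
  "thompson_F = (BijGroup {0..1})
     \<lparr>carrier := {f \<in> Bij {0..1}. (\<exists>g. homeomorphism {0..1} {0..1} f g) \<and>
                    strict_mono_on {0..1} f \<and> dyadic_piecewise_linear f}\<rparr>"

definition amenable :: "('g, 'b) monoid_scheme \<Rightarrow> bool" where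
  "amenable G \<longleftrightarrow>
     (\<exists>\<mu> :: 'g set \<Rightarrow> real.
        (\<forall>A. A \<subseteq> carrier G \<longrightarrow> 0 \<le> \<mu> A) \<and> \<mu> (carrier G) = 1 \<and>
        (\<forall>A B. A \<subseteq> carrier G \<and> B \<subseteq> carrier G \<and> A \<inter> B = {} \<longrightarrow> \<mu> (A \<union> B) = \<mu> A + \<mu> B) \<and>
        (\<forall>g\<in>carrier G. \<forall>A. A \<subseteq> carrier G \<longrightarrow> \<mu> (g <#\<^bsub>G\<^esub> A) = \<mu> A))"

text \<open>Elements of \<open>\<ell>\<^sup>2(G)\<close> are functions on the whole type that vanish off the carrier.\<close>

definition ell2 :: "('g, 'b) monoid_scheme \<Rightarrow> ('g \<Rightarrow> complex) set" where
  "ell2 G = {v. (\<forall>x. x \<notin> carrier G \<longrightarrow> v x = 0) \<and>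
                (\<lambda>x. (cmod (v x))\<^sup>2) summable_on carrier G}"

definition ell2_norm :: "('g, 'b) monoid_scheme \<Rightarrow> ('g \<Rightarrow> complex) \<Rightarrow> real" where
  "ell2_norm G v = sqrt (\<Sum>\<^sub>\<infinity>x\<in>carrier G. (cmod (v x))\<^sup>2)"

definition bounded_operators ::
  "('g, 'b) monoid_scheme \<Rightarrow> (('g \<Rightarrow> complex) \<Rightarrow> ('g \<Rightarrow> complex)) set" where
  "bounded_operators G = {T \<in> ell2 G \<rightarrow>\<^sub>E ell2 G.
     (\<forall>v\<in>ell2 G. \<forall>w\<in>ell2 G. T (\<lambda>x. v x + w x) = (\<lambda>x. T v x + T w x)) \<and>
     (\<forall>a. \<forall>v\<in>ell2 G. T (\<lambda>x. a * v x) = (\<lambda>x. a * T v x)) \<and>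
     (\<exists>C. \<forall>v\<in>ell2 G. ell2_norm G (T v) \<le> C * ell2_norm G v)}"

definition left_translation ::
  "('g, 'b) monoid_scheme \<Rightarrow> 'g \<Rightarrow> ('g \<Rightarrow> complex) \<Rightarrow> ('g \<Rightarrow> complex)" where
  "left_translation G g = (\<lambda>v\<in>ell2 G. \<lambda>x. if x \<in> carrier G then v (inv\<^bsub>G\<^esub> g \<otimes>\<^bsub>G\<^esub> x) else 0)"

definition right_translation ::
  "('g, 'b) monoid_scheme \<Rightarrow> 'g \<Rightarrow> ('g \<Rightarrow> complex) \<Rightarrow> ('g \<Rightarrow> complex)" where
  "right_translation G g = (\<lambda>v\<in>ell2 G. \<lambda>x. if x \<in> carrier G then v (x \<otimes>\<^bsub>G\<^esub> g) else 0)"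

text \<open>\<open>\<N>(G) = \<B>(\<ell>\<^sup>2(G))\<^sup>G\<close>, the bounded operators that are equivariant
  for the left regular representation.\<close>

definition group_vN_algebra ::
  "('g, 'b) monoid_scheme \<Rightarrow> (('g \<Rightarrow> complex) \<Rightarrow> ('g \<Rightarrow> complex)) ring" where
  "group_vN_algebra G =
     \<lparr>carrier = {T \<in> bounded_operators G. \<forall>g\<in>carrier G. \<forall>v\<in>ell2 G.
                    T (left_translation G g v) = left_translation G g (T v)},
      monoid.mult = (\<lambda>S T. compose (ell2 G) S T),
      one = (\<lambda>v\<in>ell2 G. v),
      ring.zero = (\<lambda>v\<in>ell2 G. \<lambda>x. 0),
      add = (\<lambda>S T. \<lambda>v\<in>ell2 G. \<lambda>x. S v x + T v x)\<rparr>"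

text \<open>The homomorphism \<open>g \<mapsto> right_translation G g\<close> embeds \<open>G\<close> into the units of
  \<open>\<N>(G)\<close>; right multiplication along it makes \<open>\<N>(G)\<close> a right \<open>\<int>G\<close>-module.\<close>

definition vN_action :: "('g, 'b) monoid_scheme \<Rightarrow> (('g \<Rightarrow> complex) \<Rightarrow> ('g \<Rightarrow> complex)) \<Rightarrow>
    'g \<Rightarrow> (('g \<Rightarrow> complex) \<Rightarrow> ('g \<Rightarrow> complex))" where
  "vN_action G T g = T \<otimes>\<^bsub>group_vN_algebra G\<^esub> right_translation G g"

text \<open>The coefficients are a right \<open>\<int>G\<close>-module: the additive group of \<open>M\<close> with the
  right action \<open>act\<close> of \<open>G\<close>. Tensoring the unnormalised bar resolution with it over
  \<open>\<int>G\<close> gives in degree \<open>n\<close> the direct sum of copies of \<open>M\<close> indexed by the \<open>n\<close>-tuples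
  \<open>[g\<^sub>1|\<dots>|g\<^sub>n]\<close>, with boundary the alternating sum of the faces
  \<open>m[g\<^sub>1|\<dots>|g\<^sub>n] \<mapsto> (m g\<^sub>1)[g\<^sub>2|\<dots>|g\<^sub>n]\<close>,
  \<open>m[g\<^sub>1|\<dots>|g\<^sub>n] \<mapsto> m[g\<^sub>1|\<dots>|g\<^sub>i g\<^sub>i\<^sub>+\<^sub>1|\<dots>|g\<^sub>n]\<close> for \<open>0 < i < n\<close>, and
  \<open>m[g\<^sub>1|\<dots>|g\<^sub>n] \<mapsto> m[g\<^sub>1|\<dots>|g\<^sub>n\<^sub>-\<^sub>1]\<close>.\<close>

definition tuples :: "('g, 'b) monoid_scheme \<Rightarrow> nat \<Rightarrow> 'g list set" where
  "tuples G n = {xs. length xs = n \<and> set xs \<subseteq> carrier G}"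

definition bar_face :: "('g, 'b) monoid_scheme \<Rightarrow> nat \<Rightarrow> 'g list \<Rightarrow> 'g list" where
  "bar_face G i xs =
     (if i = 0 then tl xs
      else if i = length xs then butlast xs
      else take (i - 1) xs @ (xs ! (i - 1) \<otimes>\<^bsub>G\<^esub> xs ! i) # drop (Suc i) xs)"

definition bar_coeff :: "('m \<Rightarrow> 'g \<Rightarrow> 'm) \<Rightarrow> nat \<Rightarrow> 'g list \<Rightarrow> 'm \<Rightarrow> 'm" where
  "bar_coeff act i xs m = (if i = 0 then act m (hd xs) else m)"

definition bar_chains ::
  "('g, 'b) monoid_scheme \<Rightarrow> ('m, 'c) ring_scheme \<Rightarrow> nat \<Rightarrow> ('g list \<Rightarrow> 'm) monoid" where
  "bar_chains G M n = sum_group (tuples G n) (\<lambda>_. add_monoid M)"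

text \<open>\<open>bar_boundary G M act n\<close> maps degree \<open>n + 1\<close> to degree \<open>n\<close>.\<close>

definition bar_boundary :: "('g, 'b) monoid_scheme \<Rightarrow> ('m, 'c) ring_scheme \<Rightarrow>
    ('m \<Rightarrow> 'g \<Rightarrow> 'm) \<Rightarrow> nat \<Rightarrow> ('g list \<Rightarrow> 'm) \<Rightarrow> ('g list \<Rightarrow> 'm)" where
  "bar_boundary G M act n c = (\<lambda>ys\<in>tuples G n.
     \<Oplus>\<^bsub>M\<^esub>xs\<in>{xs \<in> tuples G (Suc n). c xs \<noteq> \<zero>\<^bsub>M\<^esub>}. \<Oplus>\<^bsub>M\<^esub>i\<in>{i \<in> {..Suc n}. bar_face G i xs = ys}.
       add_pow M ((- 1 :: int) ^ i) (bar_coeff act i xs (c xs)))"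

definition bar_cycles :: "('g, 'b) monoid_scheme \<Rightarrow> ('m, 'c) ring_scheme \<Rightarrow>
    ('m \<Rightarrow> 'g \<Rightarrow> 'm) \<Rightarrow> nat \<Rightarrow> ('g list \<Rightarrow> 'm) set" where
  "bar_cycles G M act n = (case n of
       0 \<Rightarrow> carrier (bar_chains G M 0)
     | Suc k \<Rightarrow> kernel (bar_chains G M (Suc k)) (bar_chains G M k) (bar_boundary G M act k))"

definition bar_boundaries :: "('g, 'b) monoid_scheme \<Rightarrow> ('m, 'c) ring_scheme \<Rightarrow>
    ('m \<Rightarrow> 'g \<Rightarrow> 'm) \<Rightarrow> nat \<Rightarrow> ('g list \<Rightarrow> 'm) set" where
  "bar_boundaries G M act n = bar_boundary G M act n ` carrier (bar_chains G M (Suc n))"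

definition group_homology :: "('g, 'b) monoid_scheme \<Rightarrow> ('m, 'c) ring_scheme \<Rightarrow>
    ('m \<Rightarrow> 'g \<Rightarrow> 'm) \<Rightarrow> nat \<Rightarrow> ('g list \<Rightarrow> 'm) set monoid" where
  "group_homology G M act n =
     (bar_chains G M n)\<lparr>carrier := bar_cycles G M act n\<rparr> Mod bar_boundaries G M act n"

definition l2_invisible :: "('g, 'b) monoid_scheme \<Rightarrow> bool" where
  "l2_invisible G \<longleftrightarrow>
     (\<forall>i. trivial_group (group_homology G (group_vN_algebra G) (vN_action G) i))"

end

theory Submission
  imports Defs "HOL-Library.Poly_Mapping"
begin

text \<open>Write \<open>\<N>\<close> for the von Neumann algebra of \<open>F\<close> and \<open>R\<^sub>g\<close> for right translation by \<open>g\<close>.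

  In degree 0, homology vanishes iff \<open>1 = \<Sum>\<^sub>s T\<^sub>s (R\<^sub>s - 1)\<close> for some \<open>T\<^sub>s \<in> \<N>\<close>. Such an identity bounds
  \<open>\<parallel>v\<parallel>\<close> by a multiple of \<open>\<Sum>\<^sub>s \<parallel>R\<^sub>s v - v\<parallel>\<close>; applied to indicator functions this gives exponential growth
  of finite sets, hence by Hall's theorem a paradoxical decomposition, and \<open>F\<close> is not amenable.

  Conversely let \<open>F\<close> be non-amenable. Every copy \<open>H\<close> of \<open>F\<close> inside \<open>F\<close> then has a spectral gap on \<open>\<ell>\<^sup>2(F)\<close>, so
  \<open>1 = \<Sum>\<^sub>h T (R\<^sub>h - 1)\<close> over finitely many \<open>h \<in> H\<close>, where \<open>T\<close> commutes with \<open>R\<^sub>k\<close> for all \<open>k\<close> centralising \<open>H\<close>.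
  Let \<open>N\<close> be the subgroup of elements that are the identity near 0. Finitely many elements of \<open>N\<close> are centralised by
  a copy \<open>H \<subseteq> N\<close> of \<open>F\<close> supported close to 0. A cycle \<open>z\<close> supported on them equals \<open>\<Sum>\<^sub>h (z T) (R\<^sub>h - 1)\<close>, and each
  summand is a boundary because conjugation by \<open>h\<close> is chain homotopic to the identity. Hence the homology of
  \<open>N\<close> with coefficients in \<open>\<N>\<close> vanishes in all degrees, and the Wang sequence of the extension of \<open>\<int>\<close> by \<open>N\<close> given by
  the logarithm of the slope at 0 extends this to \<open>F\<close>.\<close>

section \<open>Chains on a group modulo the translation relations\<close>

text \<open>The detour through the kernel of the slope is forced: a finite subset of F can have
  trivial centraliser, so no commuting copy of F need exist, whereas in the kernel one is always
  found closer to 0. Conjugation by h calls for two kinds of commutation: h with the finitely many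
  group elements that occur, and T with their right translations, so that z T is again a cycle. T
  stands to the left of R_h - 1 because coefficients are multiplied from the right. The gap holds on
  all of l^2(F), not merely on l^2(H), since l^2(F) restricted to H is a sum of copies of the
  regular representation of H; without a gap, H and hence F would carry an invariant mean. To avoid
  quotient modules, chains are finitely supported formal sums of lists, and coinvariants are
  expressed by congruence modulo a group of relations.\<close>

hide_const (open) Measure_Space.additive

abbreviation "single \<equiv> Poly_Mapping.single"
abbreviation "keys \<equiv> Poly_Mapping.keys"
abbreviation "lookup \<equiv> poly_mapping.lookup"

text \<open>The universal property of a direct sum. Coefficients are multiplied by noncommuting ring
  elements, so operators are treated as additive maps rather than linear ones.\<close>

definition extend :: "('i \<Rightarrow> 'm \<Rightarrow> 'b) \<Rightarrow> ('i \<Rightarrow>\<^sub>0 'm::zero) \<Rightarrow> 'b::comm_monoid_add" where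
  "extend f c = (\<Sum>x\<in>keys c. f x (lookup c x))"

lemma additiveI: "(\<And>x y. f (x + y) = f x + f y) \<Longrightarrow> additive f"
  by (simp add: Modules.additive_def)

lemma additive_compose: "additive f \<Longrightarrow> additive g \<Longrightarrow> additive (\<lambda>x. f (g x))"
  by (simp add: Modules.additive_def)

lemma additive_diff: "additive f \<Longrightarrow> additive g \<Longrightarrow> additive (\<lambda>x. f x - g x)"
  by (simp add: Modules.additive_def)

lemma additive_id: "additive (\<lambda>x. x)"
  by (simp add: Modules.additive_def)

lemma additive_const_zero: "additive (\<lambda>x. 0)"
  by (simp add: Modules.additive_def)

lemma additive_single: "additive (single k)"
  by (simp add: Modules.additive_def single_add)

lemma additive_times_right: "additive (\<lambda>m. m * (a :: 'm::ring))"
  by (simp add: Modules.additive_def distrib_right)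

lemma additive_extend:
  assumes "\<And>x. additive (f x)"
  shows "additive (extend f)"
  unfolding extend_def
  by (rule additiveI, rule setsum_keys_plus_distrib)
     (use assms in \<open>auto simp: additive.zero additive.add\<close>)

lemma extend_single [simp]: "additive (f x) \<Longrightarrow> extend f (single x m) = f x m"
  by (cases "m = 0") (auto simp: extend_def additive.zero)

lemma sum_single_keys: "(\<Sum>x\<in>keys c. single x (lookup c x)) = c"
  by (rule poly_mapping_eqI)
     (auto simp: lookup_sum lookup_single when_def in_keys_iff)

text \<open>A chain is the sum of its \<open>single\<close> terms. Almost every identity between
  chain operators reduces in this way to one about a single list, where recursion applies.\<close>

lemma additive_eqI:
  assumes "additive F" "additive G"
    and "\<And>x m. F (single x m) = G (single x m)"
  shows "F c = G c"
proof -
  have "F (\<Sum>x\<in>keys c. single x (lookup c x)) =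
        G (\<Sum>x\<in>keys c. single x (lookup c x))"
    by (simp add: additive.sum[OF assms(1)] additive.sum[OF assms(2)] assms(3))
  then show ?thesis by (simp add: sum_single_keys)
qed

section \<open>Cones, induced maps, boundary and prisms\<close>

definition cons :: "'a \<Rightarrow> ('a list \<Rightarrow>\<^sub>0 'm::ab_group_add) \<Rightarrow> ('a list \<Rightarrow>\<^sub>0 'm)" where
  "cons v = extend (\<lambda>\<sigma> m. single (v # \<sigma>) m)"

definition lmap :: "('a \<Rightarrow> 'b) \<Rightarrow> ('a list \<Rightarrow>\<^sub>0 'm::ab_group_add) \<Rightarrow> ('b list \<Rightarrow>\<^sub>0 'm)" where
  "lmap f = extend (\<lambda>\<sigma> m. single (map f \<sigma>) m)"

definition rmul :: "'m::ring \<Rightarrow> ('i \<Rightarrow>\<^sub>0 'm) \<Rightarrow> ('i \<Rightarrow>\<^sub>0 'm)" where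
  "rmul a = extend (\<lambda>\<sigma> m. single \<sigma> (m * a))"

text \<open>The complex is augmented: the boundary of a one-element list is the empty list.\<close>

primrec bdl :: "'a list \<Rightarrow> 'm::ab_group_add \<Rightarrow> ('a list \<Rightarrow>\<^sub>0 'm)" where
  "bdl [] m = 0"
| "bdl (v # vs) m = single vs m - cons v (bdl vs m)"

definition bd :: "('a list \<Rightarrow>\<^sub>0 'm::ab_group_add) \<Rightarrow> ('a list \<Rightarrow>\<^sub>0 'm)" where
  "bd = extend bdl"

text \<open>The classical prism, the sum of (-1)^i [f v_0, ..., f v_i, g v_i, ..., g v_n], with the
  terms i > 0 gathered into a cone with apex f v_0.\<close>

primrec prl :: "('a \<Rightarrow> 'b) \<Rightarrow> ('a \<Rightarrow> 'b) \<Rightarrow> 'a list \<Rightarrow> 'm::ab_group_add \<Rightarrow> ('b list \<Rightarrow>\<^sub>0 'm)" where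
  "prl f g [] m = 0"
| "prl f g (v # vs) m = single (f v # g v # map g vs) m - cons (f v) (prl f g vs m)"

definition prism :: "('a \<Rightarrow> 'b) \<Rightarrow> ('a \<Rightarrow> 'b) \<Rightarrow> ('a list \<Rightarrow>\<^sub>0 'm::ab_group_add) \<Rightarrow> ('b list \<Rightarrow>\<^sub>0 'm)" where
  "prism f g = extend (prl f g)"

lemma additive_cons: "additive (cons v)"
  unfolding cons_def by (intro additive_extend additive_single)

lemma additive_lmap: "additive (lmap f)"
  unfolding lmap_def by (intro additive_extend additive_single)

lemma additive_rmul: "additive (rmul a)"
  unfolding rmul_def by (intro additive_extend additive_compose[OF additive_single] additive_times_right)

lemma additive_bdl: "additive (bdl \<sigma>)"
  by (induction \<sigma>)
     (auto intro!: additive_const_zero additive_diff additive_single additive_compose[OF additive_cons])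

lemma additive_bd: "additive bd"
  unfolding bd_def by (intro additive_extend additive_bdl)

lemma additive_prl: "additive (prl f g \<sigma>)"
  by (induction \<sigma>)
     (auto intro!: additive_const_zero additive_diff additive_single additive_compose[OF additive_cons])

lemma additive_prism: "additive (prism f g)"
  unfolding prism_def by (intro additive_extend additive_prl)

lemmas additive_ops = additive_cons additive_lmap additive_rmul additive_bd additive_prism

lemmas additive_intros = additive_diff additive_id additive_const_zero additive_single
  additive_ops additive_ops[THEN additive_compose]

lemmas ops_diff [simp] = additive_ops[THEN additive.diff]
lemmas ops_zero [simp] = additive_ops[THEN additive.zero]
lemmas ops_add [simp] = additive_ops[THEN additive.add]
lemmas ops_sum = additive_ops[THEN additive.sum]

lemma cons_single [simp]: "cons v (single \<sigma> m) = single (v # \<sigma>) m"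
  unfolding cons_def by (simp add: additive_single)

lemma lmap_single [simp]: "lmap f (single \<sigma> m) = single (map f \<sigma>) m"
  unfolding lmap_def by (simp add: additive_single)

lemma rmul_single [simp]: "rmul a (single \<sigma> m) = single \<sigma> (m * a)"
  unfolding rmul_def by (simp add: additive_compose[OF additive_single] additive_times_right)

lemma bd_single [simp]: "bd (single \<sigma> m) = bdl \<sigma> m"
  unfolding bd_def by (simp add: additive_bdl)

lemma prism_single [simp]: "prism f g (single \<sigma> m) = prl f g \<sigma> m"
  unfolding prism_def by (simp add: additive_prl)

text \<open>Coning contracts the augmented complex; the recursion of \<open>bdl\<close> is this
  formula read as a definition.\<close>

lemma bd_cons [simp]: "bd (cons v c) = c - cons v (bd c)"
  by (rule additive_eqI) (simp_all add: additive_intros)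

lemma lmap_cons [simp]: "lmap f (cons v c) = cons (f v) (lmap f c)"
  by (rule additive_eqI) (simp_all add: additive_intros)

lemma rmul_cons [simp]: "rmul a (cons v c) = cons v (rmul a c)"
  by (rule additive_eqI) (simp_all add: additive_intros)

lemma rmul_rmul: "rmul a (rmul b c) = rmul (b * a) c"
  by (rule additive_eqI) (simp_all add: additive_intros mult.assoc)

lemma rmul_lmap: "rmul a (lmap f c) = lmap f (rmul a c)"
  by (rule additive_eqI) (simp_all add: additive_intros)

lemma lmap_lmap: "lmap f (lmap g c) = lmap (\<lambda>x. f (g x)) c"
  by (rule additive_eqI) (simp_all add: additive_intros o_def)

lemma rmul_one [simp]: "rmul (1 :: 'm::ring_1) c = c"
  by (rule additive_eqI) (simp_all add: additive_intros)

lemma bdl_map: "bdl (map f \<sigma>) m = lmap f (bdl \<sigma> m)"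
  by (induction \<sigma>) auto

lemma bd_lmap: "bd (lmap f c) = lmap f (bd c)"
  by (rule additive_eqI) (simp_all add: additive_intros bdl_map)

lemma bdl_mult: "bdl \<sigma> (m * a) = rmul a (bdl \<sigma> m)"
  by (induction \<sigma>) auto

lemma bd_rmul: "bd (rmul a c) = rmul a (bd c)"
  by (rule additive_eqI) (simp_all add: additive_intros bdl_mult)

lemma bd_bdl: "bd (bdl \<sigma> m) = 0"
  by (induction \<sigma>) auto

lemma bd_bd: "bd (bd c) = 0"
  by (rule additive_eqI) (simp_all add: additive_intros bd_bdl)

lemma prism_cons: "prism f g (cons v c) = cons (f v) (cons (g v) (lmap g c)) - cons (f v) (prism f g c)"
  by (rule additive_eqI) (simp_all add: additive_intros)

lemma bd_prl: "bd (prl f g \<sigma> m) =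
    single (map g \<sigma>) m - single (map f \<sigma>) m - prism f g (bdl \<sigma> m)"
proof (induction \<sigma>)
  case (Cons v \<sigma>)
  show ?case by (simp add: bdl_map prism_cons Cons.IH)
qed simp

text \<open>The homotopy between the chain maps of two vertex maps. It is applied to the identity
  and an equivariant substitute for left translation.\<close>

lemma bd_prism: "bd (prism f g c) = lmap g c - lmap f c - prism f g (bd c)"
  by (rule additive_eqI) (simp_all add: additive_intros bd_prl)

lemma prl_mult: "prl f g \<sigma> (m * a) = rmul a (prl f g \<sigma> m)"
  by (induction \<sigma>) auto

lemma prism_rmul: "prism f g (rmul a c) = rmul a (prism f g c)"
  by (rule additive_eqI) (simp_all add: additive_intros prl_mult)

lemma prl_equivariant:
  assumes "\<And>x. f (h x) = k (f x)" "\<And>x. g (h x) = k (g x)"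
  shows "prl f g (map h \<sigma>) m = lmap k (prl f g \<sigma> m)"
  by (induction \<sigma>) (auto simp: assms o_def)

lemma prism_lmap:
  assumes "\<And>x. f (h x) = k (f x)" "\<And>x. g (h x) = k (g x)"
  shows "prism f g (lmap h c) = lmap k (prism f g c)"
  by (rule additive_eqI) (simp_all add: additive_intros prl_equivariant[where f = f and g = g and h = h and k = k, OF assms])

text \<open>Used to split a chain by the degree of its first vertex.\<close>

definition subchain :: "('i \<Rightarrow> bool) \<Rightarrow> ('i \<Rightarrow>\<^sub>0 'm::ab_group_add) \<Rightarrow> ('i \<Rightarrow>\<^sub>0 'm)" where
  "subchain p = extend (\<lambda>\<sigma> m. if p \<sigma> then single \<sigma> m else 0)"

lemma additive_subchain: "additive (subchain p)"
proof -
  have "additive (\<lambda>m. if p \<sigma> then single \<sigma> m else 0)" for \<sigma>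
    by (cases "p \<sigma>") (auto intro: additive_single additive_const_zero)
  then show ?thesis unfolding subchain_def by (rule additive_extend)
qed

lemma subchain_single [simp]:
  "subchain p (single \<sigma> m) = (if p \<sigma> then single \<sigma> m else 0)"
proof -
  have "additive (\<lambda>m. if p \<sigma> then single \<sigma> m else 0)"
    by (cases "p \<sigma>") (auto intro: additive_single additive_const_zero)
  then show ?thesis
    unfolding subchain_def
    by (rule extend_single[where f = "\<lambda>\<sigma> m. if p \<sigma> then single \<sigma> m else 0"])
qed

lemma subchain_diff: "subchain p (a - b) = subchain p a - subchain p b"
  by (rule additive.diff[OF additive_subchain])

lemma lookup_subchain: "lookup (subchain p c) \<sigma> = (if p \<sigma> then lookup c \<sigma> else 0)"
proof -
  have "additive (\<lambda>c. lookup (subchain p c) \<sigma>)"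
    by (intro additiveI) (simp add: additive.add[OF additive_subchain] lookup_add)
  moreover have "additive (\<lambda>c. if p \<sigma> then lookup c \<sigma> else 0)"
    by (intro additiveI) (simp add: lookup_add)
  ultimately show ?thesis
    by (rule additive_eqI[where F = "\<lambda>c. lookup (subchain p c) \<sigma>"
          and G = "\<lambda>c. if p \<sigma> then lookup c \<sigma> else 0"])
       (auto simp: lookup_single when_def)
qed

lemma subchain_rmul: "subchain p (rmul a c) = rmul a (subchain p c)"
  by (rule additive_eqI) (simp_all add: additive_intros additive_compose additive_subchain)

lemma subchain_lmap:
  assumes "\<And>\<sigma>. p (map f \<sigma>) = q \<sigma>"
  shows "subchain p (lmap f c) = lmap f (subchain q c)"
  by (rule additive_eqI) (simp_all add: additive_intros additive_compose additive_subchain assms)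

text \<open>The class \<open>group_add\<close> does not assume commutativity, so \<open>'a\<close>
  is an arbitrary group written additively; \<open>\<rho>\<close> is a homomorphism into the units
  of the coefficient ring.\<close>

locale right_coefficients =
  fixes \<rho> :: "'a::group_add \<Rightarrow> 'm::ring_1"
  assumes \<rho>_add: "\<rho> (x + y) = \<rho> x * \<rho> y"
    and \<rho>_zero [simp]: "\<rho> 0 = 1"
begin

text \<open>Chains modulo \<open>rel N\<close> are the coinvariants of \<open>N\<close> in the homogeneous bar resolution with
  coefficients. Because of the augmentation, \<open>rel_acyclic N\<close> below contains the vanishing of the
  homology of \<open>N\<close> in degree 0 as its second clause.\<close>

inductive_set rel :: "'a set \<Rightarrow> ('a list \<Rightarrow>\<^sub>0 'm) set" for N where
  rel_gen: "n \<in> N \<Longrightarrow> single (map ((+) n) \<sigma>) m - single \<sigma> (m * \<rho> n) \<in> rel N"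
| rel_zero: "0 \<in> rel N"
| rel_diff: "a \<in> rel N \<Longrightarrow> b \<in> rel N \<Longrightarrow> a - b \<in> rel N"

lemma rel_uminus: "a \<in> rel N \<Longrightarrow> - a \<in> rel N"
  using rel_diff[OF rel_zero] by fastforce

lemma rel_add: "a \<in> rel N \<Longrightarrow> b \<in> rel N \<Longrightarrow> a + b \<in> rel N"
  using rel_diff[OF _ rel_uminus] by fastforce

lemma rel_sum: "(\<And>i. i \<in> I \<Longrightarrow> f i \<in> rel N) \<Longrightarrow> sum f I \<in> rel N"
  by (induction I rule: infinite_finite_induct) (auto intro: rel_zero rel_add)

lemma rel_mono: "a \<in> rel N \<Longrightarrow> N \<subseteq> N' \<Longrightarrow> a \<in> rel N'"
  by (induction rule: rel.induct) (auto intro: rel.intros)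

text \<open>Derivations are finite, so a cycle condition modulo \<open>rel N\<close> involves
  finitely many group elements. This is why it is enough to centralise finite sets.\<close>

lemma rel_finite: "a \<in> rel N \<Longrightarrow> \<exists>K. finite K \<and> K \<subseteq> N \<and> a \<in> rel K"
proof (induction rule: rel.induct)
  case (rel_gen n \<sigma> m)
  then show ?case by (intro exI[of _ "{n}"]) (auto intro: rel.rel_gen)
next
  case rel_zero
  then show ?case by (intro exI[of _ "{}"]) (auto intro: rel.rel_zero)
next
  case (rel_diff a b)
  then obtain K L where "finite K" "K \<subseteq> N" "a \<in> rel K" "finite L" "L \<subseteq> N" "b \<in> rel L" by blast
  then show ?case
    by (intro exI[of _ "K \<union> L"]) (auto intro!: rel.rel_diff intro: rel_mono)
qed

lemma additive_in_rel:
  assumes "additive F" "\<And>x m. x \<in> keys c \<Longrightarrow> F (single x m) \<in> rel N"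
  shows "F c \<in> rel N"
proof -
  have "F (\<Sum>x\<in>keys c. single x (lookup c x)) \<in> rel N"
    unfolding additive.sum[OF assms(1)] by (intro rel_sum assms(2))
  then show ?thesis by (simp add: sum_single_keys)
qed

lemma rel_genI: "n \<in> N \<Longrightarrow> lmap ((+) n) c - rmul (\<rho> n) c \<in> rel N"
  by (rule additive_in_rel[where c = c and F = "\<lambda>c. lmap ((+) n) c - rmul (\<rho> n) c"])
     (auto intro: additive_intros rel_gen)

text \<open>The identity as \<open>\<phi>\<close> covers boundary, prisms, right multiplication and
  splitting by degree; conjugation by \<open>t\<close> covers the action of \<open>t\<close> on
  coinvariants of a normal subgroup.\<close>

lemma rel_map:
  assumes z: "z \<in> rel N" and F: "additive F"
    and c: "\<And>n. n \<in> N \<Longrightarrow> \<phi> n \<in> N'"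
      "\<And>n c. n \<in> N \<Longrightarrow> F (lmap ((+) n) c) = lmap ((+) (\<phi> n)) (F c)"
      "\<And>n c. n \<in> N \<Longrightarrow> F (rmul (\<rho> n) c) = rmul (\<rho> (\<phi> n)) (F c)"
  shows "F z \<in> rel N'"
  using z
proof (induction rule: rel.induct)
  case (rel_gen n \<sigma> m)
  have "F (lmap ((+) n) (single \<sigma> m) - rmul (\<rho> n) (single \<sigma> m)) \<in> rel N'"
    unfolding additive.diff[OF F] c(2)[OF rel_gen] c(3)[OF rel_gen] by (intro rel_genI c rel_gen)
  then show ?case by simp
qed (auto simp: additive.zero[OF F] additive.diff[OF F] intro: rel_zero rel_diff)

lemma bd_rel: "z \<in> rel N \<Longrightarrow> bd z \<in> rel N"
  by (rule rel_map[where \<phi> = "\<lambda>n. n"]) (auto simp: additive_bd bd_lmap bd_rmul)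

lemma prism_rel:
  assumes "z \<in> rel N" "\<And>n x. n \<in> N \<Longrightarrow> f (n + x) = n + f x" "\<And>n x. n \<in> N \<Longrightarrow> g (n + x) = n + g x"
  shows "prism f g z \<in> rel N"
  by (rule rel_map[where \<phi> = "\<lambda>n. n", OF assms(1)])
     (auto simp: additive_prism prism_rmul assms intro!: prism_lmap)

text \<open>The relations multiply coefficients by \<open>\<rho> n\<close> on the right, so a
  further right factor \<open>T\<close> respects them once it commutes with
  \<open>\<rho> n\<close>.\<close>

lemma rmul_rel:
  assumes "z \<in> rel N" "\<And>n. n \<in> N \<Longrightarrow> T * \<rho> n = \<rho> n * T"
  shows "rmul T z \<in> rel N"
  by (rule rel_map[where \<phi> = "\<lambda>n. n", OF assms(1)])
     (auto simp: additive_rmul rmul_lmap rmul_rmul assms)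

definition rel_acyclic :: "'a set \<Rightarrow> bool" where
  "rel_acyclic N \<longleftrightarrow> (\<forall>z. bd z \<in> rel N \<longrightarrow> (\<exists>u. z - bd u \<in> rel N)) \<and>
     (\<forall>m. single [] m \<in> rel N)"

lemma rmul_sum: "rmul (\<Sum>s\<in>S. T s) c = (\<Sum>s\<in>S. rmul (T s) c)"
  by (rule additive_eqI[where F = "rmul (\<Sum>s\<in>S. T s)"])
     (simp_all add: additive_rmul sum_distrib_left additive.sum[OF additive_single] Modules.additive_def sum.distrib)

lemma rmul_minus_one: "rmul (T * (a - (1 :: 'm))) c = rmul a (rmul T c) - rmul T c"
  by (rule additive_eqI[where F = "rmul (T * (a - 1))"])
     (simp_all add: additive_intros right_diff_distrib mult.assoc additive.diff[OF additive_single])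

text \<open>Left translation by \<open>s\<close> is not equivariant under \<open>N\<close>, so its
  prism need not respect the relations. The map \<open>r\<close> picks a representative of each
  coset \<open>N + x\<close>, and inserting \<open>s\<close> as \<open>(x - r x) + s + r x\<close>
  is equivariant by construction. The result is \<open>s + x\<close> as soon as \<open>s\<close>
  commutes with the component \<open>x - r x\<close> in \<open>N\<close>, which can be arranged for
  the finitely many vertices of a given chain.\<close>

theorem acyclic_if_centralised:
  fixes r :: "'a \<Rightarrow> 'a"
  assumes r: "\<And>n x. n \<in> N \<Longrightarrow> r (n + x) = r x" "\<And>x. x - r x \<in> N"
    and key: "\<And>K. finite K \<Longrightarrow> K \<subseteq> N \<Longrightarrow> \<exists>S T. finite S \<and> S \<subseteq> N \<and>
       (\<forall>s\<in>S. \<forall>k\<in>K. s + k = k + s \<and> T s * \<rho> k = \<rho> k * T s) \<and> (\<Sum>s\<in>S. T s * (\<rho> s - 1)) = 1"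
  shows "rel_acyclic N"
proof -
  have main: "\<exists>u. z - bd u \<in> rel N" if z: "bd z \<in> rel N" for z :: "'a list \<Rightarrow>\<^sub>0 'm"
  proof -
    obtain K where K: "finite K" "K \<subseteq> N" "bd z \<in> rel K" using rel_finite[OF z] by blast
    \<comment> \<open>The elements of \<open>K\<close> are wanted for commuting with
      \<open>T s\<close>, the \<open>N\<close>-components of the vertices of \<open>z\<close> for
      commuting with \<open>s\<close>.\<close>
    define K' where "K' = K \<union> (\<Union>\<sigma>\<in>keys z. (\<lambda>x. x - r x) ` set \<sigma>)"
    have K': "finite K'" "K' \<subseteq> N" unfolding K'_def using K r(2) by auto
    obtain S T where S: "finite S" "S \<subseteq> N" and
      comm: "\<forall>s\<in>S. \<forall>k\<in>K'. s + k = k + s \<and> T s * \<rho> k = \<rho> k * T s" and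
      one: "(\<Sum>s\<in>S. T s * (\<rho> s - 1)) = 1"
      using key[OF K'] by (elim exE conjE)
    note ST = S comm[rule_format] one
    \<comment> \<open>On the finitely many vertices of \<open>z\<close> the \<open>N\<close>-equivariant map \<open>f s\<close> is left translation by \<open>s\<close>.\<close>
    define f where "f s x = (x - r x) + s + r x" for s x
    have f_eq: "f s x = s + x" if "s \<in> S" "\<sigma> \<in> keys z" "x \<in> set \<sigma>" for s \<sigma> x
    proof -
      have "x - r x \<in> K'" unfolding K'_def using that by blast
      from ST(3)[OF that(1) this] have "(x - r x) + s = s + (x - r x)" by simp
      then show ?thesis unfolding f_def by (simp add: add.assoc)
    qed
    have f_equiv: "f s (n + x) = n + f s x" if "n \<in> N" for s n x
      unfolding f_def r(1)[OF that] by (simp add: add.assoc diff_conv_add_uminus del: add_uminus_conv_diff)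
    define P where "P s = prism (\<lambda>x. x) (f s) (rmul (T s) z)" for s
    \<comment> \<open>Right multiplication by \<open>T s\<close> keeps \<open>z\<close> a cycle
      modulo relations. The prism joins the product to its image under \<open>f s\<close>; on these
      vertices \<open>f s\<close> is translation by \<open>s\<close>, which modulo
      \<open>rel N\<close> is multiplication by \<open>\<rho> s\<close>.\<close>
    have step: "(rmul (\<rho> s) (rmul (T s) z) - rmul (T s) z) - bd (P s) \<in> rel N" if s: "s \<in> S" for s
    proof -
      have "rmul (T s) (bd z) \<in> rel K"
        by (rule rmul_rel[OF K(3)]) (use ST(3)[OF s] in \<open>auto simp: K'_def\<close>)
      then have "rmul (T s) (bd z) \<in> rel N" using rel_mono K(2) by blast
      then have 1: "prism (\<lambda>x. x) (f s) (bd (rmul (T s) z)) \<in> rel N"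
        unfolding bd_rmul by (rule prism_rel) (auto simp: f_equiv)
      have 2: "lmap (f s) (rmul (T s) z) - rmul (\<rho> s) (rmul (T s) z) \<in> rel N"
      proof -
        have "lmap (f s) (rmul (T s) c) - rmul (\<rho> s) (rmul (T s) c) \<in> rel N"
          if c: "keys c \<subseteq> keys z" for c
        proof (rule additive_in_rel[where c = c and
              F = "\<lambda>c. lmap (f s) (rmul (T s) c) - rmul (\<rho> s) (rmul (T s) c)"])
          fix \<sigma> m assume "\<sigma> \<in> keys c"
          then have \<sigma>: "map (f s) \<sigma> = map ((+) s) \<sigma>" using f_eq[OF s] c by auto
          show "lmap (f s) (rmul (T s) (single \<sigma> m)) -
              rmul (\<rho> s) (rmul (T s) (single \<sigma> m)) \<in> rel N"
            using rel_gen[of s N \<sigma> "m * T s"] s ST(2) by (auto simp: \<sigma>)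
        qed (intro additive_intros additive_compose[OF additive_lmap] additive_compose[OF additive_rmul])
        then show ?thesis by blast
      qed
      have "lmap (\<lambda>x. x) (rmul (T s) z) = rmul (T s) z"
        by (rule additive_eqI) (simp_all add: additive_intros)
      then have "(rmul (\<rho> s) (rmul (T s) z) - rmul (T s) z) - bd (P s) =
         prism (\<lambda>x. x) (f s) (bd (rmul (T s) z)) - (lmap (f s) (rmul (T s) z) - rmul (\<rho> s) (rmul (T s) z))"
        unfolding P_def bd_prism by simp
      then show ?thesis using rel_diff[OF 1 2] by (simp only:)
    qed
    have "z = rmul (\<Sum>s\<in>S. T s * (\<rho> s - 1)) z" by (simp add: ST(4))
    also have "\<dots> = (\<Sum>s\<in>S. rmul (\<rho> s) (rmul (T s) z) - rmul (T s) z)"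
      by (simp add: rmul_sum rmul_minus_one)
    finally have "z - bd (\<Sum>s\<in>S. P s) = (\<Sum>s\<in>S. (rmul (\<rho> s) (rmul (T s) z) - rmul (T s) z) - bd (P s))"
      by (simp add: ops_sum sum_subtractf)
    moreover have "\<dots> \<in> rel N" by (intro rel_sum step)
    ultimately show ?thesis by (intro exI[of _ "\<Sum>s\<in>S. P s"]) simp
  qed
  \<comment> \<open>Translations fix the empty list, so its relations identify \<open>m\<close> with
    \<open>m * \<rho> s\<close>; the identity obtained for \<open>K = {}\<close> then kills every
    coefficient.\<close>
  have "single [] m \<in> rel N" for m
  proof -
    obtain S T where ST: "finite S" "S \<subseteq> N" "(\<Sum>s\<in>S. T s * (\<rho> s - 1)) = (1 :: 'm)"
      using key[of "{}"] by blast
    have "m = (\<Sum>s\<in>S. m * T s * \<rho> s - m * T s)"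
      using arg_cong[OF ST(3), of "\<lambda>x. m * x"] by (simp add: sum_distrib_left algebra_simps)
    then have "single [] m = single ([] :: 'a list) (\<Sum>s\<in>S. m * T s * \<rho> s - m * T s)"
      by (rule arg_cong)
    also have "\<dots> = (\<Sum>s\<in>S. - (single (map ((+) s) []) (m * T s) - single [] (m * T s * \<rho> s)))"
      by (simp add: additive.sum[OF additive_single] single_diff)
    also have "\<dots> \<in> rel N" by (intro rel_sum rel_uminus rel_gen) (use ST in auto)
    finally show ?thesis .
  qed
  with main show ?thesis unfolding rel_acyclic_def by blast
qed

text \<open>The Wang sequence by hand. Coinvariants of the whole group are those of the kernel
  modulo the image of 1 - \<open>\<theta>\<close>, where \<open>\<theta>\<close> is the action of
  \<open>t\<close>. As 1 - \<open>\<theta>\<close> is injective, this is a short exact sequence of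
  complexes whose first two terms are acyclic, hence so is the third.\<close>

theorem acyclic_UNIV_if_acyclic_kernel:
  fixes \<tau> :: "'a \<Rightarrow> int"
  assumes \<tau>: "\<And>x y. \<tau> (x + y) = \<tau> x + \<tau> y" and t: "\<tau> t = 1"
    and ker: "rel_acyclic {x. \<tau> x = 0}"
  shows "rel_acyclic UNIV"
proof -
  define N where "N = {x. \<tau> x = 0}"
  have \<tau>0: "\<tau> 0 = 0" using \<tau>[of 0 0] by simp
  have \<tau>_uminus: "\<tau> (- x) = - \<tau> x" for x using \<tau>[of x "- x"] \<tau>0 by simp
  have nil: "single [] m \<in> rel N" for m
    using ker unfolding rel_acyclic_def N_def by blast
  \<comment> \<open>The action of \<open>t\<close> on the coinvariants of the kernel; \<open>1 - \<theta>\<close> is injective modulo \<open>rel N\<close> because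
    \<open>\<theta>\<close> raises the degree \<open>\<tau>\<close> of the first vertex.\<close>
  define \<theta> where "\<theta> c = lmap ((+) t) (rmul (\<rho> (- t)) c)" for c :: "'a list \<Rightarrow>\<^sub>0 'm"
  have \<theta>_add: "additive \<theta>"
    unfolding \<theta>_def by (intro additive_intros additive_compose[OF additive_lmap])
  have inv: "\<rho> (- x) * \<rho> x = 1" "\<rho> x * \<rho> (- x) = 1" for x
    by (simp_all add: \<rho>_add[symmetric])
  have \<theta>_rel: "\<theta> z \<in> rel N" if "z \<in> rel N" for z
  proof (rule rel_map[where \<phi> = "\<lambda>n. t + (n + (- t))", OF that \<theta>_add])
    fix n c assume "n \<in> N"
    show "t + (n + (- t)) \<in> N"
      using \<open>n \<in> N\<close> unfolding N_def by (simp only: mem_Collect_eq \<tau> \<tau>_uminus)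
    have "(\<lambda>x. t + (n + x)) = (\<lambda>x. t + (n + (- t)) + (t + x))"
      by (simp only: add.assoc minus_add_cancel)
    then show "\<theta> (lmap ((+) n) c) = lmap ((+) (t + (n + (- t)))) (\<theta> c)"
      unfolding \<theta>_def rmul_lmap lmap_lmap by simp
    have "n + (- t) = - t + (t + (n + (- t)))" by (simp only: minus_add_cancel)
    then show "\<theta> (rmul (\<rho> n) c) = rmul (\<rho> (t + (n + (- t)))) (\<theta> c)"
      unfolding \<theta>_def rmul_lmap rmul_rmul \<rho>_add[symmetric] by simp
  qed
  have \<theta>_bd: "bd (\<theta> c) = \<theta> (bd c)" for c by (simp add: \<theta>_def bd_lmap bd_rmul)
  have coinv: "\<theta> c - c \<in> rel UNIV" for c
    using rel_genI[of t UNIV "rmul (\<rho> (- t)) c"] by (simp add: \<theta>_def rmul_rmul inv)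

  \<comment> \<open>The elements whose relations lie in \<open>D\<close> form a subgroup. It
    contains the kernel and \<open>t\<close>, hence everything, by induction on the absolute value
    of \<open>\<tau> g\<close>.\<close>
  have rel_UNIV: "\<exists>r w. r \<in> rel N \<and> z = r + (w - \<theta> w)" if "z \<in> rel UNIV" for z
  proof -
    define D where "D = {r + (w - \<theta> w) | r w. r \<in> rel N}"
    have D_diff: "a - b \<in> D" if ab: "a \<in> D" "b \<in> D" for a b
    proof -
      obtain r w r' w' where "r \<in> rel N" "r' \<in> rel N" "a = r + (w - \<theta> w)" "b = r' + (w' - \<theta> w')"
        using ab unfolding D_def by blast
      moreover from this have "a - b = (r - r') + ((w - w') - \<theta> (w - w'))"
        by (simp add: additive.diff[OF \<theta>_add])
      ultimately show ?thesis unfolding D_def using rel_diff by blast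
    qed
    have relD: "r \<in> D" if "r \<in> rel N" for r
    proof -
      have "r = r + (0 - \<theta> 0)" by (simp add: additive.zero[OF \<theta>_add])
      then show ?thesis unfolding D_def using that by blast
    qed
    then have D_0: "0 \<in> D" using rel_zero by blast
    have D_uminus: "- a \<in> D" if "a \<in> D" for a using D_diff[OF D_0 that] by simp
    have D_add: "a + b \<in> D" if "a \<in> D" "b \<in> D" for a b
      using D_diff[OF that(1) D_uminus[OF that(2)]] by simp
    define good where "good g \<longleftrightarrow> (\<forall>c. lmap ((+) g) c - rmul (\<rho> g) c \<in> D)" for g
    have plus_plus: "(+) (g + h) = (\<lambda>x. g + (h + x))" for g h :: 'a
      by (simp add: fun_eq_iff add.assoc)
    have good_N: "good n" if "\<tau> n = 0" for n
      unfolding good_def using rel_genI[of n N] that by (auto intro: relD simp: N_def)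
    have good_add: "good (g + h)" if "good g" "good h" for g h
    proof -
      have "lmap ((+) (g + h)) c - rmul (\<rho> (g + h)) c =
          (lmap ((+) g) (lmap ((+) h) c) - rmul (\<rho> g) (lmap ((+) h) c)) +
          (lmap ((+) h) (rmul (\<rho> g) c) - rmul (\<rho> h) (rmul (\<rho> g) c))" for c
        by (simp add: lmap_lmap rmul_lmap rmul_rmul \<rho>_add plus_plus)
      then show ?thesis using that D_add unfolding good_def by metis
    qed
    have good_uminus: "good (- g)" if "good g" for g
    proof -
      have "lmap ((+) (- g)) c - rmul (\<rho> (- g)) c =
         - (lmap ((+) g) (lmap ((+) (- g)) (rmul (\<rho> (- g)) c)) -
            rmul (\<rho> g) (lmap ((+) (- g)) (rmul (\<rho> (- g)) c)))" for c
      proof -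
        have "lmap (\<lambda>x. x) c' = c'" for c' :: "'a list \<Rightarrow>\<^sub>0 'm"
          by (rule additive_eqI) (simp_all add: additive_intros)
        then show ?thesis by (simp add: lmap_lmap rmul_lmap rmul_rmul inv)
      qed
      then show ?thesis using that D_uminus unfolding good_def by metis
    qed
    have good_t: "good t"
    proof -
      \<comment> \<open>With w = \<open>- rmul (\<rho> t) c\<close>, the factor
        \<open>\<rho> (- t)\<close> inside \<open>\<theta>\<close> cancels, so
        \<open>\<theta>\<close> sends w to \<open>- lmap ((+) t) c\<close>.\<close>
      have "lmap ((+) t) c - rmul (\<rho> t) c = 0 + ((- rmul (\<rho> t) c) - \<theta> (- rmul (\<rho> t) c))" for c
        by (simp add: additive.minus[OF \<theta>_add]) (simp add: \<theta>_def rmul_rmul inv)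
      then show ?thesis unfolding good_def D_def using rel_zero by blast
    qed
    have "good g" if "nat \<bar>\<tau> g\<bar> = k" for g k
      using that
    proof (induction k arbitrary: g)
      case 0
      then show ?case by (intro good_N) auto
    next
      case (Suc k)
      consider "\<tau> g > 0" | "\<tau> g < 0" using Suc.prems by force
      then show ?case
      proof cases
        case 1
        have "good (g + (- t))"
          by (rule Suc.IH) (use 1 Suc.prems in \<open>auto simp: \<tau> \<tau>_uminus t simp del: add_uminus_conv_diff\<close>)
        from good_add[OF this good_t] show ?thesis by (simp add: add.assoc)
      next
        case 2
        have "good (g + t)"
          by (rule Suc.IH) (use 2 Suc.prems in \<open>auto simp: \<tau> t\<close>)
        from good_add[OF this good_uminus[OF good_t]] show ?thesis by (simp add: add.assoc)
      qed
    qed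
    then have all: "lmap ((+) g) c - rmul (\<rho> g) c \<in> D" for g c unfolding good_def by blast
    from that have "z \<in> D"
    proof (induction rule: rel.induct)
      case (rel_gen n \<sigma> m)
      show ?case using all[of n "single \<sigma> m"] by simp
    qed (auto intro: D_0 D_diff)
    then show ?thesis unfolding D_def by blast
  qed

  \<comment> \<open>Relations over \<open>N\<close> preserve the degree of the first vertex, so
    modulo \<open>rel N\<close> the piece of \<open>w\<close> in degree k is \<open>\<theta>\<close>
    of the piece in degree k - 1. Finite support makes the lowest pieces zero, and induction upwards
    kills the rest.\<close>
  have inj: "w \<in> rel N" if w: "w - \<theta> w \<in> rel N" for w
  proof -
    define p :: "int \<Rightarrow> ('a list \<Rightarrow>\<^sub>0 'm) \<Rightarrow> ('a list \<Rightarrow>\<^sub>0 'm)"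
      where "p k = subchain (\<lambda>\<sigma>. \<sigma> \<noteq> [] \<and> \<tau> (hd \<sigma>) = k)" for k
    have p_rel: "p k r \<in> rel N" if "r \<in> rel N" for k r
      unfolding p_def
      by (rule rel_map[where \<phi> = "\<lambda>n. n", OF that additive_subchain])
         (auto simp: subchain_rmul N_def \<tau> hd_map intro!: subchain_lmap)
    have p_\<theta>: "p k (\<theta> c) = \<theta> (p (k - 1) c)" for k c
      unfolding p_def \<theta>_def subchain_rmul[symmetric]
      by (rule subchain_lmap) (auto simp: \<tau> t hd_map)
    have p_step: "p k w - \<theta> (p (k - 1) w) \<in> rel N" for k
      using p_rel[OF w, of k] by (simp add: p_def subchain_diff p_\<theta>[unfolded p_def])
    \<comment> \<open>If \<open>w\<close> involves the empty list, \<open>hd []\<close> may add a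
      spurious degree. This is harmless: \<open>p\<close> ignores that list, and its coefficient is
      handled by \<open>nil\<close>.\<close>
    define I where "I = (\<lambda>\<sigma>. \<tau> (hd \<sigma>)) ` keys w"
    have "finite I" unfolding I_def by simp
    have out: "p k w = 0" if "k \<notin> I" for k
      by (rule poly_mapping_eqI) (use that in \<open>auto simp: p_def lookup_subchain I_def in_keys_iff\<close>)
    \<comment> \<open>One below the support, so that the induction starts at a zero piece. For empty
      \<open>I\<close> the value is arbitrary, but then every piece is zero.\<close>
    define b where "b = Min I - 1"
    have b: "b < i" if "i \<in> I" for i
      using Min_le[OF \<open>finite I\<close> that] by (simp add: b_def)
    have p_in: "p k w \<in> rel N" for k
    proof (cases "k \<le> b")
      case True
      then have "k \<notin> I" using b by fastforce
      then show ?thesis by (simp add: out rel_zero)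
    next
      case False
      then have "b \<le> k" by simp
      then show ?thesis
      proof (induction k rule: int_ge_induct)
        case base
        have "b \<notin> I" using b by fastforce
        then show ?case by (simp add: out rel_zero)
      next
        case (step i)
        have "p (i + 1) w = (p (i + 1) w - \<theta> (p i w)) + \<theta> (p i w)" by simp
        then show ?case
          using rel_add[OF p_step[of "i + 1"] \<theta>_rel[OF step.IH]] by simp
      qed
    qed
    have w_eq: "w = single [] (lookup w []) + (\<Sum>k\<in>I. p k w)"
    proof (rule poly_mapping_eqI)
      fix \<sigma>
      show "lookup w \<sigma> =
          lookup (single [] (lookup w []) + (\<Sum>k\<in>I. p k w)) \<sigma>"
      proof (cases "\<sigma> = []")
        case True
        then show ?thesis by (simp add: lookup_add lookup_sum p_def lookup_subchain)
      next
        case False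
        then have "(\<Sum>k\<in>I. lookup (p k w) \<sigma>) =
            (\<Sum>k\<in>I. if \<tau> (hd \<sigma>) = k then lookup w \<sigma> else 0)"
          by (simp add: p_def lookup_subchain)
        also have "\<dots> = lookup w \<sigma>"
          using \<open>finite I\<close> by (auto simp: I_def in_keys_iff)
        finally show ?thesis using False by (simp add: lookup_add lookup_sum lookup_single when_def)
      qed
    qed
    show ?thesis
      by (rule ssubst[where P = "\<lambda>x. x \<in> rel N", OF w_eq]) (intro rel_add nil rel_sum p_in)
  qed

  \<comment> \<open>The diagram chase: applying \<open>bd\<close> to
    \<open>r + (w - \<theta> w)\<close> shows by injectivity that \<open>w\<close> is a cycle modulo
    \<open>rel N\<close>, hence bounded by some \<open>w'\<close>. Subtracting
    \<open>w' - \<theta> w'\<close>, a relation for the whole group, turns \<open>z\<close> into a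
    cycle modulo \<open>rel N\<close>.\<close>
  have "\<exists>u. z - bd u \<in> rel UNIV" if z: "bd z \<in> rel UNIV" for z
  proof -
    obtain r w where r: "r \<in> rel N" "bd z = r + (w - \<theta> w)" using rel_UNIV[OF z] by blast
    have "bd r + (bd w - \<theta> (bd w)) = 0"
      using arg_cong[OF r(2), of bd] by (simp add: bd_bd \<theta>_bd)
    then have "bd w - \<theta> (bd w) = - bd r" by (rule minus_unique[symmetric])
    then have "bd w - \<theta> (bd w) \<in> rel N" by (simp add: rel_uminus bd_rel r)
    then have "bd w \<in> rel N" by (rule inj)
    then obtain w' where w': "w - bd w' \<in> rel N"
      using ker unfolding rel_acyclic_def N_def by blast
    have "bd (z - (w' - \<theta> w')) = r + ((w - bd w') - \<theta> (w - bd w'))"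
      by (simp add: r(2) \<theta>_bd additive.diff[OF \<theta>_add])
    also have "\<dots> \<in> rel N" by (intro rel_add rel_diff \<theta>_rel r w')
    finally obtain u where "z - (w' - \<theta> w') - bd u \<in> rel N"
      using ker unfolding rel_acyclic_def N_def by blast
    then have "z - (w' - \<theta> w') - bd u \<in> rel UNIV" by (rule rel_mono) simp
    from rel_diff[OF this coinv[of w']] show ?thesis by (intro exI[of _ u]) (simp add: algebra_simps)
  qed
  moreover have "single [] m \<in> rel UNIV" for m using rel_mono[OF nil] by blast
  ultimately show ?thesis unfolding rel_acyclic_def by blast
qed

end

section \<open>The inhomogeneous bar complex\<close>

text \<open>The bar tuple [x_1|...|x_n] with base point \<open>g\<close> becomes the homogeneous
  simplex (g, g x_1, g x_1 x_2, ...), which has one more entry.\<close>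

primrec psums :: "'a::group_add \<Rightarrow> 'a list \<Rightarrow> 'a list" where
  "psums g [] = [g]"
| "psums g (x # xs) = g # psums (g + x) xs"

primrec diffs :: "'a::group_add \<Rightarrow> 'a list \<Rightarrow> 'a list" where
  "diffs g [] = []"
| "diffs g (h # hs) = (- g + h) # diffs h hs"

lemma length_psums [simp]: "length (psums g xs) = Suc (length xs)"
  by (induction xs arbitrary: g) auto

lemma map_plus_psums: "map ((+) n) (psums g xs) = psums (n + g) xs"
  by (induction xs arbitrary: g) (auto simp: add.assoc)

lemma psums_diffs: "psums g (diffs g hs) = g # hs"
proof (induction hs arbitrary: g)
  case (Cons h hs)
  have "g + (- g + h) = h" by (rule add_minus_cancel)
  then show ?case using Cons.IH[of h] by simp
qed simp

lemma tl_psums: "\<exists>hs. psums g xs = g # hs \<and> diffs g hs = xs"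
proof (induction xs arbitrary: g)
  case (Cons x xs)
  obtain hs where "psums (g + x) xs = (g + x) # hs" "diffs (g + x) hs = xs"
    using Cons.IH by blast
  moreover have "- g + (g + x) = x" by (rule minus_add_cancel)
  ultimately show ?case by auto
qed simp

lemma diffs_map_plus: "diffs (n + g) (map ((+) n) hs) = diffs g hs"
proof (induction hs arbitrary: g)
  case (Cons h hs)
  have "- (n + g) + (n + h) = - g + h"
    by (simp only: minus_add add.assoc minus_add_cancel)
  then show ?case using Cons.IH by simp
qed simp

definition omit :: "nat \<Rightarrow> 'a list \<Rightarrow> 'a list" where
  "omit i \<sigma> = take i \<sigma> @ drop (Suc i) \<sigma>"

lemma bdl_eq_sum_omit:
  "bdl \<sigma> m = (\<Sum>i<length \<sigma>. single (omit i \<sigma>) ((- 1) ^ i * (m :: 'm::ring_1)))"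
proof (induction \<sigma>)
  case (Cons v \<sigma>)
  show ?case
    by (simp add: Cons.IH sum.lessThan_Suc_shift omit_def additive.sum[OF additive_cons]
        single_uminus sum_negf del: sum.lessThan_Suc)
qed simp

definition face :: "nat \<Rightarrow> 'a::group_add list \<Rightarrow> 'a list" where
  "face i xs =
     (if i = 0 then tl xs
      else if i = length xs then butlast xs
      else take (i - 1) xs @ (xs ! (i - 1) + xs ! i) # drop (Suc i) xs)"

lemma length_face: "xs \<noteq> [] \<Longrightarrow> i \<le> length xs \<Longrightarrow> length (face i xs) = length xs - 1"
  by (auto simp: face_def)

lemma face_Cons: "0 < j \<Longrightarrow> face (Suc j) (x # xs) = x # face j xs"
  by (cases j) (auto simp: face_def)

text \<open>Deleting an inner vertex merges two neighbouring increments, deleting the last vertex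
  drops one. Index 0 is excluded: it moves the base point, and that is where the action on
  coefficients enters.\<close>

lemma omit_psums: "0 < i \<Longrightarrow> i \<le> length xs \<Longrightarrow> omit i (psums g xs) = psums g (face i xs)"
proof (induction xs arbitrary: i g)
  case (Cons x xs)
  obtain j where j: "i = Suc j" using Cons.prems by (cases i) auto
  show ?case
  proof (cases "j = 0")
    case True
    show ?thesis by (cases xs) (auto simp: j True omit_def face_def add.assoc)
  next
    case False
    then show ?thesis
      using Cons.IH[of j "g + x"] Cons.prems by (auto simp: j omit_def face_Cons)
  qed
qed simp

context right_coefficients
begin

definition coef :: "nat \<Rightarrow> 'a list \<Rightarrow> 'm \<Rightarrow> 'm" where
  "coef i xs m = (if i = 0 then m * \<rho> (hd xs) else m)"

text \<open>The empty tuple has its own clause because the bar complex, unlike the augmented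
  homogeneous one, has boundary zero in degree 0; the sum would contribute a term with
  \<open>hd []\<close>.\<close>

definition bar_bdl :: "'a list \<Rightarrow> 'm \<Rightarrow> ('a list \<Rightarrow>\<^sub>0 'm)" where
  "bar_bdl xs m = (if xs = [] then 0
     else \<Sum>i\<le>length xs. single (face i xs) ((- 1) ^ i * coef i xs m))"

definition bar_bd :: "('a list \<Rightarrow>\<^sub>0 'm) \<Rightarrow> ('a list \<Rightarrow>\<^sub>0 'm)" where
  "bar_bd = extend bar_bdl"

definition hom_lift :: "('a list \<Rightarrow>\<^sub>0 'm) \<Rightarrow> ('a list \<Rightarrow>\<^sub>0 'm)" where
  "hom_lift = extend (\<lambda>xs m. single (psums 0 xs) m)"

text \<open>Moving a simplex to base point 0 costs the factor \<open>\<rho> g\<close> prescribed by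
  the relations. The empty list, which carries the augmentation, goes to 0.\<close>

definition inhom :: "('a list \<Rightarrow>\<^sub>0 'm) \<Rightarrow> ('a list \<Rightarrow>\<^sub>0 'm)" where
  "inhom = extend (\<lambda>\<sigma> m. case \<sigma> of [] \<Rightarrow> 0 | g # hs \<Rightarrow> single (diffs g hs) (m * \<rho> g))"

lemma additive_coef: "additive (coef i xs)"
  by (cases "i = 0") (auto simp: coef_def Modules.additive_def distrib_right)

lemma additive_bar_bdl: "additive (bar_bdl xs)"
  by (rule additiveI)
     (auto simp: bar_bdl_def additive.add[OF additive_coef] distrib_left single_add sum.distrib)

lemma additive_bar_bd: "additive bar_bd"
  unfolding bar_bd_def by (intro additive_extend additive_bar_bdl)

lemma bar_bd_single [simp]: "bar_bd (single xs m) = bar_bdl xs m"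
  unfolding bar_bd_def by (rule extend_single[OF additive_bar_bdl])

lemma additive_hom_lift: "additive hom_lift"
  unfolding hom_lift_def by (intro additive_extend additive_single)

lemma hom_lift_single [simp]: "hom_lift (single xs m) = single (psums 0 xs) m"
  unfolding hom_lift_def
  by (rule extend_single[where f = "\<lambda>xs m. single (psums 0 xs) m", OF additive_single])

lemma additive_inhom_aux:
  "additive (\<lambda>m. case \<sigma> of [] \<Rightarrow> 0 | g # hs \<Rightarrow> single (diffs g hs) (m * \<rho> g))"
  by (cases \<sigma>) (auto simp: Modules.additive_def distrib_right single_add)

lemma additive_inhom: "additive inhom"
  unfolding inhom_def by (intro additive_extend additive_inhom_aux)

lemma inhom_single [simp]: "inhom (single \<sigma> m) =
    (case \<sigma> of [] \<Rightarrow> 0 | g # hs \<Rightarrow> single (diffs g hs) (m * \<rho> g))"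
  unfolding inhom_def
  by (rule extend_single[where f = "\<lambda>\<sigma> m. case \<sigma> of [] \<Rightarrow> 0
    | g # hs \<Rightarrow> single (diffs g hs) (m * \<rho> g)", OF additive_inhom_aux])

lemma inhom_psums: "inhom (single (psums g xs) m) = single xs (m * \<rho> g)"
  using tl_psums[of g xs] by auto

lemma inhom_hom_lift: "inhom (hom_lift c) = c"
  by (rule additive_eqI[where F = "\<lambda>c. inhom (hom_lift c)" and G = "\<lambda>c. c"])
     (auto intro: additive_compose additive_inhom additive_hom_lift additive_id simp: inhom_psums simp del: inhom_single)

lemma inhom_rel: "z \<in> rel UNIV \<Longrightarrow> inhom z = 0"
proof (induction rule: rel.induct)
  case (rel_gen n \<sigma> m)
  show ?case
    by (cases \<sigma>) (auto simp: additive.diff[OF additive_inhom] diffs_map_plus \<rho>_add mult.assoc)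
qed (auto simp: additive.zero[OF additive_inhom] additive.diff[OF additive_inhom])

text \<open>Face 0 of a simplex based at 0 is based at the first entry of the tuple, and
  \<open>inhom\<close> turns this base point into the factor in \<open>coef\<close>. All other faces
  keep base point 0.\<close>

lemma inhom_bd_hom_lift: "inhom (bd (hom_lift c)) = bar_bd c"
proof (rule additive_eqI[where F = "\<lambda>c. inhom (bd (hom_lift c))" and G = bar_bd])
  fix xs m
  show "inhom (bd (hom_lift (single xs m))) = bar_bd (single xs m)"
  proof (cases xs)
    case (Cons x ys)
    have "inhom (bd (hom_lift (single xs m))) =
        (\<Sum>i\<le>length xs. inhom (single (omit i (psums 0 xs)) ((- 1) ^ i * m)))"
      by (simp add: bdl_eq_sum_omit additive.sum[OF additive_inhom] lessThan_Suc_atMost del: inhom_single)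
    also have "\<dots> = (\<Sum>i\<le>length xs. single (face i xs) ((- 1) ^ i * coef i xs m))"
    proof (rule sum.cong)
      fix i assume i: "i \<in> {..length xs}"
      show "inhom (single (omit i (psums 0 xs)) ((- 1) ^ i * m)) =
          single (face i xs) ((- 1) ^ i * coef i xs m)"
      proof (cases "i = 0")
        case True
        then show ?thesis by (simp add: Cons omit_def face_def coef_def inhom_psums del: inhom_single)
      next
        case False
        then show ?thesis using i by (simp add: omit_psums coef_def inhom_psums del: inhom_single)
      qed
    qed simp
    finally show ?thesis using Cons by (simp add: bar_bdl_def)
  qed (simp add: bar_bdl_def additive.zero[OF additive_inhom])
qed (intro additive_compose[OF additive_inhom] additive_compose[OF additive_bd] additive_hom_lift additive_bar_bd)+

context
  assumes acyclic: "rel_acyclic UNIV"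
begin

text \<open>A nonempty list differs from its copy based at 0 by one translation relation. The empty
  list is forgotten by \<open>inhom\<close>, but is a relation by the second clause of
  \<open>rel_acyclic\<close>.\<close>

lemma hom_lift_inhom: "hom_lift (inhom c) - c \<in> rel UNIV"
proof (rule additive_in_rel[where F = "\<lambda>c. hom_lift (inhom c) - c"])
  fix \<sigma> m
  show "hom_lift (inhom (single \<sigma> m)) - single \<sigma> m \<in> rel UNIV"
  proof (cases \<sigma>)
    case Nil
    then show ?thesis
      using acyclic rel_uminus by (simp add: rel_acyclic_def additive.zero[OF additive_hom_lift])
  next
    case (Cons g hs)
    have "map ((+) g) (psums 0 (diffs g hs)) = \<sigma>"
      by (simp add: map_plus_psums psums_diffs Cons)
    with rel_gen[of g UNIV "psums 0 (diffs g hs)" m] rel_uminus show ?thesis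
      by (fastforce simp: Cons)
  qed
qed (intro additive_diff additive_compose[OF additive_hom_lift] additive_inhom additive_id)

lemma inhom_bd_hom_lift_inhom: "inhom (bd (hom_lift (inhom c))) = inhom (bd c)"
  using inhom_rel[OF bd_rel[OF hom_lift_inhom[of c]]] by (simp add: additive.diff[OF additive_inhom])

lemma bar_bd_bar_bd: "bar_bd (bar_bd c) = 0"
  by (metis inhom_bd_hom_lift inhom_bd_hom_lift_inhom bd_bd additive.zero[OF additive_inhom])

text \<open>The lift of a bar cycle has a boundary that \<open>inhom\<close> kills, and which is
  therefore a relation. Acyclicity of the coinvariants provides a filling, and \<open>inhom\<close>
  brings it back.\<close>

lemma bar_exact:
  assumes "bar_bd c = 0"
  shows "\<exists>v. c = bar_bd v"
proof -
  have "hom_lift (inhom (bd (hom_lift c))) = 0"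
    by (simp add: inhom_bd_hom_lift assms additive.zero[OF additive_hom_lift])
  with hom_lift_inhom[of "bd (hom_lift c)"] have "bd (hom_lift c) \<in> rel UNIV"
    using rel_uminus by fastforce
  then obtain u where u: "hom_lift c - bd u \<in> rel UNIV"
    using acyclic unfolding rel_acyclic_def by blast
  have "c = inhom (bd u)"
    using inhom_rel[OF u] by (simp add: additive.diff[OF additive_inhom] inhom_hom_lift)
  also have "\<dots> = bar_bd (inhom u)"
    by (simp only: inhom_bd_hom_lift[symmetric] inhom_bd_hom_lift_inhom)
  finally show ?thesis by blast
qed

end

end

text \<open>The bar complex of \<open>G\<close> with coefficients in \<open>M\<close>, in coordinates: \<open>\<gamma>\<close> and \<open>\<mu>\<close>
  identify a group written additively and a unital ring with the carriers of \<open>G\<close> and \<open>M\<close>.\<close>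

locale bar_coordinates = right_coefficients \<rho>
  for \<rho> :: "'a::group_add \<Rightarrow> 'm::ring_1" +
  fixes G :: "('g, 'x) monoid_scheme" and M :: "('c, 'y) ring_scheme"
    and act :: "'c \<Rightarrow> 'g \<Rightarrow> 'c" and \<gamma> :: "'a \<Rightarrow> 'g" and \<mu> :: "'m \<Rightarrow> 'c"
  assumes abelian: "abelian_group M"
    and \<gamma>_bij: "bij_betw \<gamma> UNIV (carrier G)"
    and \<gamma>_add: "\<gamma> (x + y) = \<gamma> x \<otimes>\<^bsub>G\<^esub> \<gamma> y"
    and \<mu>_bij: "bij_betw \<mu> UNIV (carrier M)"
    and \<mu>_add: "\<mu> (a + b) = \<mu> a \<oplus>\<^bsub>M\<^esub> \<mu> b"
    and act: "act (\<mu> a) (\<gamma> x) = \<mu> (a * \<rho> x)"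
begin

section \<open>Transport of the bar complex along the coordinates\<close>

sublocale M: abelian_group M by (rule abelian)

definition \<delta> :: "'g \<Rightarrow> 'a" where "\<delta> = inv_into UNIV \<gamma>"

lemma inj_\<gamma>: "inj \<gamma>" and inj_\<mu>: "inj \<mu>"
  using \<gamma>_bij \<mu>_bij by (auto simp: bij_betw_def)

lemma \<gamma>_in [simp]: "\<gamma> x \<in> carrier G" and \<mu>_in [simp]: "\<mu> a \<in> carrier M"
  using \<gamma>_bij \<mu>_bij by (auto simp: bij_betw_def)

lemma \<delta>_\<gamma> [simp]: "\<delta> (\<gamma> x) = x"
  unfolding \<delta>_def using inj_\<gamma> by (rule inv_into_f_f) simp

lemma \<gamma>_\<delta> [simp]: "g \<in> carrier G \<Longrightarrow> \<gamma> (\<delta> g) = g"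
  unfolding \<delta>_def using \<gamma>_bij by (intro f_inv_into_f) (simp add: bij_betw_def)

lemma \<mu>_zero [simp]: "\<mu> 0 = \<zero>\<^bsub>M\<^esub>"
  using \<mu>_add[of 0 0] by (metis M.add.l_cancel_one \<mu>_in add_0)

lemma \<mu>_eq_zero_iff [simp]: "\<mu> a = \<zero>\<^bsub>M\<^esub> \<longleftrightarrow> a = 0"
  using inj_\<mu> by (metis \<mu>_zero injD)

lemma \<mu>_uminus: "\<mu> (- a) = \<ominus>\<^bsub>M\<^esub> \<mu> a"
  by (metis M.add.inv_equality M.minus_equality \<mu>_add \<mu>_in \<mu>_zero ab_left_minus)

lemma \<mu>_sum: "finite A \<Longrightarrow> (\<Oplus>\<^bsub>M\<^esub>x\<in>A. \<mu> (f x)) = \<mu> (sum f A)"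
  by (induction A rule: finite_induct) (auto simp: M.finsum_insert \<mu>_add)

lemma add_pow_\<mu>: "add_pow M ((- 1 :: int) ^ i) (\<mu> a) = \<mu> ((- 1) ^ i * a)"
proof (cases "even i")
  case True
  have "add_pow M (1 :: int) (\<mu> a) = \<mu> a"
    by (simp add: add_pow_int_ge)
  with True show ?thesis by simp
next
  case False
  have "add_pow M (- 1 :: int) (\<mu> a) = \<ominus>\<^bsub>M\<^esub> \<mu> a"
    by (simp add: add_pow_int_lt)
  with False show ?thesis by (simp add: \<mu>_uminus)
qed

lemma bij_tuples: "bij_betw (map \<gamma>) {\<sigma>. length \<sigma> = n} (tuples G n)"
proof (rule bij_betwI[where g = "map \<delta>"])
  show "map \<gamma> (map \<delta> ys) = ys" if "ys \<in> tuples G n" for ys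
    using that by (auto simp: tuples_def intro!: map_idI)
qed (auto simp: tuples_def o_def)

text \<open>Only lists of length \<open>n\<close> are read off, so one type of chains of mixed
  degree serves all the chain groups.\<close>

definition coord :: "nat \<Rightarrow> ('a list \<Rightarrow>\<^sub>0 'm) \<Rightarrow> 'g list \<Rightarrow> 'c" where
  "coord n c = (\<lambda>ys\<in>tuples G n. \<mu> (lookup c (map \<delta> ys)))"

lemma map_\<gamma>_in: "length \<sigma> = n \<Longrightarrow> map \<gamma> \<sigma> \<in> tuples G n"
  by (auto simp: tuples_def)

lemma coord_map: "length \<sigma> = n \<Longrightarrow> coord n c (map \<gamma> \<sigma>) = \<mu> (lookup c \<sigma>)"
  by (simp add: coord_def map_\<gamma>_in o_def)

lemma group_add_monoid: "group (add_monoid M)"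
  by (rule M.a_group)

lemma carrier_chains: "carrier (bar_chains G M n) =
    {x \<in> tuples G n \<rightarrow>\<^sub>E carrier M. finite {i \<in> tuples G n. x i \<noteq> \<zero>\<^bsub>M\<^esub>}}"
  unfolding bar_chains_def by (subst carrier_sum_group) (auto simp: group_add_monoid)

lemma support_coord: "{xs \<in> tuples G n. coord n c xs \<noteq> \<zero>\<^bsub>M\<^esub>} =
    map \<gamma> ` {\<sigma> \<in> keys c. length \<sigma> = n}" (is "?L = ?R")
proof (intro Set.set_eqI iffI)
  fix xs assume xs: "xs \<in> ?L"
  then obtain \<sigma> where "length \<sigma> = n" "xs = map \<gamma> \<sigma>"
    using bij_tuples[of n] by (auto simp: bij_betw_def)
  then show "xs \<in> ?R" using xs by (auto simp: coord_map in_keys_iff)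
next
  fix xs assume "xs \<in> ?R"
  then show "xs \<in> ?L" by (auto simp: coord_map map_\<gamma>_in in_keys_iff)
qed

lemma coord_in: "coord n c \<in> carrier (bar_chains G M n)"
  unfolding carrier_chains mem_Collect_eq support_coord by (auto simp: coord_def)

text \<open>That the preimage lives in a single degree matters for cycles: the cycle condition sees
  one degree of \<open>bar_bd c\<close>, and this purity makes all others vanish.\<close>

lemma coord_surj:
  assumes "d \<in> carrier (bar_chains G M n)"
  shows "\<exists>c. (\<forall>\<sigma>\<in>keys c. length \<sigma> = n) \<and> d = coord n c"
proof -
  define S where "S = {xs \<in> tuples G n. d xs \<noteq> \<zero>\<^bsub>M\<^esub>}"
  have fin: "finite S" and d: "d \<in> tuples G n \<rightarrow>\<^sub>E carrier M"
    using assms by (auto simp: carrier_chains S_def)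
  define b where "b ys = inv_into UNIV \<mu> (d ys)" for ys
  have b: "\<mu> (b ys) = d ys" if "ys \<in> tuples G n" for ys
    unfolding b_def using \<mu>_bij d that by (intro f_inv_into_f) (auto simp: bij_betw_def)
  define c where "c = (\<Sum>ys\<in>S. single (map \<delta> ys) (b ys))"
  have inj: "map \<delta> ys = map \<delta> zs \<longleftrightarrow> ys = zs" if "ys \<in> tuples G n" "zs \<in> tuples G n" for ys zs
  proof
    assume "map \<delta> ys = map \<delta> zs"
    then have "map \<gamma> (map \<delta> ys) = map \<gamma> (map \<delta> zs)" by (rule arg_cong)
    moreover have "map \<gamma> (map \<delta> xs) = xs" if "xs \<in> tuples G n" for xs
      using that by (auto simp: tuples_def intro!: map_idI)
    ultimately show "ys = zs" using that by simp
  qed simp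
  have "d = coord n c"
  proof
    fix ys
    show "d ys = coord n c ys"
    proof (cases "ys \<in> tuples G n")
      case True
      have "lookup c (map \<delta> ys) = (\<Sum>zs\<in>S. if zs = ys then b zs else 0)"
        unfolding c_def lookup_sum
        by (rule sum.cong) (use inj True in \<open>auto simp: lookup_single when_def S_def\<close>)
      also have "\<dots> = (if ys \<in> S then b ys else 0)" using fin by simp
      finally have "coord n c ys = (if ys \<in> S then d ys else \<zero>\<^bsub>M\<^esub>)"
        using True b by (simp add: coord_def)
      then show ?thesis using True by (auto simp: S_def)
    next
      case False
      then show ?thesis by (simp add: coord_def PiE_arb[OF d False])
    qed
  qed
  moreover have "length \<sigma> = n" if "\<sigma> \<in> keys c" for \<sigma>
  proof -
    have "\<sigma> \<in> (\<Union>ys\<in>S. keys (single (map \<delta> ys) (b ys)))"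
      using that unfolding c_def by (rule subsetD[OF Poly_Mapping.keys_sum, rotated])
    then show ?thesis by (auto simp: S_def tuples_def split: if_splits)
  qed
  ultimately show ?thesis by blast
qed

lemma coord_add: "coord n (a + b) = coord n a \<otimes>\<^bsub>bar_chains G M n\<^esub> coord n b"
  by (auto simp: bar_chains_def coord_def lookup_add \<mu>_add)

lemma coord_zero: "coord n 0 = \<one>\<^bsub>bar_chains G M n\<^esub>"
  by (auto simp: bar_chains_def coord_def)

lemma group_chains: "group (bar_chains G M n)"
  unfolding bar_chains_def by (rule sum_group) (rule group_add_monoid)

lemma coord_uminus: "coord n (- a) = inv\<^bsub>bar_chains G M n\<^esub> coord n a"
  by (rule group.inv_equality[OF group_chains, symmetric])
     (auto simp: coord_in coord_add[symmetric] coord_zero)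

lemma coord_eq_one:
  assumes "coord n c = \<one>\<^bsub>bar_chains G M n\<^esub>" "length \<sigma> = n"
  shows "lookup c \<sigma> = 0"
  using arg_cong[OF assms(1), of "\<lambda>f. f (map \<gamma> \<sigma>)"] map_\<gamma>_in[OF assms(2)]
  by (simp add: coord_map[OF assms(2)] bar_chains_def)

lemma bar_face_map: "xs \<noteq> [] \<Longrightarrow> i \<le> length xs \<Longrightarrow> bar_face G i (map \<gamma> xs) = map \<gamma> (face i xs)"
  by (auto simp: bar_face_def face_def map_tl map_butlast take_map drop_map \<gamma>_add)

lemma bar_coeff_map: "xs \<noteq> [] \<Longrightarrow> bar_coeff act i (map \<gamma> xs) (\<mu> a) = \<mu> (coef i xs a)"
  by (auto simp: bar_coeff_def coef_def hd_map act)

lemma bar_bd_eq: "bar_bd c = (\<Sum>xs\<in>keys c. bar_bdl xs (lookup c xs))"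
  by (simp add: bar_bd_def extend_def)

text \<open>At \<open>map \<gamma> \<tau>\<close> both sides collect one contribution for each
  supporting list and each index whose face is \<open>\<tau>\<close>; injectivity of
  \<open>\<gamma>\<close> matches them.\<close>

lemma bar_boundary_coord: "bar_boundary G M act n (coord (Suc n) c) = coord n (bar_bd c)"
proof
  fix ys
  show "bar_boundary G M act n (coord (Suc n) c) ys = coord n (bar_bd c) ys"
  proof (cases "ys \<in> tuples G n")
    case True
    then obtain \<tau> where \<tau>: "length \<tau> = n" "ys = map \<gamma> \<tau>"
      using bij_tuples[of n] by (auto simp: bij_betw_def)
    define K where "K = {\<sigma> \<in> keys c. length \<sigma> = Suc n}"
    have fin: "finite K" by (simp add: K_def)
    define h where "h \<sigma> = (\<Sum>i | i \<le> Suc n \<and> face i \<sigma> = \<tau>.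
        (- 1) ^ i * coef i \<sigma> (lookup c \<sigma>))" for \<sigma>
    have inner: "(\<Oplus>\<^bsub>M\<^esub>i\<in>{i \<in> {..Suc n}. bar_face G i (map \<gamma> \<sigma>) = ys}.
        add_pow M ((- 1 :: int) ^ i) (bar_coeff act i (map \<gamma> \<sigma>) (coord (Suc n) c (map \<gamma> \<sigma>)))) = \<mu> (h \<sigma>)"
      if \<sigma>: "length \<sigma> = Suc n" for \<sigma>
    proof -
      have ne: "\<sigma> \<noteq> []" using \<sigma> by auto
      have set_eq: "{i \<in> {..Suc n}. bar_face G i (map \<gamma> \<sigma>) = ys} = {i. i \<le> Suc n \<and> face i \<sigma> = \<tau>}"
        using \<sigma> ne by (auto simp: bar_face_map \<tau> inj_map_eq_map[OF inj_\<gamma>])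
      show ?thesis
        unfolding set_eq h_def
        by (simp add: coord_map[OF \<sigma>] bar_coeff_map[OF ne] add_pow_\<mu> \<mu>_sum)
    qed
    have "bar_boundary G M act n (coord (Suc n) c) ys =
        (\<Oplus>\<^bsub>M\<^esub>xs\<in>map \<gamma> ` K. \<Oplus>\<^bsub>M\<^esub>i\<in>{i \<in> {..Suc n}. bar_face G i xs = ys}.
           add_pow M ((- 1 :: int) ^ i) (bar_coeff act i xs (coord (Suc n) c xs)))"
      using True by (simp add: bar_boundary_def support_coord K_def)
    also have "\<dots> = (\<Oplus>\<^bsub>M\<^esub>\<sigma>\<in>K. \<Oplus>\<^bsub>M\<^esub>i\<in>{i \<in> {..Suc n}. bar_face G i (map \<gamma> \<sigma>) = ys}.
           add_pow M ((- 1 :: int) ^ i) (bar_coeff act i (map \<gamma> \<sigma>) (coord (Suc n) c (map \<gamma> \<sigma>))))"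
    proof (rule M.finsum_reindex)
      show "(\<lambda>xs. \<Oplus>\<^bsub>M\<^esub>i\<in>{i \<in> {..Suc n}. bar_face G i xs = ys}. add_pow M ((- 1 :: int) ^ i)
          (bar_coeff act i xs (coord (Suc n) c xs))) \<in> map \<gamma> ` K \<rightarrow> carrier M"
      proof
        fix xs assume "xs \<in> map \<gamma> ` K"
        then obtain \<sigma> where \<sigma>: "xs = map \<gamma> \<sigma>" "length \<sigma> = Suc n" by (auto simp: K_def)
        show "(\<Oplus>\<^bsub>M\<^esub>i\<in>{i \<in> {..Suc n}. bar_face G i xs = ys}. add_pow M ((- 1 :: int) ^ i)
          (bar_coeff act i xs (coord (Suc n) c xs))) \<in> carrier M"
          unfolding \<sigma>(1) inner[OF \<sigma>(2)] by (rule \<mu>_in)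
      qed
    qed (auto simp: inj_on_def inj_map_eq_map[OF inj_\<gamma>])
    also have "\<dots> = (\<Oplus>\<^bsub>M\<^esub>\<sigma>\<in>K. \<mu> (h \<sigma>))"
    proof (rule M.finsum_cong')
      fix \<sigma> assume "\<sigma> \<in> K"
      then show "(\<Oplus>\<^bsub>M\<^esub>i\<in>{i \<in> {..Suc n}. bar_face G i (map \<gamma> \<sigma>) = ys}. add_pow M ((- 1 :: int) ^ i)
          (bar_coeff act i (map \<gamma> \<sigma>) (coord (Suc n) c (map \<gamma> \<sigma>)))) = \<mu> (h \<sigma>)"
        by (intro inner) (simp add: K_def)
    qed auto
    also have "\<dots> = \<mu> (sum h K)" using fin by (rule \<mu>_sum)
    also have "sum h K = lookup (bar_bd c) \<tau>"
    proof -
      have "lookup (bar_bd c) \<tau> =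
          (\<Sum>\<sigma>\<in>keys c. lookup (bar_bdl \<sigma> (lookup c \<sigma>)) \<tau>)"
        by (simp add: bar_bd_eq lookup_sum)
      also have "\<dots> = (\<Sum>\<sigma>\<in>K. lookup (bar_bdl \<sigma> (lookup c \<sigma>)) \<tau>)"
      proof (rule sum.mono_neutral_right)
        show "\<forall>\<sigma>\<in>keys c - K. lookup (bar_bdl \<sigma> (lookup c \<sigma>)) \<tau> = 0"
        proof
          fix \<sigma> assume "\<sigma> \<in> keys c - K"
          then have "length \<sigma> \<noteq> Suc n" by (auto simp: K_def)
          then have "face i \<sigma> \<noteq> \<tau>" if "\<sigma> \<noteq> []" "i \<le> length \<sigma>" for i
            using length_face[OF that] \<tau>(1) that by (cases \<sigma>) auto
          then show "lookup (bar_bdl \<sigma> (lookup c \<sigma>)) \<tau> = 0"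
            by (auto simp: bar_bdl_def lookup_sum lookup_single when_def)
        qed
      qed (auto simp: K_def)
      also have "\<dots> = sum h K"
      proof (rule sum.cong)
        fix \<sigma> assume "\<sigma> \<in> K"
        then have \<sigma>: "length \<sigma> = Suc n" "\<sigma> \<noteq> []" by (auto simp: K_def)
        show "lookup (bar_bdl \<sigma> (lookup c \<sigma>)) \<tau> = h \<sigma>"
          using \<sigma> by (simp add: bar_bdl_def lookup_sum lookup_single when_def h_def sum.If_cases
              Int_def del: sum.atMost_Suc)
      qed simp
      finally show ?thesis by simp
    qed
    finally show ?thesis using True by (simp add: \<tau> coord_map)
  next
    case False
    then show ?thesis by (simp add: bar_boundary_def coord_def)
  qed
qed

lemma bar_bd_length:
  assumes "\<forall>\<sigma>\<in>keys c. length \<sigma> = Suc n" "\<sigma> \<in> keys (bar_bd c)"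
  shows "length \<sigma> = n"
proof -
  obtain \<tau> where \<tau>: "\<tau> \<in> keys c"
    "\<sigma> \<in> keys (bar_bdl \<tau> (lookup c \<tau>))"
    using subsetD[OF Poly_Mapping.keys_sum assms(2)[unfolded bar_bd_eq]] by blast
  then have len: "length \<tau> = Suc n" using assms(1) by blast
  then have "\<sigma> \<in> keys (\<Sum>i\<le>length \<tau>. single (face i \<tau>)
      ((- 1) ^ i * coef i \<tau> (lookup c \<tau>)))"
    using \<tau>(2) unfolding bar_bdl_def by (auto split: if_splits)
  then obtain i where "i \<le> length \<tau>" "\<sigma> \<in> keys (single (face i \<tau>)
      ((- 1) ^ i * coef i \<tau> (lookup c \<tau>)))"
    by (blast dest: subsetD[OF Poly_Mapping.keys_sum])
  moreover have "\<tau> \<noteq> []" using len by auto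
  ultimately show ?thesis using length_face[of \<tau> i] len by (auto split: if_splits)
qed

lemma boundaries_eq: "bar_boundaries G M act n = {coord n (bar_bd v) | v. True}"
proof (intro Set.set_eqI iffI)
  fix x assume "x \<in> bar_boundaries G M act n"
  then obtain d where d: "d \<in> carrier (bar_chains G M (Suc n))" "x = bar_boundary G M act n d"
    unfolding bar_boundaries_def by blast
  from coord_surj[OF d(1)] obtain c where "d = coord (Suc n) c" by blast
  then show "x \<in> {coord n (bar_bd v) | v. True}" using d(2) bar_boundary_coord by blast
next
  fix x assume "x \<in> {coord n (bar_bd v) | v. True}"
  then obtain v where "x = coord n (bar_bd v)" by blast
  then have "x = bar_boundary G M act n (coord (Suc n) v)" by (simp add: bar_boundary_coord)
  then show "x \<in> bar_boundaries G M act n" unfolding bar_boundaries_def using coord_in by blast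
qed

text \<open>Cycles and boundaries coincide, so the homology group is a group modulo itself.\<close>

theorem trivial_group_homology:
  assumes acyclic: "rel_acyclic UNIV"
  shows "trivial_group (group_homology G M act n)"
proof -
  have sub: "bar_boundaries G M act n \<subseteq> bar_cycles G M act n"
  proof
    fix x assume "x \<in> bar_boundaries G M act n"
    then obtain v where x: "x = coord n (bar_bd v)" unfolding boundaries_eq by blast
    show "x \<in> bar_cycles G M act n"
    proof (cases n)
      case 0
      then show ?thesis by (simp add: x coord_in bar_cycles_def)
    next
      case (Suc k)
      then show ?thesis
        by (simp add: x bar_cycles_def kernel_def coord_in bar_boundary_coord
            bar_bd_bar_bd[OF acyclic] coord_zero)
    qed
  qed
  have sup: "bar_cycles G M act n \<subseteq> bar_boundaries G M act n"
  proof
    fix x assume x: "x \<in> bar_cycles G M act n"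
    then have "x \<in> carrier (bar_chains G M n)"
      by (cases n) (auto simp: bar_cycles_def kernel_def)
    then obtain c where c: "\<forall>\<sigma>\<in>keys c. length \<sigma> = n" "x = coord n c"
      using coord_surj by blast
    have "bar_bd c = 0"
    proof (cases n)
      case 0
      then have "bar_bdl \<sigma> (lookup c \<sigma>) = 0" if "\<sigma> \<in> keys c" for \<sigma>
        using c(1) that by (simp add: bar_bdl_def)
      then show ?thesis by (simp add: bar_bd_eq)
    next
      case (Suc k)
      have one: "coord k (bar_bd c) = \<one>\<^bsub>bar_chains G M k\<^esub>"
        using x by (simp add: Suc bar_cycles_def kernel_def c(2) bar_boundary_coord)
      show ?thesis
      proof (rule poly_mapping_eqI)
        fix \<sigma>
        show "lookup (bar_bd c) \<sigma> = lookup 0 \<sigma>"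
          using coord_eq_one[OF one] bar_bd_length[of c k \<sigma>] c(1) Suc by (auto simp: in_keys_iff)
      qed
    qed
    then show "x \<in> bar_boundaries G M act n"
      using bar_exact[OF acyclic] c(2) unfolding boundaries_eq by blast
  qed
  have eq: "bar_cycles G M act n = bar_boundaries G M act n" using sub sup by blast
  have "subgroup (bar_boundaries G M act n) (bar_chains G M n)"
  proof (rule group.subgroupI[OF group_chains])
    show "bar_boundaries G M act n \<subseteq> carrier (bar_chains G M n)"
      unfolding boundaries_eq using coord_in by blast
    show "bar_boundaries G M act n \<noteq> {}" unfolding boundaries_eq by blast
  next
    fix a assume "a \<in> bar_boundaries G M act n"
    then obtain v where "a = coord n (bar_bd v)" unfolding boundaries_eq by blast
    then have "inv\<^bsub>bar_chains G M n\<^esub> a = coord n (bar_bd (- v))"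
      by (simp add: coord_uminus[symmetric] additive.minus[OF additive_bar_bd])
    then show "inv\<^bsub>bar_chains G M n\<^esub> a \<in> bar_boundaries G M act n" unfolding boundaries_eq by blast
  next
    fix a b assume "a \<in> bar_boundaries G M act n" "b \<in> bar_boundaries G M act n"
    then obtain v w where "a = coord n (bar_bd v)" "b = coord n (bar_bd w)" unfolding boundaries_eq by blast
    then have "a \<otimes>\<^bsub>bar_chains G M n\<^esub> b = coord n (bar_bd (v + w))"
      by (simp add: coord_add additive.add[OF additive_bar_bd])
    then show "a \<otimes>\<^bsub>bar_chains G M n\<^esub> b \<in> bar_boundaries G M act n" unfolding boundaries_eq by blast
  qed
  then have "group (bar_chains G M n\<lparr>carrier := bar_boundaries G M act n\<rparr>)"
    using group_chains by (rule subgroup.subgroup_is_group)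
  moreover define Z where "Z = bar_chains G M n\<lparr>carrier := bar_boundaries G M act n\<rparr>"
  ultimately interpret Z: group Z by simp
  have H: "group_homology G M act n = Z Mod carrier Z"
    by (simp add: group_homology_def eq Z_def)
  have "group (group_homology G M act n)"
    unfolding H by (rule normal.factorgroup_is_group[OF Z.normal_self])
  moreover have "carrier Z #>\<^bsub>Z\<^esub> x = carrier Z" if "x \<in> carrier Z" for x
    using Z.coset_join2[OF that Z.subgroup_self that] .
  then have "carrier (group_homology G M act n) = {\<one>\<^bsub>group_homology G M act n\<^esub>}"
    unfolding H carrier_FactGroup using Z.one_closed by (auto simp: FactGroup_def)
  ultimately show ?thesis unfolding trivial_group_def by blast
qed

text \<open>The class of the coefficient 1 on the empty tuple vanishes. If \<open>T x\<close> is the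
  coefficient of a bounding chain at the tuple [x], this term has boundary
  \<open>T x * \<rho> x - T x\<close>.\<close>

theorem trivial_group_homology_0:
  assumes "trivial_group (group_homology G M act 0)"
  shows "\<exists>S T. finite S \<and> (\<Sum>s\<in>S. T s * (\<rho> s - 1)) = 1"
proof -
  define C where "C = bar_chains G M 0"
  interpret C: group C unfolding C_def by (rule group_chains)
  have H: "group_homology G M act 0 = C Mod bar_boundaries G M act 0"
    by (simp add: group_homology_def bar_cycles_def C_def)
  define e where "e = coord 0 (single [] 1)"
  have e: "e \<in> carrier C" unfolding e_def C_def by (rule coord_in)
  have "bar_boundaries G M act 0 #>\<^bsub>C\<^esub> e \<in> carrier (C Mod bar_boundaries G M act 0)"
    using e by (auto simp: carrier_FactGroup)
  then have B: "bar_boundaries G M act 0 #>\<^bsub>C\<^esub> e = bar_boundaries G M act 0"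
    using assms unfolding H trivial_group_def by (auto simp: FactGroup_def)
  have "\<one>\<^bsub>C\<^esub> \<in> bar_boundaries G M act 0"
    unfolding boundaries_eq C_def
    by (auto intro!: exI[of _ 0] simp: additive.zero[OF additive_bar_bd] coord_zero)
  then have "\<one>\<^bsub>C\<^esub> \<otimes>\<^bsub>C\<^esub> e \<in> bar_boundaries G M act 0 #>\<^bsub>C\<^esub> e"
    unfolding r_coset_def by blast
  then have "e \<in> bar_boundaries G M act 0" using B e by simp
  then obtain v where "coord 0 (single [] 1) = coord 0 (bar_bd v)"
    unfolding boundaries_eq e_def by blast
  from arg_cong[OF this, of "\<lambda>f. f (map \<gamma> [])"] have "\<mu> 1 = \<mu> (lookup (bar_bd v) [])"
    by (simp only: coord_map list.size lookup_single_eq)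
  then have v: "1 = lookup (bar_bd v) []" using inj_\<mu> by (auto dest: injD)
  define S where "S = {x. [x] \<in> keys v}"
  define T where "T x = lookup v [x]" for x
  have "finite ((\<lambda>x. [x]) ` S)"
    by (rule finite_subset[of _ "keys v"]) (auto simp: S_def)
  then have fin: "finite S" by (rule finite_imageD) (auto simp: inj_on_def)
  have "1 = (\<Sum>\<sigma>\<in>keys v. lookup (bar_bdl \<sigma> (lookup v \<sigma>)) [])"
    unfolding v bar_bd_eq lookup_sum ..
  \<comment> \<open>The empty tuple is a face of one-entry tuples only, so parts of \<open>v\<close>
    in other degrees contribute nothing.\<close>
  also have "\<dots> = (\<Sum>\<sigma>\<in>(\<lambda>x. [x]) ` S. lookup (bar_bdl \<sigma> (lookup v \<sigma>)) [])"
  proof (rule sum.mono_neutral_right)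
    show "\<forall>\<sigma>\<in>keys v - (\<lambda>x. [x]) ` S.
        lookup (bar_bdl \<sigma> (lookup v \<sigma>)) [] = 0"
    proof
      fix \<sigma> assume \<sigma>: "\<sigma> \<in> keys v - (\<lambda>x. [x]) ` S"
      have "face i \<sigma> \<noteq> []" if "\<sigma> \<noteq> []" "i \<le> length \<sigma>" for i
      proof
        assume "face i \<sigma> = []"
        with length_face[OF that] that(1) have "length \<sigma> = 1" by (cases \<sigma>) auto
        then obtain x where "\<sigma> = [x]" by (cases \<sigma>) auto
        then show False using \<sigma> by (auto simp: S_def)
      qed
      then show "lookup (bar_bdl \<sigma> (lookup v \<sigma>)) [] = 0"
        by (auto simp: bar_bdl_def lookup_sum lookup_single when_def)
    qed
  qed (auto simp: S_def)
  also have "\<dots> = (\<Sum>x\<in>S. T x * (\<rho> x - 1))"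
    by (subst sum.reindex)
       (auto simp: inj_on_def bar_bdl_def lookup_add face_def coef_def T_def right_diff_distrib)
  finally show ?thesis using fin by (intro exI[of _ S] exI[of _ T]) simp
qed

end

section \<open>Square-summable functions and the group von Neumann algebra\<close>

lemma ell2_has_sum: "v \<in> ell2 G \<Longrightarrow> ((\<lambda>x. (cmod (v x))\<^sup>2) has_sum (ell2_norm G v)\<^sup>2) (carrier G)"
  unfolding ell2_def ell2_norm_def
  by (simp add: infsum_nonneg)

lemma ell2_norm_nonneg [simp]: "0 \<le> ell2_norm G v"
  unfolding ell2_norm_def by (simp add: infsum_nonneg)

lemma ell2_outside: "v \<in> ell2 G \<Longrightarrow> x \<notin> carrier G \<Longrightarrow> v x = 0"
  by (simp add: ell2_def)

lemma ell2_norm_eqI: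
  assumes "((\<lambda>x. (cmod (v x))\<^sup>2) has_sum C) (carrier G)"
  shows "(ell2_norm G v)\<^sup>2 = C"
  using infsumI[OF assms] has_sum_nonneg[OF assms] unfolding ell2_norm_def by simp

lemma ell2I_has_sum:
  assumes "\<And>x. x \<notin> carrier G \<Longrightarrow> v x = 0" "((\<lambda>x. (cmod (v x))\<^sup>2) has_sum C) (carrier G)"
  shows "v \<in> ell2 G"
  using assms has_sum_imp_summable unfolding ell2_def by blast

lemma L2_set_le_ell2_norm:
  assumes "v \<in> ell2 G" "finite F" "F \<subseteq> carrier G"
  shows "L2_set (\<lambda>x. cmod (v x)) F \<le> ell2_norm G v"
proof -
  have "(\<Sum>x\<in>F. (cmod (v x))\<^sup>2) \<le> (ell2_norm G v)\<^sup>2"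
    by (rule has_sum_mono2[OF has_sum_finite[OF assms(2)] ell2_has_sum[OF assms(1)]]) (use assms in auto)
  then show ?thesis unfolding L2_set_def by (simp add: real_le_lsqrt)
qed

lemma cmod_le_ell2_norm:
  assumes "v \<in> ell2 G"
  shows "cmod (v x) \<le> ell2_norm G v"
proof (cases "x \<in> carrier G")
  case True
  then show ?thesis using L2_set_le_ell2_norm[OF assms, of "{x}"] by simp
qed (simp add: ell2_outside[OF assms])

text \<open>The terms are non-negative, so bounds on finite subsets suffice. The triangle inequality
  and the limit of the Neumann series thus reduce to finite sums.\<close>

lemma ell2_boundI:
  assumes out: "\<And>x. x \<notin> carrier G \<Longrightarrow> v x = 0"
    and bound: "\<And>F. finite F \<Longrightarrow> F \<subseteq> carrier G \<Longrightarrow> L2_set (\<lambda>x. cmod (v x)) F \<le> C"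
  shows "v \<in> ell2 G" "ell2_norm G v \<le> C"
proof -
  have C: "0 \<le> C" using bound[of "{}"] by simp
  have le: "(\<Sum>x\<in>F. (cmod (v x))\<^sup>2) \<le> C\<^sup>2" if "finite F" "F \<subseteq> carrier G" for F
    using bound[OF that] C unfolding L2_set_def
    by (metis real_sqrt_le_iff real_sqrt_unique)
  have summable: "(\<lambda>x. (cmod (v x))\<^sup>2) summable_on carrier G"
    by (rule nonneg_bdd_above_summable_on) (use le in \<open>auto intro!: bdd_aboveI\<close>)
  then show v: "v \<in> ell2 G" using out unfolding ell2_def by blast
  have "(\<Sum>\<^sub>\<infinity>x\<in>carrier G. (cmod (v x))\<^sup>2) \<le> C\<^sup>2"
    by (rule infsum_le_finite_sums[OF summable le])
  then show "ell2_norm G v \<le> C" unfolding ell2_norm_def by (simp add: C real_le_lsqrt infsum_nonneg)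
qed

lemma ell2_zero [simp]: "(\<lambda>x. 0) \<in> ell2 G" "ell2_norm G (\<lambda>x. 0) = 0"
  by (auto simp: ell2_def ell2_norm_def)

lemma ell2_add:
  assumes "v \<in> ell2 G" "w \<in> ell2 G"
  shows "(\<lambda>x. v x + w x) \<in> ell2 G" "ell2_norm G (\<lambda>x. v x + w x) \<le> ell2_norm G v + ell2_norm G w"
proof -
  have "L2_set (\<lambda>x. cmod (v x + w x)) F \<le> ell2_norm G v + ell2_norm G w"
    if F: "finite F" "F \<subseteq> carrier G" for F
  proof -
    have "L2_set (\<lambda>x. cmod (v x + w x)) F \<le> L2_set (\<lambda>x. cmod (v x) + cmod (w x)) F"
      by (rule L2_set_mono) (auto intro: norm_triangle_ineq)
    also have "\<dots> \<le> L2_set (\<lambda>x. cmod (v x)) F + L2_set (\<lambda>x. cmod (w x)) F"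
      by (rule L2_set_triangle_ineq)
    also have "\<dots> \<le> ell2_norm G v + ell2_norm G w"
      by (intro add_mono L2_set_le_ell2_norm assms F)
    finally show ?thesis .
  qed
  then show "(\<lambda>x. v x + w x) \<in> ell2 G" "ell2_norm G (\<lambda>x. v x + w x) \<le> ell2_norm G v + ell2_norm G w"
    using ell2_boundI[of G "\<lambda>x. v x + w x"] assms by (auto simp: ell2_outside)
qed

lemma ell2_scale:
  assumes "v \<in> ell2 G"
  shows "(\<lambda>x. a * v x) \<in> ell2 G" "ell2_norm G (\<lambda>x. a * v x) = cmod a * ell2_norm G v"
proof -
  have "((\<lambda>x. (cmod (a * v x))\<^sup>2) has_sum (cmod a)\<^sup>2 * (ell2_norm G v)\<^sup>2) (carrier G)"
    using has_sum_cmult_right[OF ell2_has_sum[OF assms], of "(cmod a)\<^sup>2"]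
    by (simp add: norm_mult power_mult_distrib)
  moreover from ell2_norm_eqI[OF this] have "(ell2_norm G (\<lambda>x. a * v x))\<^sup>2 = (cmod a * ell2_norm G v)\<^sup>2"
    by (simp add: power_mult_distrib)
  ultimately show "(\<lambda>x. a * v x) \<in> ell2 G" "ell2_norm G (\<lambda>x. a * v x) = cmod a * ell2_norm G v"
    using assms by (auto intro!: ell2I_has_sum simp: ell2_outside power2_eq_iff_nonneg)
qed

lemma ell2_uminus:
  assumes "v \<in> ell2 G"
  shows "(\<lambda>x. - v x) \<in> ell2 G" "ell2_norm G (\<lambda>x. - v x) = ell2_norm G v"
  using ell2_scale[OF assms, of "- 1"] by auto

lemma ell2_diff:
  assumes "v \<in> ell2 G" "w \<in> ell2 G"
  shows "(\<lambda>x. v x - w x) \<in> ell2 G"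
  using ell2_add(1)[OF assms(1) ell2_uminus(1)[OF assms(2)]] by simp

lemma ell2_sum:
  assumes "\<And>i. i \<in> I \<Longrightarrow> v i \<in> ell2 G"
  shows "(\<lambda>x. \<Sum>i\<in>I. v i x) \<in> ell2 G" "ell2_norm G (\<lambda>x. \<Sum>i\<in>I. v i x) \<le> (\<Sum>i\<in>I. ell2_norm G (v i))"
proof -
  have "(\<lambda>x. \<Sum>i\<in>I. v i x) \<in> ell2 G \<and> ell2_norm G (\<lambda>x. \<Sum>i\<in>I. v i x) \<le> (\<Sum>i\<in>I. ell2_norm G (v i))"
    using assms
  proof (induction I rule: infinite_finite_induct)
    case (insert i I)
    then show ?case
      using ell2_add[of "v i" G "\<lambda>x. \<Sum>i\<in>I. v i x"] by force
  qed auto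
  then show "(\<lambda>x. \<Sum>i\<in>I. v i x) \<in> ell2 G" "ell2_norm G (\<lambda>x. \<Sum>i\<in>I. v i x) \<le> (\<Sum>i\<in>I. ell2_norm G (v i))"
    by auto
qed

section \<open>Translations and the ring of equivariant bounded operators\<close>

context group
begin

definition rtrans :: "'a \<Rightarrow> ('a \<Rightarrow> complex) \<Rightarrow> ('a \<Rightarrow> complex)" where
  "rtrans g v = (\<lambda>x. if x \<in> carrier G then v (x \<otimes> g) else 0)"

definition ltrans :: "'a \<Rightarrow> ('a \<Rightarrow> complex) \<Rightarrow> ('a \<Rightarrow> complex)" where
  "ltrans g v = (\<lambda>x. if x \<in> carrier G then v (inv g \<otimes> x) else 0)"

lemma right_translation_eq: "v \<in> ell2 G \<Longrightarrow> right_translation G g v = rtrans g v"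
  by (simp add: right_translation_def rtrans_def)

lemma left_translation_eq: "v \<in> ell2 G \<Longrightarrow> left_translation G g v = ltrans g v"
  by (simp add: left_translation_def ltrans_def)

lemma ell2_permute:
  assumes v: "v \<in> ell2 G" and h: "bij_betw h (carrier G) (carrier G)"
  shows "(\<lambda>x. if x \<in> carrier G then v (h x) else 0) \<in> ell2 G"
    "ell2_norm G (\<lambda>x. if x \<in> carrier G then v (h x) else 0) = ell2_norm G v"
proof -
  have "((\<lambda>x. (cmod (v (h x)))\<^sup>2) has_sum (ell2_norm G v)\<^sup>2) (carrier G)"
    using has_sum_reindex_bij_betw[OF h, of "\<lambda>x. (cmod (v x))\<^sup>2"] ell2_has_sum[OF v] by blast
  then have s: "((\<lambda>x. (cmod (if x \<in> carrier G then v (h x) else 0))\<^sup>2) has_sum (ell2_norm G v)\<^sup>2) (carrier G)"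
    by (simp cong: has_sum_cong)
  then show "(\<lambda>x. if x \<in> carrier G then v (h x) else 0) \<in> ell2 G"
    by (rule ell2I_has_sum[rotated]) simp
  show "ell2_norm G (\<lambda>x. if x \<in> carrier G then v (h x) else 0) = ell2_norm G v"
    using ell2_norm_eqI[OF s] by (simp add: power2_eq_iff_nonneg)
qed

lemma bij_rmult: "g \<in> carrier G \<Longrightarrow> bij_betw (\<lambda>x. x \<otimes> g) (carrier G) (carrier G)"
  by (rule bij_betwI[where g = "\<lambda>x. x \<otimes> inv g"]) (auto simp: m_assoc)

lemma bij_lmult: "g \<in> carrier G \<Longrightarrow> bij_betw (\<lambda>x. g \<otimes> x) (carrier G) (carrier G)"
  by (rule bij_betwI[where g = "\<lambda>x. inv g \<otimes> x"]) (auto simp: m_assoc[symmetric])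

lemma rtrans_ell2:
  assumes "v \<in> ell2 G" "g \<in> carrier G"
  shows "rtrans g v \<in> ell2 G" "ell2_norm G (rtrans g v) = ell2_norm G v"
  unfolding rtrans_def using ell2_permute[OF assms(1) bij_rmult[OF assms(2)]] by auto

lemma ltrans_ell2:
  assumes "v \<in> ell2 G" "g \<in> carrier G"
  shows "ltrans g v \<in> ell2 G" "ell2_norm G (ltrans g v) = ell2_norm G v"
  unfolding ltrans_def using ell2_permute[OF assms(1) bij_lmult[OF inv_closed[OF assms(2)]]] by auto

lemma rtrans_rtrans:
  "g \<in> carrier G \<Longrightarrow> h \<in> carrier G \<Longrightarrow> rtrans g (rtrans h v) = rtrans (g \<otimes> h) v"
  by (auto simp: rtrans_def m_assoc)

lemma rtrans_ltrans:
  "g \<in> carrier G \<Longrightarrow> h \<in> carrier G \<Longrightarrow> rtrans g (ltrans h v) = ltrans h (rtrans g v)"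
  by (auto simp: rtrans_def ltrans_def m_assoc)

lemma rtrans_one: "v \<in> ell2 G \<Longrightarrow> rtrans \<one> v = v"
  by (auto simp: rtrans_def ell2_outside)

lemma trans_linear:
  "rtrans g (\<lambda>x. v x + w x) = (\<lambda>x. rtrans g v x + rtrans g w x)"
  "rtrans g (\<lambda>x. a * v x) = (\<lambda>x. a * rtrans g v x)"
  "ltrans g (\<lambda>x. v x + w x) = (\<lambda>x. ltrans g v x + ltrans g w x)"
  "ltrans g (\<lambda>x. a * v x) = (\<lambda>x. a * ltrans g v x)"
  by (auto simp: rtrans_def ltrans_def)

abbreviation vN where "vN \<equiv> group_vN_algebra G"

lemma vN_iff: "T \<in> carrier vN \<longleftrightarrow> T \<in> ell2 G \<rightarrow>\<^sub>E ell2 G \<and>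
     (\<forall>v\<in>ell2 G. \<forall>w\<in>ell2 G. T (\<lambda>x. v x + w x) = (\<lambda>x. T v x + T w x)) \<and>
     (\<forall>a. \<forall>v\<in>ell2 G. T (\<lambda>x. a * v x) = (\<lambda>x. a * T v x)) \<and>
     (\<exists>C\<ge>0. \<forall>v\<in>ell2 G. ell2_norm G (T v) \<le> C * ell2_norm G v) \<and>
     (\<forall>g\<in>carrier G. \<forall>v\<in>ell2 G. T (ltrans g v) = ltrans g (T v))"
proof -
  have "(\<exists>C. \<forall>v\<in>ell2 G. ell2_norm G (T v) \<le> C * ell2_norm G v) \<longleftrightarrow>
      (\<exists>C\<ge>0. \<forall>v\<in>ell2 G. ell2_norm G (T v) \<le> C * ell2_norm G v)" (is "?L \<longleftrightarrow> ?R")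
  proof
    assume ?L
    then obtain C where C: "\<And>v. v \<in> ell2 G \<Longrightarrow> ell2_norm G (T v) \<le> C * ell2_norm G v" by blast
    have "ell2_norm G (T v) \<le> max C 0 * ell2_norm G v" if "v \<in> ell2 G" for v
      using C[OF that] mult_right_mono[of C "max C 0" "ell2_norm G v"] by auto
    then show ?R by (intro exI[of _ "max C 0"]) auto
  qed blast
  moreover have "(\<forall>g\<in>carrier G. \<forall>v\<in>ell2 G. T (left_translation G g v) = left_translation G g (T v)) \<longleftrightarrow>
     (\<forall>g\<in>carrier G. \<forall>v\<in>ell2 G. T (ltrans g v) = ltrans g (T v))" if "T \<in> ell2 G \<rightarrow>\<^sub>E ell2 G"
  proof -
    have "left_translation G g (T v) = ltrans g (T v)" if "v \<in> ell2 G" for g v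
      using \<open>T \<in> ell2 G \<rightarrow>\<^sub>E ell2 G\<close> that by (auto intro!: left_translation_eq simp: PiE_iff)
    then show ?thesis by (simp add: left_translation_eq)
  qed
  ultimately show ?thesis
    unfolding group_vN_algebra_def bounded_operators_def by auto
qed

lemma vN_I:
  assumes "\<And>v. v \<in> ell2 G \<Longrightarrow> f v \<in> ell2 G"
    and "\<And>v w. v \<in> ell2 G \<Longrightarrow> w \<in> ell2 G \<Longrightarrow> f (\<lambda>x. v x + w x) = (\<lambda>x. f v x + f w x)"
    and "\<And>a v. v \<in> ell2 G \<Longrightarrow> f (\<lambda>x. a * v x) = (\<lambda>x. a * f v x)"
    and "\<And>v. v \<in> ell2 G \<Longrightarrow> ell2_norm G (f v) \<le> C * ell2_norm G v" "0 \<le> C"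
    and "\<And>g v. g \<in> carrier G \<Longrightarrow> v \<in> ell2 G \<Longrightarrow> f (ltrans g v) = ltrans g (f v)"
  shows "(\<lambda>v\<in>ell2 G. f v) \<in> carrier vN"
  unfolding vN_iff using assms by (auto simp: ell2_add ell2_scale ltrans_ell2)

lemma vN_D:
  assumes "T \<in> carrier vN"
  shows "\<And>v. v \<in> ell2 G \<Longrightarrow> T v \<in> ell2 G"
    and "\<And>v w. v \<in> ell2 G \<Longrightarrow> w \<in> ell2 G \<Longrightarrow> T (\<lambda>x. v x + w x) = (\<lambda>x. T v x + T w x)"
    and "\<And>a v. v \<in> ell2 G \<Longrightarrow> T (\<lambda>x. a * v x) = (\<lambda>x. a * T v x)"
    and "\<exists>C\<ge>0. \<forall>v\<in>ell2 G. ell2_norm G (T v) \<le> C * ell2_norm G v"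
    and "\<And>g v. g \<in> carrier G \<Longrightarrow> v \<in> ell2 G \<Longrightarrow> T (ltrans g v) = ltrans g (T v)"
    and "T \<in> extensional (ell2 G)"
  using assms unfolding vN_iff by (auto simp: PiE_iff)

lemma vN_eqI:
  assumes "S \<in> carrier vN" "T \<in> carrier vN" "\<And>v. v \<in> ell2 G \<Longrightarrow> S v = T v"
  shows "S = T"
  by (rule extensionalityI[OF vN_D(6)[OF assms(1)] vN_D(6)[OF assms(2)] assms(3)])

lemma vN_simps:
  "S \<otimes>\<^bsub>vN\<^esub> T = (\<lambda>v\<in>ell2 G. S (T v))" "S \<oplus>\<^bsub>vN\<^esub> T = (\<lambda>v\<in>ell2 G. \<lambda>x. S v x + T v x)"
  "\<one>\<^bsub>vN\<^esub> = (\<lambda>v\<in>ell2 G. v)" "\<zero>\<^bsub>vN\<^esub> = (\<lambda>v\<in>ell2 G. \<lambda>x. 0)"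
  by (auto simp: group_vN_algebra_def compose_def)

lemma vN_mult_closed:
  assumes S: "S \<in> carrier vN" and T: "T \<in> carrier vN"
  shows "S \<otimes>\<^bsub>vN\<^esub> T \<in> carrier vN"
proof -
  obtain C D where C: "C \<ge> 0" "\<And>v. v \<in> ell2 G \<Longrightarrow> ell2_norm G (S v) \<le> C * ell2_norm G v"
    and D: "D \<ge> 0" "\<And>v. v \<in> ell2 G \<Longrightarrow> ell2_norm G (T v) \<le> D * ell2_norm G v"
    using vN_D(4)[OF S] vN_D(4)[OF T] by blast
  have "ell2_norm G (S (T v)) \<le> (C * D) * ell2_norm G v" if "v \<in> ell2 G" for v
    using C(2)[OF vN_D(1)[OF T that]] mult_left_mono[OF D(2)[OF that] C(1)] by (simp add: mult.assoc)
  then show ?thesis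
    unfolding vN_simps
    by (intro vN_I[where C = "C * D"]) (auto simp: vN_D[OF S] vN_D[OF T] C D)
qed

lemma vN_add_closed:
  assumes S: "S \<in> carrier vN" and T: "T \<in> carrier vN"
  shows "S \<oplus>\<^bsub>vN\<^esub> T \<in> carrier vN"
proof -
  obtain C D where C: "C \<ge> 0" "\<And>v. v \<in> ell2 G \<Longrightarrow> ell2_norm G (S v) \<le> C * ell2_norm G v"
    and D: "D \<ge> 0" "\<And>v. v \<in> ell2 G \<Longrightarrow> ell2_norm G (T v) \<le> D * ell2_norm G v"
    using vN_D(4)[OF S] vN_D(4)[OF T] by blast
  have "ell2_norm G (\<lambda>x. S v x + T v x) \<le> (C + D) * ell2_norm G v" if v: "v \<in> ell2 G" for v
    using ell2_add(2)[OF vN_D(1)[OF S v] vN_D(1)[OF T v]] C(2)[OF v] D(2)[OF v]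
    by (simp add: distrib_right)
  then show ?thesis
    unfolding vN_simps
    by (intro vN_I[where C = "C + D"])
       (auto simp: vN_D[OF S] vN_D[OF T] C D ell2_add trans_linear algebra_simps)
qed

lemma vN_scale_closed:
  assumes T: "T \<in> carrier vN"
  shows "(\<lambda>v\<in>ell2 G. \<lambda>x. a * T v x) \<in> carrier vN"
proof -
  obtain D where D: "D \<ge> 0" "\<And>v. v \<in> ell2 G \<Longrightarrow> ell2_norm G (T v) \<le> D * ell2_norm G v"
    using vN_D(4)[OF T] by blast
  have "ell2_norm G (\<lambda>x. a * T v x) \<le> (cmod a * D) * ell2_norm G v" if v: "v \<in> ell2 G" for v
    using mult_left_mono[OF D(2)[OF v], of "cmod a"] by (simp add: ell2_scale vN_D[OF T] v mult.assoc)
  then show ?thesis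
    by (intro vN_I[where C = "cmod a * D"])
       (auto simp: vN_D[OF T] D ell2_scale trans_linear algebra_simps)
qed

lemma vN_one_closed: "\<one>\<^bsub>vN\<^esub> \<in> carrier vN"
  unfolding vN_simps by (rule vN_I[where C = 1]) auto

lemma vN_zero_closed: "\<zero>\<^bsub>vN\<^esub> \<in> carrier vN"
  unfolding vN_simps by (rule vN_I[where C = 0]) (auto simp: ltrans_def)

lemma rtrans_in_vN: "g \<in> carrier G \<Longrightarrow> right_translation G g \<in> carrier vN"
proof -
  assume g: "g \<in> carrier G"
  have "(\<lambda>v\<in>ell2 G. rtrans g v) \<in> carrier vN"
    by (rule vN_I[where C = 1]) (auto simp: rtrans_ell2 trans_linear rtrans_ltrans g)
  then show ?thesis unfolding right_translation_def rtrans_def .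
qed

theorem ring_vN: "ring vN"
proof (rule ringI)
  show "abelian_group vN"
  proof (rule abelian_groupI)
    fix S assume S: "S \<in> carrier vN"
    show "\<exists>T\<in>carrier vN. T \<oplus>\<^bsub>vN\<^esub> S = \<zero>\<^bsub>vN\<^esub>"
      by (rule bexI[OF _ vN_scale_closed[OF S, of "- 1"]]) (auto simp: vN_simps intro!: restrict_ext)
    show "\<zero>\<^bsub>vN\<^esub> \<oplus>\<^bsub>vN\<^esub> S = S"
      by (rule vN_eqI[OF vN_add_closed[OF vN_zero_closed S] S]) (simp add: vN_simps)
  next
    fix S T assume "S \<in> carrier vN" "T \<in> carrier vN"
    then show "S \<oplus>\<^bsub>vN\<^esub> T \<in> carrier vN" by (rule vN_add_closed)
  next
    show "\<zero>\<^bsub>vN\<^esub> \<in> carrier vN" by (rule vN_zero_closed)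
  qed (auto simp: vN_simps add.assoc add.commute intro!: restrict_ext)
  show "monoid vN"
  proof (rule monoidI)
    fix S assume S: "S \<in> carrier vN"
    show "\<one>\<^bsub>vN\<^esub> \<otimes>\<^bsub>vN\<^esub> S = S"
      by (rule vN_eqI[OF vN_mult_closed[OF vN_one_closed S] S]) (simp add: vN_simps vN_D[OF S])
    show "S \<otimes>\<^bsub>vN\<^esub> \<one>\<^bsub>vN\<^esub> = S"
      by (rule vN_eqI[OF vN_mult_closed[OF S vN_one_closed] S]) (simp add: vN_simps vN_D[OF S])
  next
    fix S T assume "S \<in> carrier vN" "T \<in> carrier vN"
    then show "S \<otimes>\<^bsub>vN\<^esub> T \<in> carrier vN" by (rule vN_mult_closed)
  next
    show "\<one>\<^bsub>vN\<^esub> \<in> carrier vN" by (rule vN_one_closed)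
  qed (auto simp: vN_simps vN_D intro!: restrict_ext)
qed (auto simp: vN_simps vN_D intro!: restrict_ext)

text \<open>Required by the class \<open>ring_1\<close>. The point mass at the identity element is a
  nonzero vector.\<close>

lemma vN_one_neq_zero: "\<one>\<^bsub>vN\<^esub> \<noteq> \<zero>\<^bsub>vN\<^esub>"
proof
  define d where "d x = (if x = \<one> then 1 else 0 :: complex)" for x
  have "((\<lambda>x. (cmod (d x))\<^sup>2) has_sum (\<Sum>x\<in>{\<one>}. (cmod (d x))\<^sup>2)) (carrier G)"
    by (rule has_sum_finite_neutralI[of "{\<one>}"]) (auto simp: d_def)
  then have "d \<in> ell2 G" by (rule ell2I_has_sum[rotated]) (auto simp: d_def)
  moreover assume "\<one>\<^bsub>vN\<^esub> = \<zero>\<^bsub>vN\<^esub>"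
  ultimately have "d = (\<lambda>x. 0)" unfolding vN_simps by (metis restrict_apply')
  from fun_cong[OF this, of \<one>] show False by (simp add: d_def)
qed

end

section \<open>Spectral gap and inversion\<close>

text \<open>For n = card S + 1 vectors, n times the sum of the squared norms exceeds the squared
  norm of the sum by the squared distances over all pairs. Only the pairs containing
  \<open>a0\<close> are kept.\<close>

lemma norm_sum_le_variance:
  fixes a0 :: "'v::real_inner"
  assumes "finite S"
  shows "(norm (a0 + (\<Sum>s\<in>S. a s)))\<^sup>2 + (\<Sum>s\<in>S. (norm (a s - a0))\<^sup>2) \<le>
    (real (card S) + 1) * ((norm a0)\<^sup>2 + (\<Sum>s\<in>S. (norm (a s))\<^sup>2))"
  using assms
proof (induction S rule: finite_induct)
  case (insert t S)
  define A where "A = a0 + (\<Sum>s\<in>S. a s)"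
  define q where "q = (\<Sum>s\<in>S. (norm (a s))\<^sup>2)"
  have "2 * (\<Sum>s\<in>S. a s \<bullet> a t) = (\<Sum>s\<in>S. 2 * (a s \<bullet> a t))" by (rule sum_distrib_left)
  also have "\<dots> \<le> (\<Sum>s\<in>S. (norm (a s))\<^sup>2 + (norm (a t))\<^sup>2)"
  proof (rule sum_mono)
    fix s
    have "0 \<le> (norm (a s - a t))\<^sup>2" by simp
    then show "2 * (a s \<bullet> a t) \<le> (norm (a s))\<^sup>2 + (norm (a t))\<^sup>2"
      by (simp add: power2_norm_eq_inner inner_simps inner_commute)
  qed
  also have "\<dots> = q + real (card S) * (norm (a t))\<^sup>2" by (simp add: sum.distrib q_def)
  finally have cross: "2 * ((A - a0) \<bullet> a t) \<le> q + real (card S) * (norm (a t))\<^sup>2"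
    by (simp add: A_def inner_sum_left)
  have "(norm (A + a t))\<^sup>2 + (norm (a t - a0))\<^sup>2 =
      (norm A)\<^sup>2 + 2 * ((A - a0) \<bullet> a t) + 2 * (norm (a t))\<^sup>2 + (norm a0)\<^sup>2"
    by (simp add: power2_norm_eq_inner inner_simps inner_commute)
  with cross have "(norm (A + a t))\<^sup>2 + (norm (a t - a0))\<^sup>2 \<le>
      (norm A)\<^sup>2 + q + (real (card S) + 2) * (norm (a t))\<^sup>2 + (norm a0)\<^sup>2"
    by (simp add: algebra_simps)
  moreover have "(norm A)\<^sup>2 + (\<Sum>s\<in>S. (norm (a s - a0))\<^sup>2) \<le> (real (card S) + 1) * ((norm a0)\<^sup>2 + q)"
    using insert.IH unfolding A_def q_def .
  ultimately have le: "(norm (A + a t))\<^sup>2 + ((norm (a t - a0))\<^sup>2 + (\<Sum>s\<in>S. (norm (a s - a0))\<^sup>2)) \<le>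
      (real (Suc (card S)) + 1) * ((norm a0)\<^sup>2 + ((norm (a t))\<^sup>2 + q))"
    by (simp add: algebra_simps)
  have A_eq: "A + a t = a0 + (a t + (\<Sum>s\<in>S. a s))"
    by (simp add: A_def algebra_simps)
  show ?case
    using insert.hyps le[unfolded A_eq q_def] by simp
qed simp

lemma has_sum_sum_swap:
  assumes "\<And>i. i \<in> I \<Longrightarrow> ((f i :: 'a \<Rightarrow> real) has_sum c i) A"
  shows "((\<lambda>x. \<Sum>i\<in>I. f i x) has_sum (\<Sum>i\<in>I. c i)) A"
  using assms
  by (induction I rule: infinite_finite_induct) (auto intro!: has_sum_add)

context group
begin

text \<open>The variance inequality is summed over the group. All translates have the norm of
  \<open>v\<close>, so its right side becomes (card S + 1)^2 times the squared norm, and the gap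
  bounds the variance from below.\<close>

lemma ell2_norm_average:
  assumes S: "finite S" "S \<subseteq> carrier G"
    and gap: "\<epsilon> * (ell2_norm G v)\<^sup>2 \<le> (\<Sum>s\<in>S. (ell2_norm G (\<lambda>x. rtrans s v x - v x))\<^sup>2)"
    and v: "v \<in> ell2 G"
  shows "(ell2_norm G (\<lambda>x. v x + (\<Sum>s\<in>S. rtrans s v x)))\<^sup>2 \<le> ((real (card S) + 1)\<^sup>2 - \<epsilon>) * (ell2_norm G v)\<^sup>2"
proof -
  define n where "n = real (card S) + 1"
  define N where "N = (ell2_norm G v)\<^sup>2"
  define w where "w = (\<lambda>x. v x + (\<Sum>s\<in>S. rtrans s v x))"
  define D where "D = (\<Sum>s\<in>S. (ell2_norm G (\<lambda>x. rtrans s v x - v x))\<^sup>2)"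
  have r: "rtrans s v \<in> ell2 G" "ell2_norm G (rtrans s v) = ell2_norm G v" if "s \<in> S" for s
    using rtrans_ell2[OF v] S that by auto
  have w: "w \<in> ell2 G"
    unfolding w_def by (intro ell2_add(1) v ell2_sum(1) r)
  have 1: "((\<lambda>x. (cmod (w x))\<^sup>2 + (\<Sum>s\<in>S. (cmod (rtrans s v x - v x))\<^sup>2)) has_sum
      (ell2_norm G w)\<^sup>2 + D) (carrier G)"
    unfolding D_def by (intro has_sum_add has_sum_sum_swap ell2_has_sum ell2_diff w v r)
  have 2: "((\<lambda>x. n * ((cmod (v x))\<^sup>2 + (\<Sum>s\<in>S. (cmod (rtrans s v x))\<^sup>2))) has_sum
      n * ((ell2_norm G v)\<^sup>2 + (\<Sum>s\<in>S. (ell2_norm G (rtrans s v))\<^sup>2))) (carrier G)"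
    by (intro has_sum_cmult_right has_sum_add has_sum_sum_swap ell2_has_sum v r)
  have "(ell2_norm G w)\<^sup>2 + D \<le> n * ((ell2_norm G v)\<^sup>2 + (\<Sum>s\<in>S. (ell2_norm G (rtrans s v))\<^sup>2))"
    by (rule has_sum_mono[OF 1 2]) (unfold w_def n_def, rule norm_sum_le_variance[OF S(1)])
  also have "\<dots> = n\<^sup>2 * N"
    by (simp add: r N_def n_def power2_eq_square algebra_simps)
  finally show ?thesis using gap by (simp add: w_def D_def N_def n_def algebra_simps)
qed

text \<open>A spectral gap makes the averaging operator \<open>P\<close> over \<open>S \<union> {1}\<close> a strict contraction, so
  \<open>1 - P\<close> is inverted by the Neumann series, which inherits every commutation property of \<open>P\<close>.\<close>

theorem vN_left_inverse:
  assumes S: "finite S" "S \<subseteq> carrier G" and \<epsilon>: "0 < \<epsilon>"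
    and gap: "\<And>v. v \<in> ell2 G \<Longrightarrow>
      \<epsilon> * (ell2_norm G v)\<^sup>2 \<le> (\<Sum>s\<in>S. (ell2_norm G (\<lambda>x. rtrans s v x - v x))\<^sup>2)"
  obtains T where "T \<in> carrier vN"
    "\<And>k v. k \<in> carrier G \<Longrightarrow> (\<And>s. s \<in> S \<Longrightarrow> s \<otimes> k = k \<otimes> s) \<Longrightarrow> v \<in> ell2 G \<Longrightarrow>
       T (rtrans k v) = rtrans k (T v)"
    "\<And>v x. v \<in> ell2 G \<Longrightarrow> (\<Sum>s\<in>S. T (rtrans s v) x - T v x) = v x"
proof -
  define n where "n = real (card S) + 1"
  have n: "n \<ge> 1" by (simp add: n_def)
  define P where "P v = (\<lambda>x. complex_of_real (1 / n) * (v x + (\<Sum>s\<in>S. rtrans s v x)))" for v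
  \<comment> \<open>The contraction factor given by \<open>ell2_norm_average\<close>;
    \<open>max 0\<close> keeps it non-negative when \<open>\<epsilon>\<close> exceeds n^2.\<close>
  define \<rho> where "\<rho> = sqrt (max 0 (1 - \<epsilon> / n\<^sup>2))"
  have "max 0 (1 - \<epsilon> / n\<^sup>2) < 1" using \<epsilon> n by simp
  then have \<rho>: "0 \<le> \<rho>" "\<rho> < 1" unfolding \<rho>_def by (simp, metis real_sqrt_lt_1_iff)
  have in_P: "P v \<in> ell2 G" if v: "v \<in> ell2 G" for v
    unfolding P_def by (intro ell2_scale(1) ell2_add(1) v ell2_sum(1) rtrans_ell2(1)) (use S in auto)
  have norm_P: "ell2_norm G (P v) \<le> \<rho> * ell2_norm G v" if v: "v \<in> ell2 G" for v
  proof -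
    have w: "(\<lambda>x. v x + (\<Sum>s\<in>S. rtrans s v x)) \<in> ell2 G"
      by (intro ell2_add(1) v ell2_sum(1) rtrans_ell2(1)) (use S in auto)
    have "(ell2_norm G (P v))\<^sup>2 = (1 / n)\<^sup>2 * (ell2_norm G (\<lambda>x. v x + (\<Sum>s\<in>S. rtrans s v x)))\<^sup>2"
      unfolding P_def ell2_scale(2)[OF w] using n by (simp add: power_mult_distrib power_divide norm_divide)
    also have "\<dots> \<le> (1 / n)\<^sup>2 * ((n\<^sup>2 - \<epsilon>) * (ell2_norm G v)\<^sup>2)"
      using ell2_norm_average[OF S gap[OF v] v] by (intro mult_left_mono) (auto simp: n_def)
    also have "\<dots> = (1 - \<epsilon> / n\<^sup>2) * (ell2_norm G v)\<^sup>2"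
      using n by (simp add: field_simps power2_eq_square)
    also have "\<dots> \<le> max 0 (1 - \<epsilon> / n\<^sup>2) * (ell2_norm G v)\<^sup>2"
      by (intro mult_right_mono) auto
    also have "\<dots> = (\<rho> * ell2_norm G v)\<^sup>2"
      unfolding \<rho>_def power_mult_distrib by simp
    finally show ?thesis using \<rho> by (intro power2_le_imp_le[of "ell2_norm G (P v)"]) auto
  qed
  have P_add: "P (\<lambda>x. v x + w x) = (\<lambda>x. P v x + P w x)" for v w
    by (auto simp: P_def trans_linear sum.distrib algebra_simps)
  have P_scale: "P (\<lambda>x. a * v x) = (\<lambda>x. a * P v x)" for a v
    by (auto simp: P_def trans_linear sum_distrib_left algebra_simps)
  have P_ltrans: "P (ltrans g v) = ltrans g (P v)" if "g \<in> carrier G" for g v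
  proof -
    have "rtrans s (ltrans g v) = ltrans g (rtrans s v)" if "s \<in> S" for s
      using that \<open>g \<in> carrier G\<close> S by (intro rtrans_ltrans) auto
    then show ?thesis unfolding P_def by (auto simp: ltrans_def cong: sum.cong)
  qed
  have P_rtrans: "P (rtrans k v) = rtrans k (P v)"
    if "k \<in> carrier G" "\<And>s. s \<in> S \<Longrightarrow> s \<otimes> k = k \<otimes> s" for k v
  proof -
    have "rtrans s (rtrans k v) = rtrans k (rtrans s v)" if "s \<in> S" for s
      using that S \<open>k \<in> carrier G\<close> \<open>\<And>s. s \<in> S \<Longrightarrow> s \<otimes> k = k \<otimes> s\<close>
      by (metis rtrans_rtrans subsetD)
    then show ?thesis unfolding P_def by (auto simp: rtrans_def cong: sum.cong)
  qed
  have pow: "(P ^^ i) v \<in> ell2 G" "ell2_norm G ((P ^^ i) v) \<le> \<rho> ^ i * ell2_norm G v"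
    if v: "v \<in> ell2 G" for i v
  proof (induction i)
    case (Suc i)
    case 1 show ?case using Suc in_P by simp
    case 2
    have "ell2_norm G ((P ^^ Suc i) v) \<le> \<rho> * ell2_norm G ((P ^^ i) v)"
      using norm_P Suc by simp
    also have "\<dots> \<le> \<rho> * (\<rho> ^ i * ell2_norm G v)" using Suc \<rho> by (intro mult_left_mono) auto
    finally show ?case by (simp add: mult.assoc)
  qed (use v in auto)
  have pow_add: "(P ^^ i) (\<lambda>x. v x + w x) = (\<lambda>x. (P ^^ i) v x + (P ^^ i) w x)" for i v w
    by (induction i) (auto simp: P_add)
  have pow_scale: "(P ^^ i) (\<lambda>x. a * v x) = (\<lambda>x. a * (P ^^ i) v x)" for i a v
    by (induction i) (auto simp: P_scale)
  have pow_ltrans: "(P ^^ i) (ltrans g v) = ltrans g ((P ^^ i) v)" if "g \<in> carrier G" for i g v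
    by (induction i) (auto simp: P_ltrans that)
  have pow_rtrans: "(P ^^ i) (rtrans k v) = rtrans k ((P ^^ i) v)"
    if "k \<in> carrier G" "\<And>s. s \<in> S \<Longrightarrow> s \<otimes> k = k \<otimes> s" for i k v
    by (induction i) (auto simp: P_rtrans that)
  have geo: "summable (\<lambda>i. \<rho> ^ i * c)" "suminf (\<lambda>i. \<rho> ^ i * c) = c / (1 - \<rho>)" for c
    using \<rho> by (auto simp: summable_geometric summable_mult2 suminf_geometric suminf_mult2[symmetric])
  have summ: "summable (\<lambda>i. (P ^^ i) v x)" if v: "v \<in> ell2 G" for v x
    by (rule summable_comparison_test[OF _ geo(1)[of "ell2_norm G v"]])
       (use cmod_le_ell2_norm[OF pow(1)[OF v]] pow(2)[OF v] order_trans in blast)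
  \<comment> \<open>The inverse of 1 - \<open>P\<close> as a pointwise series: values at a point are
    bounded by the norm, so they converge geometrically.\<close>
  define U where "U v = (\<lambda>x. suminf (\<lambda>i. (P ^^ i) v x))" for v
  have U_bound: "U v \<in> ell2 G \<and> ell2_norm G (U v) \<le> 1 / (1 - \<rho>) * ell2_norm G v" if v: "v \<in> ell2 G" for v
  proof -
    have "L2_set (\<lambda>x. cmod (U v x)) F \<le> ell2_norm G v / (1 - \<rho>)" if F: "finite F" "F \<subseteq> carrier G" for F
    proof (rule LIMSEQ_le_const2)
      show "(\<lambda>m. L2_set (\<lambda>x. cmod (\<Sum>i<m. (P ^^ i) v x)) F) \<longlonglongrightarrow> L2_set (\<lambda>x. cmod (U v x)) F"
        unfolding L2_set_def U_def by (intro tendsto_intros summable_LIMSEQ summ v)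
      have "L2_set (\<lambda>x. cmod (\<Sum>i<m. (P ^^ i) v x)) F \<le> ell2_norm G v / (1 - \<rho>)" for m
      proof -
        have "L2_set (\<lambda>x. cmod (\<Sum>i<m. (P ^^ i) v x)) F \<le> ell2_norm G (\<lambda>x. \<Sum>i<m. (P ^^ i) v x)"
          by (intro L2_set_le_ell2_norm ell2_sum(1) pow v F)
        also have "\<dots> \<le> (\<Sum>i<m. ell2_norm G ((P ^^ i) v))" by (intro ell2_sum(2) pow v)
        also have "\<dots> \<le> (\<Sum>i<m. \<rho> ^ i * ell2_norm G v)" by (intro sum_mono pow v)
        also have "\<dots> \<le> suminf (\<lambda>i. \<rho> ^ i * ell2_norm G v)" using \<rho> by (intro sum_le_suminf geo) auto
        finally show ?thesis by (simp add: geo)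
      qed
      then show "\<exists>N. \<forall>m\<ge>N. L2_set (\<lambda>x. cmod (\<Sum>i<m. (P ^^ i) v x)) F \<le> ell2_norm G v / (1 - \<rho>)" by blast
    qed
    moreover have "U v x = 0" if "x \<notin> carrier G" for x
      unfolding U_def using ell2_outside[OF pow(1)[OF v] that] by simp
    ultimately show ?thesis using ell2_boundI[of G "U v" "ell2_norm G v / (1 - \<rho>)"] by simp
  qed
  have U_add: "U (\<lambda>x. v x + w x) = (\<lambda>x. U v x + U w x)" if "v \<in> ell2 G" "w \<in> ell2 G" for v w
    unfolding U_def pow_add using that by (simp add: suminf_add summ)
  have U_scale: "U (\<lambda>x. a * v x) = (\<lambda>x. a * U v x)" if "v \<in> ell2 G" for a v
    unfolding U_def pow_scale using that by (simp add: suminf_mult summ)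
  have U_rtrans: "U (rtrans k v) = rtrans k (U v)"
    if "k \<in> carrier G" "\<And>s. s \<in> S \<Longrightarrow> s \<otimes> k = k \<otimes> s" for k v
  proof -
    have "(P ^^ i) (rtrans k v) = rtrans k ((P ^^ i) v)" for i
      by (rule pow_rtrans) (use that in auto)
    then show ?thesis by (auto simp: U_def rtrans_def)
  qed
  have U_P: "U (P v) x = U v x - v x" if v: "v \<in> ell2 G" for v x
  proof -
    have "suminf (\<lambda>i. (P ^^ i) v x) = v x + suminf (\<lambda>i. (P ^^ Suc i) v x)"
      using suminf_split_head[OF summ[OF v, of x]] by simp
    then show ?thesis by (simp add: U_def funpow_swap1)
  qed
  have U_vN: "(\<lambda>v\<in>ell2 G. U v) \<in> carrier vN"
  proof (rule vN_I[where C = "1 / (1 - \<rho>)"])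
    show "U (ltrans g v) = ltrans g (U v)" if "g \<in> carrier G" for g v
      unfolding U_def pow_ltrans[OF that] by (auto simp: ltrans_def)
  qed (use \<rho> U_bound U_add U_scale in auto)
  \<comment> \<open>The sum of R_s - 1 over \<open>S\<close> is n (P - 1), and U (P - 1) = -1; hence
    the factor -1/n.\<close>
  define T where "T = (\<lambda>v\<in>ell2 G. \<lambda>x. complex_of_real (- 1 / n) * U v x)"
  have T_vN: "T \<in> carrier vN"
    using vN_scale_closed[OF U_vN, of "complex_of_real (- 1 / n)"] by (simp add: T_def cong: restrict_cong)
  show thesis
  proof (rule that[of T])
    show "T \<in> carrier vN" by (rule T_vN)
    show "T (rtrans k v) = rtrans k (T v)"
      if "k \<in> carrier G" "\<And>s. s \<in> S \<Longrightarrow> s \<otimes> k = k \<otimes> s" "v \<in> ell2 G" for k v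
      using that by (simp add: T_def rtrans_ell2 U_rtrans) (auto simp: rtrans_def)
    fix v x assume v: "v \<in> ell2 G"
    have r: "rtrans s v \<in> ell2 G" if "s \<in> S" for s using rtrans_ell2[OF v] S that by auto
    have T_sum: "T (\<lambda>x. \<Sum>s\<in>S. rtrans s v x) = (\<lambda>x. \<Sum>s\<in>S. T (rtrans s v) x)"
      using S(1) r
    proof (induction S rule: finite_induct)
      case empty
      show ?case using vN_D(3)[OF T_vN, of "\<lambda>x. 0" 0] by simp
    next
      case (insert s S)
      then show ?case using vN_D(2)[OF T_vN, of "rtrans s v" "\<lambda>x. \<Sum>s\<in>S. rtrans s v x"]
        by (simp add: ell2_sum(1))
    qed
    have sum_in: "(\<lambda>x. \<Sum>s\<in>S. rtrans s v x) \<in> ell2 G" by (intro ell2_sum r)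
    have "T (P v) x = complex_of_real (1 / n) * (T v x + (\<Sum>s\<in>S. T (rtrans s v) x))"
      unfolding P_def vN_D(3)[OF T_vN ell2_add(1)[OF v sum_in]] vN_D(2)[OF T_vN v sum_in] T_sum ..
    moreover have "T (P v) x = T v x - complex_of_real (- 1 / n) * v x"
      using v in_P[OF v] by (simp add: T_def U_P diff_divide_distrib)
    ultimately have "T v x + (\<Sum>s\<in>S. T (rtrans s v) x) =
        complex_of_real n * (T v x - complex_of_real (- 1 / n) * v x)"
      using n by (simp add: field_simps)
    also have "\<dots> = complex_of_real n * T v x + v x"
      using n by (simp add: field_simps)
    finally show "(\<Sum>s\<in>S. T (rtrans s v) x - T v x) = v x"
      by (simp add: sum_subtractf n_def algebra_simps)
  qed
qed

end

section \<open>Almost invariant vectors and means\<close>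

text \<open>Weighted arithmetic-geometric mean inequality for the product of |a - b| and |a| + |b|.
  Being pointwise, it can be summed over the group in place of a Cauchy-Schwarz estimate.\<close>

lemma abs_power2_diff_le:
  fixes a b :: complex
  assumes "0 < \<eta>"
  shows "\<bar>(cmod a)\<^sup>2 - (cmod b)\<^sup>2\<bar> \<le> (cmod (a - b))\<^sup>2 / (2 * \<eta>) + \<eta> * ((cmod a)\<^sup>2 + (cmod b)\<^sup>2)"
proof -
  define d where "d = cmod (a - b)"
  define e where "e = cmod a + cmod b"
  have "\<bar>(cmod a)\<^sup>2 - (cmod b)\<^sup>2\<bar> = \<bar>cmod a - cmod b\<bar> * e"
    by (simp add: e_def power2_eq_square square_diff_square_factored abs_mult mult.commute)
  also have "\<dots> \<le> d * e"
    unfolding d_def e_def by (intro mult_right_mono norm_triangle_ineq3) auto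
  also have "\<dots> \<le> d\<^sup>2 / (2 * \<eta>) + \<eta> / 2 * e\<^sup>2"
  proof -
    have "0 \<le> (d - \<eta> * e)\<^sup>2 / (2 * \<eta>)" using assms by simp
    also have "\<dots> = d\<^sup>2 / (2 * \<eta>) + \<eta> / 2 * e\<^sup>2 - d * e"
      using assms by (simp add: field_simps power2_eq_square)
    finally show ?thesis by simp
  qed
  also have "\<eta> / 2 * e\<^sup>2 \<le> \<eta> * ((cmod a)\<^sup>2 + (cmod b)\<^sup>2)"
  proof -
    have "0 \<le> (cmod a - cmod b)\<^sup>2" by simp
    then have "e\<^sup>2 \<le> 2 * ((cmod a)\<^sup>2 + (cmod b)\<^sup>2)"
      by (simp add: e_def power2_eq_square algebra_simps)
    then show ?thesis using assms by (simp add: mult_left_mono)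
  qed
  finally show ?thesis by (simp add: d_def)
qed

text \<open>Tychonoff's theorem; limits of approximate means are found in this cube.\<close>

lemma compact_unit_functions: "compact (PiE (UNIV :: 'i set) (\<lambda>_. {0..1::real}))"
proof -
  have "compactin (product_topology (\<lambda>i. euclidean) UNIV) (PiE (UNIV :: 'i set) (\<lambda>_. {0..1::real}))"
    by (subst compactin_PiE) auto
  then show ?thesis by (simp add: euclidean_product_topology)
qed

text \<open>The bounds are imposed on all sets, also outside \<open>Y\<close>, so that a mean is a
  point of the compact cube of functions on the whole type.\<close>

definition mean_on :: "'a set \<Rightarrow> ('a set \<Rightarrow> real) \<Rightarrow> bool" where
  "mean_on Y m \<longleftrightarrow> (\<forall>A. 0 \<le> m A \<and> m A \<le> 1) \<and> m Y = 1 \<and>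
     (\<forall>A B. A \<subseteq> Y \<and> B \<subseteq> Y \<and> A \<inter> B = {} \<longrightarrow> m (A \<union> B) = m A + m B)"

text \<open>Normalisation, additivity and approximate invariance are closed conditions. Finitely
  many of them are met by one approximate mean, so compactness yields a common point, which is
  invariant up to every \<eta>.\<close>

lemma (in group) amenableI_approx:
  assumes "\<And>S \<eta>. finite S \<Longrightarrow> S \<subseteq> carrier G \<Longrightarrow> 0 < \<eta> \<Longrightarrow>
    \<exists>m :: 'a set \<Rightarrow> real. mean_on (carrier G) m \<and>
      (\<forall>s\<in>S. \<forall>A. A \<subseteq> carrier G \<longrightarrow> \<bar>m (s <#\<^bsub>G\<^esub> A) - m A\<bar> \<le> \<eta>)"
  shows "amenable G"
proof -
  define I where "I = {(S, \<eta>). finite S \<and> S \<subseteq> carrier G \<and> 0 < (\<eta> :: real)}"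
  define f where "f i = {m :: 'a set \<Rightarrow> real. m (carrier G) = 1 \<and>
      (\<forall>A B. A \<subseteq> carrier G \<and> B \<subseteq> carrier G \<and> A \<inter> B = {} \<longrightarrow> m (A \<union> B) = m A + m B) \<and>
      (\<forall>s A. s \<in> fst i \<and> A \<subseteq> carrier G \<longrightarrow> \<bar>m (s <#\<^bsub>G\<^esub> A) - m A\<bar> \<le> snd i)}" for i :: "'a set \<times> real"
  have "PiE UNIV (\<lambda>_. {0..1}) \<inter> (\<Inter>i\<in>I. f i) \<noteq> {}"
  proof (rule compact_imp_fip_image[OF compact_unit_functions])
    show "closed (f i)" for i
      unfolding f_def
      by (intro closed_Collect_conj closed_Collect_all closed_Collect_imp open_Collect_const
          closed_Collect_eq closed_Collect_le continuous_intros continuous_on_product_coordinates)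
    fix I' assume I': "finite I'" "I' \<subseteq> I"
    define S where "S = (\<Union>i\<in>I'. fst i)"
    \<comment> \<open>The inserted 1 keeps the minimum meaningful when \<open>I'\<close> is
      empty.\<close>
    define \<eta> where "\<eta> = Min (insert 1 (snd ` I'))"
    have fin: "finite (insert 1 (snd ` I'))" using I' by simp
    have I'_D: "finite (fst i)" "fst i \<subseteq> carrier G" "0 < snd i" if "i \<in> I'" for i
      using subsetD[OF I'(2) that] by (auto simp: I_def)
    have "finite S" "S \<subseteq> carrier G" using I'(1) I'_D unfolding S_def by blast+
    moreover have "0 < \<eta>" unfolding \<eta>_def using fin I'_D by (subst Min_gr_iff) auto
    ultimately have "\<exists>m :: 'a set \<Rightarrow> real. mean_on (carrier G) m \<and>
      (\<forall>s\<in>S. \<forall>A. A \<subseteq> carrier G \<longrightarrow> \<bar>m (s <#\<^bsub>G\<^esub> A) - m A\<bar> \<le> \<eta>)"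
      by (rule assms)
    then obtain m :: "'a set \<Rightarrow> real" where m: "mean_on (carrier G) m"
      "\<forall>s\<in>S. \<forall>A. A \<subseteq> carrier G \<longrightarrow> \<bar>m (s <#\<^bsub>G\<^esub> A) - m A\<bar> \<le> \<eta>"
      by (elim exE conjE) (rule that)
    have "m \<in> f i" if "i \<in> I'" for i
    proof -
      have "\<eta> \<le> snd i" unfolding \<eta>_def using fin that by (intro Min_le) auto
      moreover have "fst i \<subseteq> S" using that by (auto simp: S_def)
      ultimately have "\<bar>m (s <#\<^bsub>G\<^esub> A) - m A\<bar> \<le> snd i" if "s \<in> fst i" "A \<subseteq> carrier G" for s A
        using m(2)[rule_format, of s A] that by (meson order_trans subsetD)
      then show ?thesis using m(1) by (simp add: f_def mean_on_def)
    qed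
    moreover have "m \<in> PiE UNIV (\<lambda>_. {0..1})" using m(1) by (simp add: PiE_iff mean_on_def)
    ultimately show "PiE UNIV (\<lambda>_. {0..1}) \<inter> (\<Inter>i\<in>I'. f i) \<noteq> {}" by blast
  qed
  then obtain m where m: "m \<in> PiE UNIV (\<lambda>_. {0..1})" "\<And>i. i \<in> I \<Longrightarrow> m \<in> f i" by blast
  have inv: "m (s <#\<^bsub>G\<^esub> A) = m A" if "s \<in> carrier G" "A \<subseteq> carrier G" for s A
  proof -
    have small: "\<bar>m (s <#\<^bsub>G\<^esub> A) - m A\<bar> \<le> \<eta>" if "0 < \<eta>" for \<eta>
    proof -
      have "({s}, \<eta>) \<in> I" using \<open>s \<in> carrier G\<close> that by (simp add: I_def)
      from m(2)[OF this] show ?thesis using \<open>A \<subseteq> carrier G\<close> by (simp add: f_def)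
    qed
    have "\<bar>m (s <#\<^bsub>G\<^esub> A) - m A\<bar> \<le> 0" by (rule field_le_epsilon) (use small in simp)
    then show ?thesis by simp
  qed
  have "({}, 1) \<in> I" by (simp add: I_def)
  from m(2)[OF this] have "m (carrier G) = 1"
    "\<forall>A B. A \<subseteq> carrier G \<and> B \<subseteq> carrier G \<and> A \<inter> B = {} \<longrightarrow> m (A \<union> B) = m A + m B"
    by (auto simp: f_def)
  moreover have "0 \<le> m A" for A using m(1) by (auto simp: PiE_iff)
  ultimately show ?thesis using inv unfolding amenable_def by (intro exI[of _ m]) auto
qed

text \<open>Every x is a chosen representative of its left coset modulo the image of
  \<open>\<phi>\<close>, times \<open>\<phi> (\<kappa> x)\<close>. The coordinate
  \<open>\<kappa>\<close> serves to push mass on \<open>G\<close> forward to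
  \<open>H\<close>.\<close>

lemma (in group) coset_coordinate:
  assumes H: "group H" and \<phi>: "\<phi> \<in> hom H G" "inj_on \<phi> (carrier H)"
  obtains \<kappa> where "\<And>x. x \<in> carrier G \<Longrightarrow> \<kappa> x \<in> carrier H"
    "\<And>x h. x \<in> carrier G \<Longrightarrow> h \<in> carrier H \<Longrightarrow> \<kappa> (x \<otimes> \<phi> h) = \<kappa> x \<otimes>\<^bsub>H\<^esub> h"
proof -
  interpret H: group H by (rule H)
  interpret \<phi>: group_hom H G \<phi> by unfold_locales (rule \<phi>)
  define C where "C x = {x \<otimes> \<phi> h | h. h \<in> carrier H}" for x
  define c where "c x = (SOME y. y \<in> C x)" for x
  have C_shift: "C (x \<otimes> \<phi> h) = C x" if "x \<in> carrier G" "h \<in> carrier H" for x h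
  proof -
    have "x \<otimes> \<phi> h \<otimes> \<phi> k = x \<otimes> \<phi> (h \<otimes>\<^bsub>H\<^esub> k)"
      "x \<otimes> \<phi> k = x \<otimes> \<phi> h \<otimes> \<phi> (inv\<^bsub>H\<^esub> h \<otimes>\<^bsub>H\<^esub> k)"
      if "k \<in> carrier H" for k
      using that \<open>x \<in> carrier G\<close> \<open>h \<in> carrier H\<close>
      by (auto simp: m_assoc \<phi>.hom_mult[symmetric] H.m_assoc[symmetric] simp del: \<phi>.hom_mult)
    then show ?thesis unfolding C_def using that by (safe; metis H.m_closed H.inv_closed)
  qed
  have ex: "\<exists>h\<in>carrier H. x = c x \<otimes> \<phi> h" "c x \<in> carrier G" if x: "x \<in> carrier G" for x
  proof -
    have "x \<otimes> \<phi> \<one>\<^bsub>H\<^esub> \<in> C x" unfolding C_def by blast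
    then have "c x \<in> C x" unfolding c_def by (rule someI)
    then obtain h where h: "h \<in> carrier H" "c x = x \<otimes> \<phi> h" unfolding C_def by blast
    then show "c x \<in> carrier G" using x by simp
    have "x = c x \<otimes> \<phi> (inv\<^bsub>H\<^esub> h)" using h x by (simp add: m_assoc)
    then show "\<exists>h\<in>carrier H. x = c x \<otimes> \<phi> h" using h by blast
  qed
  define \<kappa> where "\<kappa> x = (SOME h. h \<in> carrier H \<and> x = c x \<otimes> \<phi> h)" for x
  have \<kappa>: "\<kappa> x \<in> carrier H" "x = c x \<otimes> \<phi> (\<kappa> x)" if x: "x \<in> carrier G" for x
    using someI_ex[of "\<lambda>h. h \<in> carrier H \<and> x = c x \<otimes> \<phi> h"] ex(1)[OF x] unfolding \<kappa>_def by blast+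
  show thesis
  proof (rule that[of \<kappa>])
    fix x h assume x: "x \<in> carrier G" and h: "h \<in> carrier H"
    have xh: "x \<otimes> \<phi> h \<in> carrier G" using x h by simp
    have c: "c (x \<otimes> \<phi> h) = c x" unfolding c_def C_shift[OF x h] ..
    have "c x \<otimes> \<phi> (\<kappa> (x \<otimes> \<phi> h)) = x \<otimes> \<phi> h" using \<kappa>(2)[OF xh] c by simp
    also have "\<dots> = c x \<otimes> \<phi> (\<kappa> x) \<otimes> \<phi> h" using \<kappa>(2)[OF x] by simp
    also have "\<dots> = c x \<otimes> \<phi> (\<kappa> x \<otimes>\<^bsub>H\<^esub> h)" using \<kappa>(1)[OF x] h ex(2)[OF x] by (simp add: m_assoc)
    finally have "\<phi> (\<kappa> (x \<otimes> \<phi> h)) = \<phi> (\<kappa> x \<otimes>\<^bsub>H\<^esub> h)"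
      using \<kappa>(1)[OF x] \<kappa>(1)[OF xh] h ex(2)[OF x] by (subst (asm) l_cancel) auto
    then show "\<kappa> (x \<otimes> \<phi> h) = \<kappa> x \<otimes>\<^bsub>H\<^esub> h"
      by (rule inj_onD[OF \<phi>(2)]) (use \<kappa>(1)[OF x] \<kappa>(1)[OF xh] h in auto)
  qed (rule \<kappa>(1))
qed

text \<open>The mass distributions \<open>\<bar>v\<bar>\<^sup>2\<close> of almost invariant vectors, pushed to \<open>H\<close> along the cosets,
  are almost invariant means; a limit point is invariant. Inversion turns the right translations
  into left ones.\<close>

theorem (in group) amenable_if_almost_invariant_vectors:
  assumes H: "group H" and \<phi>: "\<phi> \<in> hom H G" "inj_on \<phi> (carrier H)"
    and approx: "\<And>S \<epsilon>. finite S \<Longrightarrow> S \<subseteq> carrier H \<Longrightarrow> 0 < \<epsilon> \<Longrightarrow>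
      \<exists>v\<in>ell2 G. (\<Sum>s\<in>S. (ell2_norm G (\<lambda>x. rtrans (\<phi> s) v x - v x))\<^sup>2) < \<epsilon> * (ell2_norm G v)\<^sup>2"
  shows "amenable H"
proof -
  interpret H: group H by (rule H)
  interpret \<phi>: group_hom H G \<phi> by unfold_locales (rule \<phi>)
  obtain \<kappa> where \<kappa>: "\<And>x. x \<in> carrier G \<Longrightarrow> \<kappa> x \<in> carrier H"
    "\<And>x h. x \<in> carrier G \<Longrightarrow> h \<in> carrier H \<Longrightarrow> \<kappa> (x \<otimes> \<phi> h) = \<kappa> x \<otimes>\<^bsub>H\<^esub> h"
    using coset_coordinate[OF H \<phi>] by blast
  define Xs where "Xs A = {x \<in> carrier G. inv\<^bsub>H\<^esub> \<kappa> x \<in> A}" for A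
  show ?thesis
  proof (rule H.amenableI_approx)
    fix S and \<eta>' :: real assume S: "finite S" "S \<subseteq> carrier H" and \<eta>': "0 < \<eta>'"
    \<comment> \<open>The error has three parts: the squared displacement, at most 2 \<eta>^2, is
      divided by 2 \<eta> and gives \<eta>; the unit masses of \<open>v\<close> and of its translate
      give \<eta> each.\<close>
    define \<eta> where "\<eta> = \<eta>' / 3"
    have \<eta>: "0 < \<eta>" using \<eta>' by (simp add: \<eta>_def)
    then have "0 < 2 * \<eta>\<^sup>2" by simp
    from approx[OF S this] obtain u where u: "u \<in> ell2 G"
      "(\<Sum>s\<in>S. (ell2_norm G (\<lambda>x. rtrans (\<phi> s) u x - u x))\<^sup>2) < 2 * \<eta>\<^sup>2 * (ell2_norm G u)\<^sup>2" by blast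
    have "0 \<le> (\<Sum>s\<in>S. (ell2_norm G (\<lambda>x. rtrans (\<phi> s) u x - u x))\<^sup>2)" by (intro sum_nonneg) simp
    then have "0 < 2 * \<eta>\<^sup>2 * (ell2_norm G u)\<^sup>2" using u(2) by linarith
    then have "ell2_norm G u \<noteq> 0" by auto
    then have pos: "0 < ell2_norm G u" using ell2_norm_nonneg[of G u] by linarith
    define v where "v = (\<lambda>x. complex_of_real (1 / ell2_norm G u) * u x)"
    have v: "v \<in> ell2 G" unfolding v_def by (rule ell2_scale(1)[OF u(1)])
    have norm_v: "ell2_norm G v = 1"
      unfolding v_def ell2_scale(2)[OF u(1)] using pos by (simp add: norm_divide)
    have diff_v: "(ell2_norm G (\<lambda>x. rtrans (\<phi> s) v x - v x))\<^sup>2 \<le> 2 * \<eta>\<^sup>2" if s: "s \<in> S" for s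
    proof -
      have su: "(\<lambda>x. rtrans (\<phi> s) u x - u x) \<in> ell2 G"
        using s S by (intro ell2_diff rtrans_ell2 u) auto
      have "(\<lambda>x. rtrans (\<phi> s) v x - v x) =
          (\<lambda>x. complex_of_real (1 / ell2_norm G u) * (rtrans (\<phi> s) u x - u x))"
        by (auto simp: v_def rtrans_def right_diff_distrib diff_divide_distrib)
      then have "(ell2_norm G (\<lambda>x. rtrans (\<phi> s) v x - v x))\<^sup>2 =
          (ell2_norm G (\<lambda>x. rtrans (\<phi> s) u x - u x))\<^sup>2 / (ell2_norm G u)\<^sup>2"
        using pos by (simp only: ell2_scale(2)[OF su]) (simp add: norm_divide power_divide)
      moreover have "(ell2_norm G (\<lambda>x. rtrans (\<phi> s) u x - u x))\<^sup>2 \<le>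
          (\<Sum>s\<in>S. (ell2_norm G (\<lambda>x. rtrans (\<phi> s) u x - u x))\<^sup>2)"
        by (rule member_le_sum) (use s S in auto)
      ultimately show ?thesis using u(2) pos by (simp add: divide_le_eq)
    qed
    define p where "p = (\<lambda>x. (cmod (v x))\<^sup>2)"
    have p_sum: "(p has_sum 1) (carrier G)"
      using ell2_has_sum[OF v] by (simp add: p_def norm_v)
    have p_on: "p summable_on B" if "B \<subseteq> carrier G" for B
      using summable_on_subset_banach[OF has_sum_imp_summable[OF p_sum] that] .
    define m where "m A = infsum p (Xs A)" for A
    have Xs_sub: "Xs A \<subseteq> carrier G" for A by (auto simp: Xs_def)
    have m_nonneg: "0 \<le> m A" for A unfolding m_def by (rule infsum_nonneg) (simp add: p_def)
    have m_le: "m A \<le> 1" for A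
    proof -
      have "infsum p (Xs A) \<le> infsum p (carrier G)"
        by (rule infsum_mono_neutral) (use Xs_sub p_on in \<open>auto simp: p_def\<close>)
      then show ?thesis using infsumI[OF p_sum] by (simp add: m_def)
    qed
    have "Xs (carrier H) = carrier G" by (auto simp: Xs_def \<kappa>)
    then have m_one: "m (carrier H) = 1" using infsumI[OF p_sum] by (simp add: m_def)
    have m_Un: "m (A \<union> B) = m A + m B" if "A \<inter> B = {}" for A B
    proof -
      have "Xs (A \<union> B) = Xs A \<union> Xs B" "Xs A \<inter> Xs B = {}" using that by (auto simp: Xs_def)
      then show ?thesis unfolding m_def by (simp add: infsum_Un_disjoint p_on Xs_sub)
    qed
    have m_inv: "\<bar>m (s <#\<^bsub>H\<^esub> A) - m A\<bar> \<le> \<eta>'" if s: "s \<in> S" and A: "A \<subseteq> carrier H" for s A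
    proof -
      have sH: "s \<in> carrier H" using s S by blast
      \<comment> \<open>Right translation by \<open>\<phi> s\<close> multiplies the inverse of
        \<open>\<kappa> x\<close> by the inverse of \<open>s\<close> on the left, so the preimage of
        s A is carried onto that of A.\<close>
      have "bij_betw (\<lambda>x. x \<otimes> \<phi> s) (Xs (s <#\<^bsub>H\<^esub> A)) (Xs A)"
      proof (rule bij_betwI[where g = "\<lambda>x. x \<otimes> \<phi> (inv\<^bsub>H\<^esub> s)"])
        show "(\<lambda>x. x \<otimes> \<phi> s) \<in> Xs (s <#\<^bsub>H\<^esub> A) \<rightarrow> Xs A"
        proof
          fix x assume "x \<in> Xs (s <#\<^bsub>H\<^esub> A)"
          then obtain a where x: "x \<in> carrier G" "a \<in> A" "inv\<^bsub>H\<^esub> \<kappa> x = s \<otimes>\<^bsub>H\<^esub> a"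
            by (auto simp: Xs_def l_coset_def)
          have "inv\<^bsub>H\<^esub> \<kappa> (x \<otimes> \<phi> s) = inv\<^bsub>H\<^esub> s \<otimes>\<^bsub>H\<^esub> inv\<^bsub>H\<^esub> \<kappa> x"
            using x sH \<kappa> by (simp add: H.inv_mult_group)
          also have "\<dots> = a" using x A sH by (auto simp: H.m_assoc[symmetric] subset_iff)
          finally show "x \<otimes> \<phi> s \<in> Xs A" using x sH by (simp add: Xs_def)
        qed
        show "(\<lambda>x. x \<otimes> \<phi> (inv\<^bsub>H\<^esub> s)) \<in> Xs A \<rightarrow> Xs (s <#\<^bsub>H\<^esub> A)"
        proof
          fix x assume "x \<in> Xs A"
          then have x: "x \<in> carrier G" "inv\<^bsub>H\<^esub> \<kappa> x \<in> A" by (auto simp: Xs_def)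
          have "inv\<^bsub>H\<^esub> \<kappa> (x \<otimes> \<phi> (inv\<^bsub>H\<^esub> s)) = s \<otimes>\<^bsub>H\<^esub> inv\<^bsub>H\<^esub> \<kappa> x"
            using x sH \<kappa> by (simp add: H.inv_mult_group del: \<phi>.hom_inv)
          then show "x \<otimes> \<phi> (inv\<^bsub>H\<^esub> s) \<in> Xs (s <#\<^bsub>H\<^esub> A)"
            using x sH by (auto simp: Xs_def l_coset_def simp del: \<phi>.hom_inv)
        qed
      qed (use sH Xs_sub in \<open>auto simp: m_assoc subset_iff\<close>)
      from infsum_reindex_bij_betw[OF this, of p] summable_on_reindex_bij_betw[OF this, of p]
      have mA: "m A = infsum (\<lambda>x. p (x \<otimes> \<phi> s)) (Xs (s <#\<^bsub>H\<^esub> A))"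
        and on: "(\<lambda>x. p (x \<otimes> \<phi> s)) summable_on (Xs (s <#\<^bsub>H\<^esub> A))"
        using p_on[OF Xs_sub] by (auto simp: m_def)
      define Y where "Y = Xs (s <#\<^bsub>H\<^esub> A)"
      define w where "w = (\<lambda>x. rtrans (\<phi> s) v x - v x)"
      have r: "rtrans (\<phi> s) v \<in> ell2 G" "ell2_norm G (rtrans (\<phi> s) v) = 1"
        using rtrans_ell2[OF v] sH norm_v by auto
      have w: "w \<in> ell2 G" unfolding w_def by (intro ell2_diff r v)
      define b where "b = (\<lambda>x. 1 / (2 * \<eta>) * (cmod (w x))\<^sup>2 + \<eta> * ((cmod (rtrans (\<phi> s) v x))\<^sup>2 + p x))"
      have b_sum: "(b has_sum (1 / (2 * \<eta>) * (ell2_norm G w)\<^sup>2 + \<eta> * (1 + 1))) (carrier G)"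
        unfolding b_def
        by (intro has_sum_add has_sum_cmult_right p_sum ell2_has_sum w)
           (use ell2_has_sum[OF r(1)] r(2) in simp)
      have b_nonneg: "0 \<le> b x" for x using \<eta> by (simp add: b_def p_def)
      have b_on: "b summable_on Y"
        using summable_on_subset_banach[OF has_sum_imp_summable[OF b_sum]] Xs_sub by (simp add: Y_def)
      have pb: "\<bar>p (x \<otimes> \<phi> s) - p x\<bar> \<le> b x" if "x \<in> Y" for x
      proof -
        have "x \<in> carrier G" using that Xs_sub by (auto simp: Y_def)
        then show ?thesis
          using abs_power2_diff_le[OF \<eta>, of "v (x \<otimes> \<phi> s)" "v x"]
          by (simp add: p_def b_def w_def rtrans_def)
      qed
      have le: "infsum f Y \<le> infsum g Y + infsum b Y"
        if "f summable_on Y" "g summable_on Y" "\<And>x. x \<in> Y \<Longrightarrow> \<bar>f x - g x\<bar> \<le> b x" for f g :: "'a \<Rightarrow> real"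
      proof -
        have "infsum f Y \<le> infsum (\<lambda>x. g x + b x) Y"
          by (rule infsum_mono[OF that(1) summable_on_add[OF that(2) b_on]]) (use that(3) in force)
        then show ?thesis by (simp add: infsum_add[OF that(2) b_on])
      qed
      have pY: "p summable_on Y" using p_on[OF Xs_sub] by (simp add: Y_def)
      have "m A \<le> m (s <#\<^bsub>H\<^esub> A) + infsum b Y"
        unfolding mA unfolding m_def Y_def[symmetric]
        by (rule le) (use on pY pb in \<open>auto simp: Y_def\<close>)
      moreover have "m (s <#\<^bsub>H\<^esub> A) \<le> m A + infsum b Y"
        unfolding mA unfolding m_def Y_def[symmetric]
        by (rule le) (use on pY pb in \<open>auto simp: Y_def abs_minus_commute\<close>)
      ultimately have "\<bar>m (s <#\<^bsub>H\<^esub> A) - m A\<bar> \<le> infsum b Y" by linarith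
      also have "\<dots> \<le> infsum b (carrier G)"
        by (rule infsum_mono_neutral[OF b_on has_sum_imp_summable[OF b_sum]])
           (use b_nonneg Xs_sub in \<open>auto simp: Y_def\<close>)
      also have "\<dots> = 1 / (2 * \<eta>) * (ell2_norm G w)\<^sup>2 + \<eta> * (1 + 1)" by (rule infsumI[OF b_sum])
      also have "\<dots> \<le> 1 / (2 * \<eta>) * (2 * \<eta>\<^sup>2) + \<eta> * (1 + 1)"
        using diff_v[OF s] \<eta> unfolding w_def by (intro add_right_mono mult_left_mono) auto
      also have "\<dots> = \<eta>'" using \<eta> by (simp add: \<eta>_def power2_eq_square)
      finally show ?thesis .
    qed
    show "\<exists>m. mean_on (carrier H) m \<and>
      (\<forall>s\<in>S. \<forall>A. A \<subseteq> carrier H \<longrightarrow> \<bar>m (s <#\<^bsub>H\<^esub> A) - m A\<bar> \<le> \<eta>')"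
      using m_nonneg m_le m_one m_Un m_inv by (intro exI[of _ m]) (auto simp: mean_on_def)
  qed
qed

section \<open>Growth and paradoxical decompositions\<close>

text \<open>Rado's proof: in a family of sets minimal subject to Hall's condition all members are singletons.\<close>

theorem hall:
  fixes Xs :: "'i \<Rightarrow> 'b set"
  assumes fin: "\<And>i. i \<in> I \<Longrightarrow> finite (Xs i)"
    and hall: "\<And>J. finite J \<Longrightarrow> J \<subseteq> I \<Longrightarrow> card J \<le> card (\<Union>i\<in>J. Xs i)"
  obtains f where "inj_on f I" "\<And>i. i \<in> I \<Longrightarrow> f i \<in> Xs i"
proof -
  define E where "E = Sigma I Xs"
  define good where "good R \<longleftrightarrow> (\<forall>J. finite J \<longrightarrow> J \<subseteq> I \<longrightarrow> card J \<le> card (R `` J))"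
    for R :: "('i \<times> 'b) set"
  have fin_E: "finite (E \<inter> J \<times> UNIV)" if "finite J" for J
  proof (rule finite_subset)
    show "E \<inter> J \<times> UNIV \<subseteq> Sigma (I \<inter> J) Xs" by (auto simp: E_def)
    show "finite (Sigma (I \<inter> J) Xs)" using that fin by (intro finite_SigmaI) auto
  qed
  have fin_im: "finite (R `` J)" if "R \<subseteq> E" "finite J" for R J
  proof (rule finite_subset)
    show "R `` J \<subseteq> snd ` (E \<inter> J \<times> UNIV)" using that(1) by force
  qed (use fin_E[OF that(2)] in simp)
  \<comment> \<open>Zorn's lemma is applied to sets of deleted edges; a maximal deletion leaves a
    minimal relation satisfying Hall's condition.\<close>
  define A where "A = {Z. Z \<subseteq> E \<and> good (E - Z)}"
  have "\<exists>M\<in>A. \<forall>Z\<in>A. M \<subseteq> Z \<longrightarrow> Z = M"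
  proof (rule subset_Zorn')
    fix C assume C: "subset.chain A C"
    have sub: "\<Union>C \<subseteq> E" using C by (auto simp: A_def subset.chain_def)
    have "good (E - \<Union>C)"
      unfolding good_def
    proof (intro allI impI)
      fix J assume J: "finite J" "J \<subseteq> I"
      show "card J \<le> card ((E - \<Union>C) `` J)"
      proof (cases "C = {}")
        case True
        have "E `` J = (\<Union>i\<in>J. Xs i)" using J by (auto simp: E_def)
        then show ?thesis using hall[OF J] True by simp
      next
        case False
        \<comment> \<open>A finite \<open>J\<close> meets finitely many edges, so over
          \<open>J\<close> the union of the chain deletes no more than some single member.\<close>
        have "finite (E \<inter> J \<times> UNIV \<inter> \<Union>C)" using fin_E[OF J(1)] by simp
        then obtain Z where Z: "Z \<in> C" "E \<inter> J \<times> UNIV \<inter> \<Union>C \<subseteq> Z"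
          using finite_subset_Union_chain[OF _ _ False C] by (metis inf_le2)
        then have "(E - \<Union>C) `` J = (E - Z) `` J" by blast
        moreover have "good (E - Z)" using Z(1) C by (auto simp: A_def subset.chain_def)
        ultimately show ?thesis using J by (simp add: good_def)
      qed
    qed
    with sub show "\<Union>C \<in> A" by (simp add: A_def)
  qed
  then obtain M where M: "M \<in> A" "\<And>Z. Z \<in> A \<Longrightarrow> M \<subseteq> Z \<Longrightarrow> Z = M" by blast
  define R where "R = E - M"
  have R: "R \<subseteq> E" "good R" using M(1) by (auto simp: R_def A_def)
  have goodD: "card J \<le> card (R `` J)" if "finite J" "J \<subseteq> I" for J
    using R(2) that by (simp add: good_def)
  \<comment> \<open>By minimality, deleting the edge \<open>(i, x)\<close> violates Hall's condition
    at some finite set. That set contains \<open>i\<close>, and \<open>J\<close> is what remains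
    without \<open>i\<close>.\<close>
  have removal: "\<exists>J. finite J \<and> J \<subseteq> I - {i} \<and> card (R `` J \<union> (R `` {i} - {x})) \<le> card J"
    if "(i, x) \<in> R" for i x
  proof -
    have "insert (i, x) M \<notin> A"
      using M(2)[of "insert (i, x) M"] that by (auto simp: R_def)
    moreover have "insert (i, x) M \<subseteq> E" using that R M(1) by (auto simp: A_def)
    moreover have "E - insert (i, x) M = R - {(i, x)}" by (auto simp: R_def)
    ultimately have "\<not> good (R - {(i, x)})" by (simp add: A_def)
    then obtain J where J: "finite J" "J \<subseteq> I" "card ((R - {(i, x)}) `` J) < card J"
      unfolding good_def by (meson not_le)
    have "i \<in> J"
    proof (rule ccontr)
      assume "i \<notin> J"
      then have "(R - {(i, x)}) `` J = R `` J" by auto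
      then show False using goodD[OF J(1,2)] J(3) by simp
    qed
    have "(R - {(i, x)}) `` J = R `` (J - {i}) \<union> (R `` {i} - {x})"
      using \<open>i \<in> J\<close> by auto
    then show ?thesis
      using J \<open>i \<in> J\<close> by (intro exI[of _ "J - {i}"]) auto
  qed
  have single: "\<exists>x. R `` {i} = {x}" if i: "i \<in> I" for i
  proof -
    have "1 \<le> card (R `` {i})" using goodD[of "{i}"] i by simp
    then obtain x where x: "(i, x) \<in> R" by (metis Image_singleton_iff all_not_in_conv card.empty not_one_le_zero)
    have "y = x" if y: "(i, y) \<in> R" for y
    proof (rule ccontr)
      assume "y \<noteq> x"
      \<comment> \<open>Two edges at \<open>i\<close> contradict inclusion-exclusion:
        \<open>S\<close> and \<open>T\<close> have at most |J| + |K| elements in total, while Hall's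
        condition forces |J \<union> K| + 1 elements in their union and |J \<inter> K| in their
        intersection.\<close>
      obtain J K where J: "finite J" "J \<subseteq> I - {i}" "card (R `` J \<union> (R `` {i} - {x})) \<le> card J"
        and K: "finite K" "K \<subseteq> I - {i}" "card (R `` K \<union> (R `` {i} - {y})) \<le> card K"
        using removal[OF x] removal[OF y] by blast
      define S where "S = R `` J \<union> (R `` {i} - {x})"
      define T where "T = R `` K \<union> (R `` {i} - {y})"
      have fS: "finite S" "finite T"
        unfolding S_def T_def using fin_im[OF R(1)] J(1) K(1) by auto
      have "S \<union> T = R `` (insert i (J \<union> K))" unfolding S_def T_def using \<open>y \<noteq> x\<close> by auto
      then have "card (insert i (J \<union> K)) \<le> card (S \<union> T)"
        using goodD[of "insert i (J \<union> K)"] J K i by auto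
      moreover have "card (insert i (J \<union> K)) = Suc (card (J \<union> K))"
        using J K by (intro card_insert_disjoint) auto
      moreover have "card (J \<inter> K) \<le> card (S \<inter> T)"
      proof -
        have "card (J \<inter> K) \<le> card (R `` (J \<inter> K))" using J K by (intro goodD) auto
        also have "\<dots> \<le> card (S \<inter> T)" using fS by (intro card_mono) (auto simp: S_def T_def)
        finally show ?thesis .
      qed
      moreover have "card S + card T = card (S \<union> T) + card (S \<inter> T)" by (rule card_Un_Int[OF fS])
      moreover have "card J + card K = card (J \<union> K) + card (J \<inter> K)" by (rule card_Un_Int[OF J(1) K(1)])
      ultimately show False using J(3) K(3) by (simp add: S_def T_def)
    qed
    then show ?thesis using x by auto
  qed
  define f where "f i = (THE x. x \<in> R `` {i})" for i
  have f: "R `` {i} = {f i}" if "i \<in> I" for i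
    using single[OF that] unfolding f_def by (metis singletonD singletonI the_equality)
  show thesis
  proof (rule that)
    show "f i \<in> Xs i" if "i \<in> I" for i
      using f[OF that] R(1) by (auto simp: E_def)
    show "inj_on f I"
    proof (rule inj_onI)
      fix i j assume ij: "i \<in> I" "j \<in> I" "f i = f j"
      have "R `` {i, j} = {f i}" using f[OF ij(1)] f[OF ij(2)] ij(3) by auto
      then have "card {i, j} \<le> 1" using goodD[of "{i, j}"] ij by simp
      then show "i = j" by (cases "i = j") auto
    qed
  qed
qed

context group
begin

lemma subset_set_mult_one:
  assumes "A \<subseteq> carrier G" "\<one> \<in> V"
  shows "A \<subseteq> A <#> V"
proof
  fix x assume "x \<in> A"
  then have "x = x \<otimes> \<one>" using assms by auto
  then show "x \<in> A <#> V" using assms(2) \<open>x \<in> A\<close> unfolding set_mult_def by blast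
qed

text \<open>The gap is tested on the indicator of \<open>A\<close>, whose squared norm is |A|. Its
  translate by \<open>s\<close> is the indicator of A s^-1. Both sets have the same size and lie in
  A V, so their symmetric difference has at most 2 (|A V| - |A|) elements; hence the inverses and
  the identity in \<open>V\<close>.\<close>

lemma card_set_mult_growth:
  assumes S: "finite S" "S \<subseteq> carrier G" and C: "0 \<le> C"
    and gap: "\<And>v. v \<in> ell2 G \<Longrightarrow> ell2_norm G v \<le> C * (\<Sum>s\<in>S. ell2_norm G (\<lambda>x. rtrans s v x - v x))"
    and A: "finite A" "A \<subseteq> carrier G"
  defines "V \<equiv> insert \<one> ((\<lambda>s. inv s) ` S)"
  shows "real (card A) \<le> 2 * (C * card S)\<^sup>2 * (real (card (A <#> V)) - real (card A))"
proof -
  define v where "v x = (if x \<in> A then 1 else 0 :: complex)" for x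
  have sq: "((\<lambda>x. (cmod (if x \<in> B then b x else 0))\<^sup>2) has_sum card B) (carrier G)"
    if "finite B" "B \<subseteq> carrier G" "\<And>x. x \<in> B \<Longrightarrow> cmod (b x) = 1" for B b
    by (rule has_sum_finite_neutralI[OF that(1,2)]) (use that(3) in auto)
  have v: "v \<in> ell2 G" "(ell2_norm G v)\<^sup>2 = card A"
    using sq[OF A, of "\<lambda>_. 1"] A
    by (auto simp: v_def[abs_def] intro!: ell2I_has_sum ell2_norm_eqI)
  define D where "D = real (card (A <#> V)) - real (card A)"
  have fin_AV: "finite (A <#> V)"
    using A S unfolding set_mult_def V_def by auto
  have A_sub: "A \<subseteq> A <#> V"
    by (rule subset_set_mult_one) (use A in \<open>auto simp: V_def\<close>)
  have D: "0 \<le> D" unfolding D_def using card_mono[OF fin_AV A_sub] by simp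
  have step: "ell2_norm G (\<lambda>x. rtrans s v x - v x) \<le> sqrt (2 * D)" if s: "s \<in> S" for s
  proof -
    have sG: "s \<in> carrier G" using s S by blast
    define B where "B = (\<lambda>a. a \<otimes> inv s) ` A"
    have B: "finite B" "B \<subseteq> carrier G" "card B = card A"
      using A sG by (auto simp: B_def intro!: card_image inj_onI dest: r_cancel)
    have B_iff: "x \<otimes> s \<in> A \<longleftrightarrow> x \<in> B" if "x \<in> carrier G" for x
    proof
      assume "x \<otimes> s \<in> A"
      moreover have "x = x \<otimes> s \<otimes> inv s" using that sG by (simp add: m_assoc)
      ultimately show "x \<in> B" unfolding B_def by blast
    next
      assume "x \<in> B"
      then show "x \<otimes> s \<in> A" using A sG by (auto simp: B_def m_assoc)
    qed
    have B_sub: "B \<subseteq> A <#> V"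
      unfolding B_def set_mult_def V_def using s by blast
    define Q where "Q = (A - B) \<union> (B - A)"
    have Q: "finite Q" "Q \<subseteq> carrier G" using A B by (auto simp: Q_def)
    have "rtrans s v x - v x = (if x \<in> Q then (if x \<in> B then 1 else - 1) else 0)" for x
      using B_iff[of x] A B by (auto simp: rtrans_def v_def Q_def)
    then have "(ell2_norm G (\<lambda>x. rtrans s v x - v x))\<^sup>2 = card Q"
      using sq[OF Q, of "\<lambda>x. if x \<in> B then 1 else - 1"] by (intro ell2_norm_eqI) simp
    also have "card Q = card (A - B) + card (B - A)"
      unfolding Q_def using A B by (intro card_Un_disjoint) auto
    also have "real (card (A - B) + card (B - A)) \<le> 2 * D"
    proof -
      have "card (A - B) = card (A \<union> B) - card B" "card (B - A) = card (A \<union> B) - card A"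
        using A B card_Diff_subset[of B "A \<union> B"] card_Diff_subset[of A "A \<union> B"]
        by (auto simp: Un_Diff)
      moreover have "card (A \<union> B) \<le> card (A <#> V)"
        using A_sub B_sub fin_AV by (intro card_mono) auto
      moreover have "card A \<le> card (A \<union> B)" using A B by (intro card_mono) auto
      ultimately show ?thesis using B(3) by (simp add: D_def of_nat_diff)
    qed
    finally show ?thesis by (simp add: real_le_rsqrt)
  qed
  note gap[OF v(1)]
  also have "C * (\<Sum>s\<in>S. ell2_norm G (\<lambda>x. rtrans s v x - v x)) \<le> C * (\<Sum>s\<in>S. sqrt (2 * D))"
    by (intro mult_left_mono sum_mono step C)
  finally have "ell2_norm G v \<le> C * (\<Sum>s\<in>S. sqrt (2 * D))" .
  then have "(ell2_norm G v)\<^sup>2 \<le> (C * (card S * sqrt (2 * D)))\<^sup>2"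
    by (intro power_mono) auto
  then show ?thesis using D unfolding v(2) by (simp add: D_def[symmetric] power_mult_distrib mult_ac)
qed

text \<open>One multiplication by \<open>V\<close> enlarges finite sets by a fixed factor above 1,
  so a sufficiently high power of \<open>V\<close> doubles them.\<close>

lemma exists_doubling_set:
  assumes S: "finite S" "S \<subseteq> carrier G" and C: "0 \<le> C"
    and gap: "\<And>v. v \<in> ell2 G \<Longrightarrow> ell2_norm G v \<le> C * (\<Sum>s\<in>S. ell2_norm G (\<lambda>x. rtrans s v x - v x))"
  obtains W where "finite W" "W \<subseteq> carrier G"
    "\<And>A. finite A \<Longrightarrow> A \<subseteq> carrier G \<Longrightarrow> 2 * card A \<le> card (A <#> W)"
proof -
  define V where "V = insert \<one> ((\<lambda>s. inv s) ` S)"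
  have V: "finite V" "V \<subseteq> carrier G" using S by (auto simp: V_def)
  have set_mult_finite: "finite (A <#> B)" if "finite A" "finite B" for A B
    using that unfolding set_mult_def by auto
  define c where "c = 2 * (C * card S)\<^sup>2"
  have c: "0 \<le> c" by (simp add: c_def)
  \<comment> \<open>From |A| \<le> c D and D \<ge> 0 follows D \<ge> |A| / (c + 1); the added 1
    avoids dividing by zero.\<close>
  define q where "q = 1 + 1 / (c + 1)"
  have q: "1 < q" using c by (simp add: q_def)
  have grow: "q * real (card A) \<le> real (card (A <#> V))" if A: "finite A" "A \<subseteq> carrier G" for A
  proof -
    define D where "D = real (card (A <#> V)) - real (card A)"
    have le: "real (card A) \<le> c * D"
      using card_set_mult_growth[OF S C gap A] by (simp add: c_def V_def D_def)
    have "0 \<le> D"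
    proof -
      have "A \<subseteq> A <#> V" by (rule subset_set_mult_one) (use A in \<open>auto simp: V_def\<close>)
      then show ?thesis using card_mono[OF set_mult_finite[OF A(1) V(1)]] by (simp add: D_def)
    qed
    with le have "real (card A) \<le> (c + 1) * D" by (simp add: algebra_simps)
    then have "real (card A) / (c + 1) \<le> D" using c by (simp add: pos_divide_le_eq mult.commute)
    then show ?thesis by (simp add: q_def D_def algebra_simps)
  qed
  define W where "W k = ((\<lambda>B. B <#> V) ^^ k) {\<one>}" for k
  have W: "finite (W k) \<and> W k \<subseteq> carrier G" for k
    by (induction k) (auto simp: W_def set_mult_finite V intro: subsetD[OF set_mult_closed[OF _ V(2)]])
  have pow: "q ^ k * real (card A) \<le> real (card (A <#> W k))" if A: "finite A" "A \<subseteq> carrier G" for A k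
  proof (induction k)
    case 0
    have "A <#> {\<one>} = A"
      using subset_set_mult_one[OF A(2), of "{\<one>}"] A by (auto simp: set_mult_def subset_iff)
    then show ?case by (simp add: W_def)
  next
    case (Suc k)
    have "q ^ Suc k * real (card A) \<le> q * real (card (A <#> W k))"
      using Suc.IH q by (simp add: mult.assoc)
    also have "\<dots> \<le> real (card ((A <#> W k) <#> V))"
      using W[of k] A by (intro grow set_mult_finite set_mult_closed) auto
    also have "(A <#> W k) <#> V = A <#> W (Suc k)"
      using set_mult_assoc[OF A(2) _ V(2), of "W k"] W[of k] by (simp add: W_def)
    finally show ?case .
  qed
  obtain k where k: "2 < q ^ k" using real_arch_pow[OF q] by blast
  show thesis
  proof (rule that[of "W k"])
    fix A assume A: "finite A" "A \<subseteq> carrier G"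
    have "2 * real (card A) \<le> q ^ k * real (card A)" using k by (intro mult_right_mono) auto
    then have "real (2 * card A) \<le> real (card (A <#> W k))" using pow[OF A, of k] by simp
    then show "2 * card A \<le> card (A <#> W k)" by (simp only: of_nat_le_iff)
  qed (use W[of k] in auto)
qed

lemma mean_UN_disjoint:
  fixes m :: "'a set \<Rightarrow> real"
  assumes add: "\<And>A B. A \<subseteq> carrier G \<Longrightarrow> B \<subseteq> carrier G \<Longrightarrow> A \<inter> B = {} \<Longrightarrow> m (A \<union> B) = m A + m B"
    and I: "finite I" "\<And>i. i \<in> I \<Longrightarrow> B i \<subseteq> carrier G"
    "\<And>i j. i \<in> I \<Longrightarrow> j \<in> I \<Longrightarrow> i \<noteq> j \<Longrightarrow> B i \<inter> B j = {}"
  shows "m (\<Union>i\<in>I. B i) = (\<Sum>i\<in>I. m (B i))"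
  using I
proof (induction I rule: finite_induct)
  case empty
  show ?case using add[of "{}" "{}"] by simp
next
  case (insert i I)
  have "m (B i \<union> (\<Union>j\<in>I. B j)) = m (B i) + m (\<Union>j\<in>I. B j)"
  proof (rule add)
    show "B i \<inter> (\<Union>j\<in>I. B j) = {}" using insert.prems(2)[of i] insert.hyps by auto
  qed (use insert.prems(1) in auto)
  moreover have "m (\<Union>j\<in>I. B j) = (\<Sum>j\<in>I. m (B j))" using insert.prems by (intro insert.IH) auto
  ultimately show ?case using insert.hyps by simp
qed

text \<open>A set \<open>W\<close> with \<open>\<bar>A W\<bar> \<ge> 2 \<bar>A\<bar>\<close> yields, by Hall's theorem, two injections with disjoint images
  that move each point by an element of a finite set. Such a paradoxical decomposition excludes
  invariant means.\<close>

lemma not_amenable_if_doubling: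
  assumes W: "finite W" "W \<subseteq> carrier G"
    and dbl: "\<And>A. finite A \<Longrightarrow> A \<subseteq> carrier G \<Longrightarrow> 2 * card A \<le> card (A <#> W)"
  shows "\<not> amenable G"
proof
  assume "amenable G"
  then obtain m :: "'a set \<Rightarrow> real" where m0: "\<forall>A. A \<subseteq> carrier G \<longrightarrow> 0 \<le> m A" "m (carrier G) = 1"
    "\<forall>A B. A \<subseteq> carrier G \<and> B \<subseteq> carrier G \<and> A \<inter> B = {} \<longrightarrow> m (A \<union> B) = m A + m B"
    "\<forall>g\<in>carrier G. \<forall>A. A \<subseteq> carrier G \<longrightarrow> m (g <#\<^bsub>G\<^esub> A) = m A"
    unfolding amenable_def by (elim exE conjE) (rule that)
  have m: "\<And>A. A \<subseteq> carrier G \<Longrightarrow> 0 \<le> m A" "m (carrier G) = 1"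
    "\<And>A B. A \<subseteq> carrier G \<Longrightarrow> B \<subseteq> carrier G \<Longrightarrow> A \<inter> B = {} \<Longrightarrow> m (A \<union> B) = m A + m B"
    "\<And>g A. g \<in> carrier G \<Longrightarrow> A \<subseteq> carrier G \<Longrightarrow> m (g <#\<^bsub>G\<^esub> A) = m A"
    by (simp_all add: m0)
  \<comment> \<open>Doubling concerns products on the right, means are invariant under translation
    from the left; inverses exchange the two sides.\<close>
  define U where "U = (\<lambda>w. inv w) ` W"
  have U: "finite U" "U \<subseteq> carrier G" using W by (auto simp: U_def)
  \<comment> \<open>Two copies of each x are to be matched with distinct elements u x, u in
    \<open>U\<close>. Hall's condition is the doubling property of the set of inverses.\<close>
  define I where "I = carrier G \<times> (UNIV :: bool set)"
  define Xs where "Xs i = (\<lambda>u. u \<otimes> fst i) ` U" for i :: "'a \<times> bool"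
  obtain f where f: "inj_on f I" "\<And>i. i \<in> I \<Longrightarrow> f i \<in> Xs i"
  proof (rule hall[of I Xs])
    show "finite (Xs i)" for i using U by (simp add: Xs_def)
    fix J assume J: "finite J" "J \<subseteq> I"
    define A where "A = (\<lambda>w. inv w) ` fst ` J"
    have JG: "fst ` J \<subseteq> carrier G" using J by (auto simp: I_def)
    have A: "finite A" "A \<subseteq> carrier G" using J JG by (auto simp: A_def)
    have inj_inv: "inj_on (\<lambda>w. inv w) B" if "B \<subseteq> carrier G" for B
      by (rule inj_onI) (metis inv_inv subsetD that)
    have "J \<subseteq> fst ` J \<times> UNIV" by force
    then have "card J \<le> card (fst ` J \<times> (UNIV :: bool set))" using J by (intro card_mono) auto
    also have "\<dots> = 2 * card A"
      using card_image[OF inj_inv[OF JG]] by (simp add: A_def card_cartesian_product)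
    also have "\<dots> \<le> card (A <#> W)" by (rule dbl[OF A])
    also have "\<dots> = card ((\<lambda>w. inv w) ` (A <#> W))"
      using card_image[OF inj_inv[OF set_mult_closed[OF A(2) W(2)]]] by simp
    also have "(\<lambda>w. inv w) ` (A <#> W) = (\<Union>i\<in>J. Xs i)"
    proof -
      have "(\<lambda>w. inv w) ` (A <#> W) = (\<Union>a\<in>A. \<Union>w\<in>W. {inv (a \<otimes> w)})"
        unfolding set_mult_def by auto
      also have "\<dots> = (\<Union>i\<in>J. \<Union>w\<in>W. {inv (inv (fst i) \<otimes> w)})"
        unfolding A_def by auto
      also have "\<dots> = (\<Union>i\<in>J. \<Union>w\<in>W. {inv w \<otimes> fst i})"
        using JG W by (intro SUP_cong refl) (auto simp: inv_mult_group subset_iff)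
      finally show ?thesis unfolding Xs_def U_def by auto
    qed
    finally show "card J \<le> card (\<Union>i\<in>J. Xs i)" .
  qed (rule that)
  \<comment> \<open>The points of one copy that the matching moves by the same u. In each copy these
    pieces partition the group, so their means add up to 2, yet their translates by u are pairwise
    disjoint.\<close>
  define B where "B k = {x \<in> carrier G. f (x, snd k) = fst k \<otimes> x}" for k :: "'a \<times> bool"
  define K where "K = U \<times> (UNIV :: bool set)"
  have K: "finite K" using U by (simp add: K_def)
  have BG: "B k \<subseteq> carrier G" for k by (auto simp: B_def)
  have one: "(\<Sum>u\<in>U. m (B (u, b))) = 1" for b
  proof -
    have "(\<Union>u\<in>U. B (u, b)) = carrier G"
      using f(2) by (force simp: B_def Xs_def I_def)
    moreover have "m (\<Union>u\<in>U. B (u, b)) = (\<Sum>u\<in>U. m (B (u, b)))"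
      by (rule mean_UN_disjoint[OF m(3)]) (use U in \<open>auto simp: B_def subset_iff\<close>)
    ultimately show ?thesis using m(2) by simp
  qed
  have "(\<Sum>k\<in>K. m (B k)) = (\<Sum>u\<in>U. \<Sum>b\<in>(UNIV :: bool set). m (B (u, b)))"
    unfolding K_def by (simp add: sum.cartesian_product)
  also have "\<dots> = (\<Sum>b\<in>(UNIV :: bool set). \<Sum>u\<in>U. m (B (u, b)))" by (rule sum.swap)
  also have "\<dots> = 2" by (simp add: one)
  finally have two: "(\<Sum>k\<in>K. m (B k)) = 2" .
  define Y where "Y k = fst k <#\<^bsub>G\<^esub> B k" for k
  have Y: "Y k = (\<lambda>x. f (x, snd k)) ` B k" for k
    by (auto simp: Y_def l_coset_def B_def image_iff)
  have YG: "Y k \<subseteq> carrier G" if "k \<in> K" for k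
    unfolding Y_def using that U by (intro l_coset_subset_G BG) (auto simp: K_def)
  have "m (\<Union>k\<in>K. Y k) = (\<Sum>k\<in>K. m (Y k))"
  proof (rule mean_UN_disjoint[OF m(3)])
    fix k l assume kl: "k \<in> K" "l \<in> K" "k \<noteq> l"
    show "Y k \<inter> Y l = {}"
    proof (rule ccontr)
      assume "Y k \<inter> Y l \<noteq> {}"
      then obtain x y where xy: "x \<in> B k" "y \<in> B l" "f (x, snd k) = f (y, snd l)"
        unfolding Y by auto
      have "(x, snd k) = (y, snd l)"
        by (rule inj_onD[OF f(1) xy(3)]) (use xy(1,2) in \<open>auto simp: I_def B_def\<close>)
      then have eq: "x = y" "snd k = snd l" by auto
      have "fst k \<otimes> x = fst l \<otimes> x" "x \<in> carrier G" using xy(1,2) eq by (auto simp: B_def)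
      moreover have "fst k \<in> carrier G" "fst l \<in> carrier G" using kl U by (auto simp: K_def)
      ultimately have "fst k = fst l" by (metis r_cancel)
      with eq(2) show False using kl(3) by (simp add: prod_eq_iff)
    qed
  qed (use K YG in auto)
  also have "\<dots> = (\<Sum>k\<in>K. m (B k))"
    unfolding Y_def using U BG by (intro sum.cong m(4) refl) (auto simp: K_def)
  finally have "m (\<Union>k\<in>K. Y k) = 2" using two by simp
  moreover have "m (carrier G) = m (\<Union>k\<in>K. Y k) + m (carrier G - (\<Union>k\<in>K. Y k))"
    using m(3)[of "\<Union>k\<in>K. Y k" "carrier G - (\<Union>k\<in>K. Y k)"] YG
    by (simp add: UN_subset_iff Un_absorb1)
  moreover have "0 \<le> m (carrier G - (\<Union>k\<in>K. Y k))" by (rule m(1)) auto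
  ultimately show False using m(2) by simp
qed

theorem not_amenable_if_gap:
  assumes S: "finite S" "S \<subseteq> carrier G" and C: "0 \<le> C"
    and gap: "\<And>v. v \<in> ell2 G \<Longrightarrow> ell2_norm G v \<le> C * (\<Sum>s\<in>S. ell2_norm G (\<lambda>x. rtrans s v x - v x))"
  shows "\<not> amenable G"
  by (rule exists_doubling_set[OF S C gap], assumption) (rule not_amenable_if_doubling)

end

section \<open>Thompson's group\<close>

lemma dyadicI: "dyadic (of_int m / 2 ^ n)"
  unfolding dyadic_def by blast

lemma dyadic_of_int [simp]: "dyadic (of_int m)"
  using dyadicI[of m 0] by simp

lemma dyadic_zero [simp]: "dyadic 0"
  using dyadic_of_int[of 0] by simp

lemma dyadic_one [simp]: "dyadic 1"
  using dyadic_of_int[of 1] by simp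

lemma dyadic_add: "dyadic x \<Longrightarrow> dyadic y \<Longrightarrow> dyadic (x + y)"
proof -
  assume "dyadic x" "dyadic y"
  then obtain a m b n where xy: "x = of_int a / 2 ^ m" "y = of_int b / 2 ^ n" unfolding dyadic_def by blast
  have "x + y = of_int (a * 2 ^ n + b * 2 ^ m) / 2 ^ (m + n)"
    unfolding xy by (simp add: field_simps power_add)
  then show ?thesis using dyadicI by metis
qed

lemma dyadic_mult: "dyadic x \<Longrightarrow> dyadic y \<Longrightarrow> dyadic (x * y)"
proof -
  assume "dyadic x" "dyadic y"
  then obtain a m b n where xy: "x = of_int a / 2 ^ m" "y = of_int b / 2 ^ n" unfolding dyadic_def by blast
  have "x * y = of_int (a * b) / 2 ^ (m + n)"
    unfolding xy by (simp add: field_simps power_add)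
  then show ?thesis using dyadicI by metis
qed

lemma dyadic_uminus: "dyadic x \<Longrightarrow> dyadic (- x)"
  using dyadic_mult[OF dyadic_of_int[of "- 1"]] by simp

lemma dyadic_diff: "dyadic x \<Longrightarrow> dyadic y \<Longrightarrow> dyadic (x - y)"
  using dyadic_add[OF _ dyadic_uminus] by fastforce

lemma dyadic_powi: "dyadic (2 powi k)"
proof (cases "k \<ge> 0")
  case True
  have "2 powi k = real_of_int (2 ^ nat k)" using True by (simp add: power_int_def)
  then show ?thesis using dyadic_of_int by metis
next
  case False
  then have "2 powi k = real_of_int 1 / 2 ^ nat (- k)" by (simp add: power_int_def field_simps)
  then show ?thesis using dyadicI by metis
qed

lemma powi_2_pos [simp]: "0 < (2 :: real) powi k"
  by (simp add: zero_less_power_int)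

section \<open>Piecewise linear maps with dyadic breakpoints\<close>

definition dyadic_affine :: "(real \<Rightarrow> real) \<Rightarrow> real \<Rightarrow> real \<Rightarrow> bool" where
  "dyadic_affine f a b \<longleftrightarrow> (\<exists>k::int. \<forall>x\<in>{a..b}. f x = f a + 2 powi k * (x - a))"

definition breakpoints :: "(real \<Rightarrow> real) \<Rightarrow> real set \<Rightarrow> bool" where
  "breakpoints f P \<longleftrightarrow> finite P \<and> (\<forall>p\<in>P. dyadic p) \<and>
     (\<forall>a b. 0 \<le> a \<and> a < b \<and> b \<le> 1 \<and> {a<..<b} \<inter> P = {} \<longrightarrow> dyadic_affine f a b)"

lemma dyadic_piecewise_linear_iff: "dyadic_piecewise_linear f \<longleftrightarrow> (\<exists>P. breakpoints f P)"
  unfolding dyadic_piecewise_linear_def breakpoints_def dyadic_affine_def by blast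

lemma dyadic_affineE:
  assumes "dyadic_affine f a b"
  obtains k :: int where "\<And>x. a \<le> x \<Longrightarrow> x \<le> b \<Longrightarrow> f x = f a + 2 powi k * (x - a)"
proof -
  from assms obtain k :: int where k: "\<forall>x\<in>{a..b}. f x = f a + 2 powi k * (x - a)"
    unfolding dyadic_affine_def ..
  show thesis by (rule that[of k]) (rule k[rule_format], simp)
qed

lemma dyadic_affineI:
  assumes "\<And>x. a \<le> x \<Longrightarrow> x \<le> b \<Longrightarrow> f x = c + 2 powi k * x" "a \<le> b"
  shows "dyadic_affine f a b"
  unfolding dyadic_affine_def using assms
  by (intro exI[of _ k]) (auto simp: algebra_simps)

text \<open>The working form of membership in F: continuity, strict monotonicity and fixed endpoints
  replace the homeomorphism, and extensionality makes agreement on [0,1] an equality.\<close>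

definition pl_map :: "(real \<Rightarrow> real) \<Rightarrow> bool" where
  "pl_map f \<longleftrightarrow> f \<in> extensional {0..1} \<and> continuous_on {0..1} f \<and> strict_mono_on {0..1} f \<and>
     f 0 = 0 \<and> f 1 = 1 \<and> (\<exists>P. breakpoints f P)"

lemma pl_map_range: "pl_map f \<Longrightarrow> f ` {0..1} = {0..1}"
proof
  assume f: "pl_map f"
  have mono: "f x \<le> f y" if "0 \<le> x" "x \<le> y" "y \<le> 1" for x y
    using f that unfolding pl_map_def
    by (intro strict_mono_on_leD[of "{0..1}" f]) auto
  show "f ` {0..1} \<subseteq> {0..1}"
    using mono[of 0] mono[of _ 1] f unfolding pl_map_def by auto
  show "{0..1} \<subseteq> f ` {0..1}"
  proof
    fix y :: real assume "y \<in> {0..1}"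
    then show "y \<in> f ` {0..1}" using IVT'[of f 0 y 1] f unfolding pl_map_def by force
  qed
qed

lemma pl_map_inj: "pl_map f \<Longrightarrow> inj_on f {0..1}"
  unfolding pl_map_def by (auto intro: strict_mono_on_imp_inj_on)

lemma pl_map_less_iff: "pl_map f \<Longrightarrow> x \<in> {0..1} \<Longrightarrow> y \<in> {0..1} \<Longrightarrow> f x < f y \<longleftrightarrow> x < y"
  unfolding pl_map_def by (metis linorder_neqE_linordered_idom order_less_asym strict_mono_onD)

lemma pl_map_in: "pl_map f \<Longrightarrow> x \<in> {0..1} \<Longrightarrow> f x \<in> {0..1}"
  using pl_map_range by blast

lemma carrier_F: "carrier thompson_F = {f. pl_map f}"
proof (intro Set.set_eqI iffI; unfold mem_Collect_eq)
  fix f assume "f \<in> carrier thompson_F"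
  then have f: "f \<in> Bij {0..1}" "\<exists>g. homeomorphism {0..1} {0..1} f g"
      "strict_mono_on {0..1} f" "dyadic_piecewise_linear f"
    by (auto simp: thompson_F_def)
  have ext: "f \<in> extensional {0..1}" and im: "f ` {0..1} = {0..1}"
    using f(1) by (auto simp: Bij_def bij_betw_def)
  have cont: "continuous_on {0..1} f" using f(2) by (auto simp: homeomorphism_def)
  have le: "f x \<le> f y" if "0 \<le> x" "x \<le> y" "y \<le> 1" for x y
    using that by (intro strict_mono_on_leD[OF f(3)]) auto
  have "f x \<in> {0..1}" if "x \<in> {0..1}" for x
    using imageI[OF that, of f] by (simp only: im)
  from this[of 0] this[of 1] have in_I: "f 0 \<in> {0..1}" "f 1 \<in> {0..1}" by auto
  have "0 \<in> f ` {0..1}" "1 \<in> f ` {0..1}" unfolding im by auto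
  then obtain a b where "a \<in> {0..1}" "f a = 0" "b \<in> {0..1}" "f b = 1"
    unfolding image_iff by metis
  then have "f 0 = 0" "f 1 = 1" using le[of 0 a] le[of b 1] in_I by auto
  then show "pl_map f"
    using ext cont f(3,4) by (simp add: pl_map_def dyadic_piecewise_linear_iff)
next
  fix f assume f: "pl_map f"
  have "bij_betw f {0..1} {0..1}"
    using pl_map_inj[OF f] pl_map_range[OF f] by (simp add: bij_betw_def)
  moreover have "\<exists>g. homeomorphism {0..1} {0..1} f g"
    using f pl_map_inj[OF f] pl_map_range[OF f]
    by (intro homeomorphism_compact) (auto simp: pl_map_def)
  ultimately show "f \<in> carrier thompson_F"
    using f by (simp add: thompson_F_def Bij_def pl_map_def dyadic_piecewise_linear_iff)
qed

lemma mult_F: "pl_map f \<Longrightarrow> pl_map g \<Longrightarrow> f \<otimes>\<^bsub>thompson_F\<^esub> g = compose {0..1} f g"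
  using carrier_F by (auto simp: thompson_F_def BijGroup_def)

text \<open>Between breakpoints the slope is 2^k, and multiplication by 2^k or 2^-k preserves dyadic
  numbers; the induction starts from \<open>f 0 = 0\<close>. Composites and inverses need this for
  their breakpoints to be dyadic.\<close>

lemma pl_map_dyadic:
  assumes f: "pl_map f" and x: "x \<in> {0..1}"
  shows "dyadic (f x) \<longleftrightarrow> dyadic x"
proof -
  obtain P where P: "breakpoints f P"
    using f unfolding pl_map_def by blast
  have finP: "finite P" using P by (simp add: breakpoints_def)
  show ?thesis
    using x
  proof (induction "card (P \<inter> {0<..<x})" arbitrary: x rule: less_induct)
    case less
    have piece: "dyadic (f x) \<longleftrightarrow> dyadic x"
      if p: "0 \<le> p" "p < x" "dyadic p" "dyadic (f p)" "{p<..<x} \<inter> P = {}" for p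
    proof -
      have "dyadic_affine f p x" using P p less.prems unfolding breakpoints_def by auto
      then obtain k where k: "\<And>y. p \<le> y \<Longrightarrow> y \<le> x \<Longrightarrow> f y = f p + 2 powi k * (y - p)"
        by (rule dyadic_affineE) (rule that)
      have fx: "f x = f p + 2 powi k * (x - p)" by (rule k) (use p(2) in auto)
      have "2 powi (- k) * (2 powi k :: real) = 1"
        by (simp add: power_int_add[symmetric])
      then have "2 powi (- k) * (f x - f p) = x - p"
        unfolding fx by (simp add: mult.assoc[symmetric])
      then have "x = p + 2 powi (- k) * (f x - f p)" by simp
      then show ?thesis
        by (metis fx p(3,4) dyadic_add dyadic_mult dyadic_diff dyadic_powi)
    qed
    show ?case
    proof (cases "P \<inter> {0<..<x} = {}")
      case True
      show ?thesis
      proof (cases "x = 0")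
        case False
        have "f 0 = 0" using f by (simp add: pl_map_def)
        then show ?thesis using False less.prems True by (intro piece[of 0]) (auto simp: Int_commute)
      qed (use f in \<open>simp add: pl_map_def\<close>)
    next
      case False
      define p where "p = Max (P \<inter> {0<..<x})"
      have fin: "finite (P \<inter> {0<..<x})" using finP by simp
      have p: "p \<in> P" "0 < p" "p < x" using Max_in[OF fin False] by (auto simp: p_def)
      have "card (P \<inter> {0<..<p}) < card (P \<inter> {0<..<x})"
        using fin p by (intro psubset_card_mono) auto
      then have "dyadic (f p) \<longleftrightarrow> dyadic p" using p less.prems by (intro less.hyps) auto
      moreover have "dyadic p" using P p by (simp add: breakpoints_def)
      moreover have "{p<..<x} \<inter> P = {}"
      proof (rule ccontr)
        assume "{p<..<x} \<inter> P \<noteq> {}"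
        then obtain q where q: "p < q" "q < x" "q \<in> P" by auto
        then have "q \<in> P \<inter> {0<..<x}" using p by auto
        then have "q \<le> p" unfolding p_def by (intro Max_ge fin)
        then show False using q by simp
      qed
      ultimately show ?thesis using p by (intro piece[of p]) auto
    qed
  qed
qed

lemma pl_map_id: "pl_map (\<lambda>x\<in>{0..1}. x)"
  unfolding pl_map_def
proof (intro conjI)
  show "continuous_on {0..1::real} (\<lambda>x\<in>{0..1}. x)"
    by (rule continuous_on_eq[OF continuous_on_id]) auto
  have "breakpoints (\<lambda>x\<in>{0..1}. x) {}"
    unfolding breakpoints_def
    by (auto intro!: dyadic_affineI[where c = 0 and k = 0])
  then show "\<exists>P. breakpoints (\<lambda>x\<in>{0..1}. x) P" by blast
qed (auto simp: strict_mono_on_def)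

lemma pl_map_compose:
  assumes f: "pl_map f" and g: "pl_map g"
  shows "pl_map (compose {0..1} f g)"
proof -
  let ?h = "compose {0..1} f g"
  obtain P Q where P: "breakpoints f P" and Q: "breakpoints g Q"
    using f g unfolding pl_map_def by blast
  \<comment> \<open>The composite can break where \<open>g\<close> does, or where \<open>g\<close>
    passes through a breakpoint of \<open>f\<close>.\<close>
  define R where "R = Q \<union> (g -` P \<inter> {0..1})"
  have "breakpoints ?h R"
    unfolding breakpoints_def
  proof (intro conjI allI impI)
    show "finite R"
      using P Q pl_map_inj[OF g] by (auto simp: R_def breakpoints_def intro: finite_vimage_IntI)
    show "\<forall>p\<in>R. dyadic p"
      using P Q pl_map_dyadic[OF g] by (auto simp: R_def breakpoints_def)
    fix a b assume ab: "0 \<le> a \<and> a < b \<and> b \<le> 1 \<and> {a<..<b} \<inter> R = {}"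
    then have "dyadic_affine g a b" using Q unfolding breakpoints_def R_def by blast
    then obtain k where k: "\<And>x. a \<le> x \<Longrightarrow> x \<le> b \<Longrightarrow> g x = g a + 2 powi k * (x - a)"
      by (rule dyadic_affineE) (rule that)
    have gab: "0 \<le> g a" "g a < g b" "g b \<le> 1"
      using pl_map_in[OF g, of a] pl_map_in[OF g, of b] pl_map_less_iff[OF g, of a b] ab by auto
    have "{g a<..<g b} \<inter> P = {}"
    proof (rule ccontr)
      assume "{g a<..<g b} \<inter> P \<noteq> {}"
      then obtain y where y: "g a < y" "y < g b" "y \<in> P" by auto
      then have "y \<in> g ` {0..1}" unfolding pl_map_range[OF g] using gab by auto
      then obtain x where x: "x \<in> {0..1}" "y = g x" by blast
      then have "a < x" "x < b"
        using y pl_map_less_iff[OF g, of a x] pl_map_less_iff[OF g, of x b] ab by auto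
      then show False using ab x y by (auto simp: R_def)
    qed
    then have "dyadic_affine f (g a) (g b)" using P gab unfolding breakpoints_def by blast
    then obtain l where l: "\<And>y. g a \<le> y \<Longrightarrow> y \<le> g b \<Longrightarrow> f y = f (g a) + 2 powi l * (y - g a)"
      by (rule dyadic_affineE) (rule that)
    have fg: "f (g x) = f (g a) + 2 powi (l + k) * (x - a)" if x: "a \<le> x" "x \<le> b" for x
    proof -
      have "g a \<le> g x"
        using k[OF x] x by simp
      moreover have "g x \<le> g b"
        using k[OF x] k[of b] x by simp
      ultimately have "f (g x) = f (g a) + 2 powi l * (g x - g a)" by (rule l)
      also have "g x - g a = 2 powi k * (x - a)" using k[OF x] by simp
      finally show ?thesis by (simp add: power_int_add)
    qed
    show "dyadic_affine ?h a b"
      unfolding dyadic_affine_def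
    proof (intro exI[of _ "l + k"] ballI)
      fix x assume "x \<in> {a..b}"
      then show "?h x = ?h a + 2 powi (l + k) * (x - a)"
        using fg[of x] ab by (simp add: compose_def)
    qed
  qed
  moreover have "continuous_on {0..1} ?h"
  proof (rule continuous_on_eq[of _ "f \<circ> g"])
    show "continuous_on {0..1} (f \<circ> g)"
      using f g pl_map_range[OF g] by (intro continuous_on_compose) (auto simp: pl_map_def)
  qed (auto simp: compose_def)
  moreover have "strict_mono_on {0..1} ?h"
    unfolding strict_mono_on_def
    using pl_map_less_iff[OF f pl_map_in[OF g] pl_map_in[OF g]] pl_map_less_iff[OF g]
    by (auto simp: compose_def)
  ultimately show ?thesis
    using f g unfolding pl_map_def by (auto simp: compose_def)
qed

lemma pl_map_inverse:
  assumes f: "pl_map f"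
  shows "pl_map (\<lambda>x\<in>{0..1}. inv_into {0..1} f x)"
proof -
  let ?g = "\<lambda>x\<in>{0..1}. inv_into {0..1} f x"
  obtain P where P: "breakpoints f P" using f unfolding pl_map_def by blast
  have g_in: "?g y \<in> {0..1}" "f (?g y) = y" if "y \<in> {0..1}" for y
    using that inv_into_into[of y f "{0..1}"] f_inv_into_f[of y f "{0..1}"] pl_map_range[OF f] by auto
  have gf: "?g (f x) = x" if "x \<in> {0..1}" for x
    using pl_map_inj[OF f] that pl_map_in[OF f that] by (simp add: inv_into_f_f)
  have less: "?g x < ?g y \<longleftrightarrow> x < y" if "x \<in> {0..1}" "y \<in> {0..1}" for x y
    using pl_map_less_iff[OF f g_in(1)[OF that(1)] g_in(1)[OF that(2)]] g_in(2) that by metis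
  define R where "R = f ` (P \<inter> {0..1})"
  have "breakpoints ?g R"
    unfolding breakpoints_def
  proof (intro conjI allI impI)
    show "finite R" using P by (simp add: R_def breakpoints_def)
    show "\<forall>p\<in>R. dyadic p"
      using P pl_map_dyadic[OF f] by (auto simp: R_def breakpoints_def)
    fix a b assume ab: "0 \<le> a \<and> a < b \<and> b \<le> 1 \<and> {a<..<b} \<inter> R = {}"
    define c where "c = ?g a"
    define d where "d = ?g b"
    have cd: "c \<in> {0..1}" "d \<in> {0..1}" "f c = a" "f d = b" "c < d"
      using ab g_in less unfolding c_def d_def by auto
    have "{c<..<d} \<inter> P = {}"
    proof (rule ccontr)
      assume "{c<..<d} \<inter> P \<noteq> {}"
      then obtain x where x: "c < x" "x < d" "x \<in> P" by auto
      then have "f c < f x" "f x < f d" "f x \<in> R"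
        using cd pl_map_less_iff[OF f] by (auto simp: R_def)
      then show False using ab cd by auto
    qed
    then have "dyadic_affine f c d" using P cd unfolding breakpoints_def by auto
    then obtain k where k: "\<And>x. c \<le> x \<Longrightarrow> x \<le> d \<Longrightarrow> f x = f c + 2 powi k * (x - c)"
      by (rule dyadic_affineE) (rule that)
    have gy: "?g y = c + 2 powi (- k) * (y - a)" if y: "a \<le> y" "y \<le> b" for y
    proof -
      have yI: "y \<in> {0..1}" using y ab by auto
      have "c \<le> ?g y" "?g y \<le> d"
        using y less[OF yI, of a] less[of b y] yI ab unfolding c_def d_def by force+
      then have "y = a + 2 powi k * (?g y - c)" using k[of "?g y"] g_in(2)[OF yI] cd by simp
      then have "2 powi (- k) * (y - a) = (2 powi (- k) * 2 powi k) * (?g y - c)"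
        by (simp add: mult.assoc)
      also have "\<dots> = ?g y - c" by (simp add: power_int_add[symmetric])
      finally show ?thesis by simp
    qed
    show "dyadic_affine ?g a b"
      unfolding dyadic_affine_def
    proof (intro exI[of _ "- k"] ballI)
      fix y assume "y \<in> {a..b}"
      then show "?g y = ?g a + 2 powi (- k) * (y - a)"
        using gy[of y] by (simp only: c_def atLeastAtMost_iff)
    qed
  qed
  moreover have "continuous_on {0..1} ?g"
  proof (rule continuous_on_eq[of _ "inv_into {0..1} f"])
    have "continuous_on (f ` {0..1}) (inv_into {0..1} f)"
      using f by (intro continuous_on_inv) (auto simp: pl_map_def pl_map_inj[OF f])
    then show "continuous_on {0..1} (inv_into {0..1} f)" by (simp only: pl_map_range[OF f])
  qed auto
  moreover have "strict_mono_on {0..1} ?g" unfolding strict_mono_on_def using less by auto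
  moreover have "?g 0 = 0" "?g 1 = 1" using gf[of 0] gf[of 1] f by (auto simp: pl_map_def)
  ultimately show ?thesis unfolding pl_map_def by auto
qed

theorem group_F: "group thompson_F"
proof -
  have "subgroup {f. pl_map f} (BijGroup {0..1})"
  proof (rule group.subgroupI[OF group_BijGroup])
    have sub: "{f. pl_map f} \<subseteq> Bij {0..1}"
      using carrier_F by (auto simp: thompson_F_def)
    then show "{f. pl_map f} \<subseteq> carrier (BijGroup {0..1})" by (simp add: BijGroup_def)
    show "{f. pl_map f} \<noteq> {}" using pl_map_id by blast
    fix f assume f: "f \<in> {f. pl_map f}"
    then have "inv\<^bsub>BijGroup {0..1}\<^esub> f = (\<lambda>x\<in>{0..1}. inv_into {0..1} f x)"
      using sub by (intro inv_BijGroup) auto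
    then show "inv\<^bsub>BijGroup {0..1}\<^esub> f \<in> {f. pl_map f}" using pl_map_inverse f by simp
    fix g assume g: "g \<in> {f. pl_map f}"
    then have "f \<otimes>\<^bsub>BijGroup {0..1}\<^esub> g = compose {0..1} f g"
      using f sub by (auto simp: BijGroup_def)
    then show "f \<otimes>\<^bsub>BijGroup {0..1}\<^esub> g \<in> {f. pl_map f}" using pl_map_compose f g by simp
  qed
  then have "group (BijGroup {0..1}\<lparr>carrier := {f. pl_map f}\<rparr>)"
    using group_BijGroup by (rule subgroup.subgroup_is_group)
  moreover have "thompson_F = BijGroup {0..1}\<lparr>carrier := carrier thompson_F\<rparr>"
    by (simp add: thompson_F_def)
  ultimately show ?thesis by (simp add: carrier_F)
qed

text \<open>Extension by the identity to the whole line lets a rescaled copy be given by one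
  formula, inside and outside its support.\<close>

definition extend_id :: "(real \<Rightarrow> real) \<Rightarrow> real \<Rightarrow> real" where
  "extend_id f y = (if y \<in> {0..1} then f y else y)"

lemma extend_id_out: "pl_map f \<Longrightarrow> y \<le> 0 \<or> 1 \<le> y \<Longrightarrow> extend_id f y = y"
  unfolding extend_id_def pl_map_def by (cases "y = 0"; cases "y = 1") auto

lemma extend_id_strict_mono:
  assumes f: "pl_map f" and xy: "x < y"
  shows "extend_id f x < extend_id f y"
proof -
  consider "x \<in> {0..1}" "y \<in> {0..1}" | "x \<in> {0..1}" "1 < y" | "x < 0" "y \<in> {0..1}"
    | "x \<notin> {0..1}" "y \<notin> {0..1}"
    using xy by force
  then show ?thesis
  proof cases
    case 1
    then show ?thesis using pl_map_less_iff[OF f 1] xy by (simp add: extend_id_def)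
  next
    case 2
    then show ?thesis using pl_map_in[OF f 2(1)] by (simp add: extend_id_def)
  next
    case 3
    then show ?thesis using pl_map_in[OF f 3(2)] by (simp add: extend_id_def)
  next
    case 4
    then show ?thesis using xy unfolding extend_id_def by presburger
  qed
qed

lemma continuous_extend_id:
  assumes f: "pl_map f"
  shows "continuous_on UNIV (extend_id f)"
proof -
  \<comment> \<open>Clamping to [0,1] writes the extension as a continuous expression without case
    distinction.\<close>
  define r where "r = (\<lambda>y :: real. max 0 (min 1 y))"
  have "extend_id f y = y + (f (r y) - r y)" for y
    using f unfolding extend_id_def r_def pl_map_def by (auto simp: max_def min_def)
  then have eq: "extend_id f = (\<lambda>y. y + (f (r y) - r y))" by (rule ext)
  have r: "continuous_on UNIV r" unfolding r_def by (intro continuous_intros)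
  have cf: "continuous_on {0..1} f" using f by (simp add: pl_map_def)
  have "continuous_on UNIV (\<lambda>y. f (r y))"
    by (rule continuous_on_compose2[OF cf r]) (auto simp: r_def)
  then show ?thesis unfolding eq by (intro continuous_on_add continuous_on_diff continuous_on_id r)
qed

lemma extend_id_compose:
  assumes "pl_map g"
  shows "extend_id (compose {0..1} f g) y = extend_id f (extend_id g y)"
proof (cases "y \<in> {0..1}")
  case True
  then show ?thesis using pl_map_in[OF assms True] by (simp add: extend_id_def compose_def)
next
  case False
  then show ?thesis unfolding extend_id_def by presburger
qed

text \<open>A copy of \<open>F\<close> supported on the interval from \<open>1 / 2 ^ Suc n\<close> to \<open>1 / 2 ^ n\<close>.\<close>

definition shrink :: "nat \<Rightarrow> (real \<Rightarrow> real) \<Rightarrow> (real \<Rightarrow> real)" where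
  "shrink n f = (\<lambda>x\<in>{0..1}. (1 + extend_id f (2 ^ Suc n * x - 1)) / 2 ^ Suc n)"

lemma shrink_out:
  assumes f: "pl_map f" and x: "x \<in> {0..1}" "x \<le> 1 / 2 ^ Suc n \<or> 1 / 2 ^ n \<le> x"
  shows "shrink n f x = x"
proof -
  have "2 ^ Suc n * x - 1 \<le> 0 \<or> 1 \<le> 2 ^ Suc n * x - 1"
    using x(2) by (auto simp: field_simps)
  then have "extend_id f (2 ^ Suc n * x - 1) = 2 ^ Suc n * x - 1" by (rule extend_id_out[OF f])
  then show ?thesis using x(1) by (simp add: shrink_def)
qed

lemma shrink_less:
  assumes f: "pl_map f" and xy: "x \<in> {0..1}" "y \<in> {0..1}" "x < y"
  shows "shrink n f x < shrink n f y"
proof -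
  have "extend_id f (2 ^ Suc n * x - 1) < extend_id f (2 ^ Suc n * y - 1)"
    by (rule extend_id_strict_mono[OF f]) (use xy in simp)
  then show ?thesis using xy by (simp add: shrink_def divide_strict_right_mono)
qed

lemma pl_map_shrink:
  assumes f: "pl_map f"
  shows "pl_map (shrink n f)"
proof -
  define m where "m = Suc n"
  define c where "c = (1 / 2 ^ m :: real)"
  have c: "0 < c" "2 * c = 1 / 2 ^ n" by (auto simp: c_def m_def)
  have c1: "2 * c \<le> 1" unfolding c(2) by (simp add: divide_le_eq)
  obtain P where P: "breakpoints f P" using f unfolding pl_map_def by blast
  \<comment> \<open>The ends c and 2 c of the supporting interval, and the breakpoints of
    \<open>f\<close> moved into it.\<close>
  define R where "R = {c, 2 * c} \<union> (\<lambda>p. c * (1 + p)) ` P"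
  have dyc: "dyadic c" using dyadicI[of 1 m] by (simp add: c_def)
  have out: "shrink n f x = x" if "x \<in> {0..1}" "x \<le> c \<or> 2 * c \<le> x" for x
    using shrink_out[OF f that(1)] that(2) unfolding c(2) by (simp add: c_def m_def)
  have "breakpoints (shrink n f) R"
    unfolding breakpoints_def
  proof (intro conjI allI impI)
    show "finite R" using P by (simp add: R_def breakpoints_def)
    show "\<forall>p\<in>R. dyadic p"
      using P dyadic_mult[OF dyc dyadic_add[OF dyadic_one]] dyadic_add[OF dyc dyc]
      by (auto simp: R_def breakpoints_def dyc)
    fix a b assume ab: "0 \<le> a \<and> a < b \<and> b \<le> 1 \<and> {a<..<b} \<inter> R = {}"
    then have "c \<notin> {a<..<b}" "2 * c \<notin> {a<..<b}" unfolding R_def by blast+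
    then consider "b \<le> c \<or> 2 * c \<le> a" | "c \<le> a" "b \<le> 2 * c" using c(1) by force
    then show "dyadic_affine (shrink n f) a b"
    proof cases
      case 1
      then have "shrink n f x = x" if "a \<le> x" "x \<le> b" for x
        using that ab by (intro out) auto
      then show ?thesis using ab by (intro dyadic_affineI[where k = 0 and c = 0]) auto
    next
      case 2
      \<comment> \<open>The affine map from [c, 2 c] onto [0,1]; conjugation by it leaves the slope
        exponents unchanged.\<close>
      define h where "h x = 2 ^ m * x - 1" for x :: real
      have h: "h x = x / c - 1" for x by (simp add: h_def c_def)
      have hab: "0 \<le> h a" "h a < h b" "h b \<le> 1"
        using 2 ab c(1) by (auto simp: h field_simps)
      have "{h a<..<h b} \<inter> P = {}"
      proof (rule ccontr)
        assume "{h a<..<h b} \<inter> P \<noteq> {}"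
        then obtain p where p: "h a < p" "p < h b" "p \<in> P" by auto
        then have "a < c * (1 + p)" "c * (1 + p) < b" using c(1) by (auto simp: h field_simps)
        then show False using ab p(3) by (auto simp: R_def)
      qed
      then have "dyadic_affine f (h a) (h b)" using P hab unfolding breakpoints_def by blast
      then obtain k where k: "\<And>x. h a \<le> x \<Longrightarrow> x \<le> h b \<Longrightarrow> f x = f (h a) + 2 powi k * (x - h a)"
        by (rule dyadic_affineE) (rule that)
      show ?thesis
      proof (rule dyadic_affineI[where k = k and c = "c * (1 + f (h a)) - 2 powi k * a"])
        fix x assume x: "a \<le> x" "x \<le> b"
        have hx: "h a \<le> h x" "h x \<le> h b" using x by (auto simp: h_def)
        then have "h x \<in> {0..1}" using hab by auto
        then have "shrink n f x = c * (1 + f (h x))"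
          using x ab by (simp add: shrink_def extend_id_def h_def c_def m_def)
        also have "\<dots> = c * (1 + f (h a)) + 2 powi k * (c * (h x - h a))"
          unfolding k[OF hx] by (simp add: algebra_simps)
        also have "c * (h x - h a) = x - a" using c(1) by (simp add: h field_simps)
        finally show "shrink n f x = c * (1 + f (h a)) - 2 powi k * a + 2 powi k * x"
          by (simp add: algebra_simps)
      qed (use ab in simp)
    qed
  qed
  moreover have "continuous_on {0..1} (shrink n f)"
  proof (rule continuous_on_eq[of _ "\<lambda>x. (1 + extend_id f (2 ^ Suc n * x - 1)) / 2 ^ Suc n"])
    have "continuous_on {0..1} (\<lambda>x. extend_id f (2 ^ Suc n * x - 1))"
      by (rule continuous_on_compose2[OF continuous_extend_id[OF f]]) (intro continuous_intros, simp)
    then show "continuous_on {0..1} (\<lambda>x. (1 + extend_id f (2 ^ Suc n * x - 1)) / 2 ^ Suc n)"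
      by (intro continuous_on_divide continuous_on_add continuous_on_const) auto
  qed (simp add: shrink_def)
  moreover have "strict_mono_on {0..1} (shrink n f)"
    by (rule strict_mono_onI) (rule shrink_less[OF f])
  moreover have "shrink n f 0 = 0" "shrink n f 1 = 1"
    using c(1) c1 by (auto intro!: out)
  moreover have "shrink n f \<in> extensional {0..1}" by (simp add: shrink_def)
  ultimately show ?thesis unfolding pl_map_def by blast
qed

lemma shrink_le:
  assumes f: "pl_map f" and x: "x \<in> {0..1}" "x \<le> 1 / 2 ^ n"
  shows "shrink n f x \<le> 1 / 2 ^ n"
proof -
  have I: "1 / 2 ^ n \<in> {0..1::real}" by (simp add: divide_le_eq)
  have "shrink n f (1 / 2 ^ n) = 1 / 2 ^ n" by (rule shrink_out[OF f I]) simp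
  then show ?thesis using shrink_less[OF f x(1) I, of n] x(2) by (cases "x = 1 / 2 ^ n") auto
qed

lemma shrink_hom: "shrink n \<in> hom thompson_F thompson_F"
proof (rule homI)
  fix f g assume "f \<in> carrier thompson_F" "g \<in> carrier thompson_F"
  then have f: "pl_map f" and g: "pl_map g" by (auto simp: carrier_F)
  have "shrink n (compose {0..1} f g) x = compose {0..1} (shrink n f) (shrink n g) x" for x
  proof (cases "x \<in> {0..1}")
    case True
    have "shrink n g x \<in> {0..1}" by (rule pl_map_in[OF pl_map_shrink[OF g] True])
    moreover have "2 ^ Suc n * shrink n g x - 1 = extend_id g (2 ^ Suc n * x - 1)"
      using True by (simp add: shrink_def)
    ultimately show ?thesis
      unfolding shrink_def[of n f] shrink_def[of n "compose {0..1} f g"] extend_id_compose[OF g]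
      using True by (simp add: compose_def)
  next
    case False
    then show ?thesis unfolding compose_def shrink_def restrict_apply by (simp only: if_False)
  qed
  then show "shrink n (f \<otimes>\<^bsub>thompson_F\<^esub> g) = shrink n f \<otimes>\<^bsub>thompson_F\<^esub> shrink n g"
    using f g by (auto simp: mult_F pl_map_shrink)
qed (simp add: carrier_F pl_map_shrink)

lemma shrink_inj: "inj_on (shrink n) (carrier thompson_F)"
proof (rule inj_onI)
  fix f g assume fg: "f \<in> carrier thompson_F" "g \<in> carrier thompson_F" "shrink n f = shrink n g"
  show "f = g"
  proof (rule extensionalityI[of _ "{0..1}"])
    fix y :: real assume y: "y \<in> {0..1}"
    define x where "x = (1 + y) / 2 ^ Suc n"
    have "1 \<le> (2 :: real) ^ n" by (rule one_le_power) simp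
    moreover have "y \<le> 1" using y by simp
    ultimately have "1 + y \<le> 2 ^ Suc n" unfolding power_Suc by linarith
    then have x: "x \<in> {0..1}" "2 ^ Suc n * x - 1 = y" using y by (auto simp: x_def divide_le_eq)
    have sh: "shrink n h x = (1 + h y) / 2 ^ Suc n" for h
      unfolding shrink_def using x y by (simp add: extend_id_def del: power_Suc)
    show "f y = g y" using sh[of f] sh[of g] fg(3) by simp
  qed (use fg in \<open>auto simp: carrier_F pl_map_def\<close>)
qed

text \<open>The bound \<epsilon> \<le> 1 keeps the interval inside the domain of
  \<open>f\<close>.\<close>

definition germ :: "(real \<Rightarrow> real) \<Rightarrow> int \<Rightarrow> bool" where
  "germ f k \<longleftrightarrow> (\<exists>\<epsilon>>0. \<epsilon> \<le> 1 \<and> (\<forall>x. 0 \<le> x \<longrightarrow> x \<le> \<epsilon> \<longrightarrow> f x = 2 powi k * x))"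

text \<open>On F this is the homomorphism onto the integers given by the germ at 0; its kernel
  consists of the maps that are the identity near 0.\<close>

definition log_slope :: "(real \<Rightarrow> real) \<Rightarrow> int" where
  "log_slope f = (THE k. germ f k)"

lemma germ_unique: "germ f k \<Longrightarrow> germ f l \<Longrightarrow> k = l"
proof -
  assume "germ f k" "germ f l"
  then obtain a b where ab: "0 < a" "0 < b" "\<And>x. 0 \<le> x \<Longrightarrow> x \<le> a \<Longrightarrow> f x = 2 powi k * x"
    "\<And>x. 0 \<le> x \<Longrightarrow> x \<le> b \<Longrightarrow> f x = 2 powi l * x"
    unfolding germ_def by blast
  have "2 powi k * min a b = f (min a b)" using ab by (intro ab(3)[symmetric]) auto
  also have "\<dots> = 2 powi l * min a b" using ab by (intro ab(4)) auto
  finally have eq: "(2 :: real) powi k = 2 powi l" using ab by auto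
  show "k = l"
    by (rule linorder_cases[of k l]) (use eq power_int_strict_increasing[of _ _ "2 :: real"] in force)+
qed

lemma germ_exists: "pl_map f \<Longrightarrow> \<exists>k. germ f k"
proof -
  assume f: "pl_map f"
  obtain P where P: "breakpoints f P" using f unfolding pl_map_def by blast
  \<comment> \<open>The least positive breakpoint, capped at 1; the cap also covers the case without
    positive breakpoints.\<close>
  define \<epsilon> where "\<epsilon> = Min (insert 1 (P \<inter> {0<..}))"
  have fin: "finite (insert 1 (P \<inter> {0<..}))" using P by (simp add: breakpoints_def)
  have \<epsilon>: "0 < \<epsilon>" "\<epsilon> \<le> 1" unfolding \<epsilon>_def using fin by auto
  have "{0<..<\<epsilon>} \<inter> P = {}"
  proof (rule ccontr)
    assume "{0<..<\<epsilon>} \<inter> P \<noteq> {}"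
    then obtain p where "0 < p" "p < \<epsilon>" "p \<in> P" by auto
    moreover from this have "\<epsilon> \<le> p" unfolding \<epsilon>_def using fin by (intro Min_le) auto
    ultimately show False by simp
  qed
  then have "dyadic_affine f 0 \<epsilon>" using P \<epsilon> unfolding breakpoints_def by simp
  then obtain k where k: "\<And>x. 0 \<le> x \<Longrightarrow> x \<le> \<epsilon> \<Longrightarrow> f x = f 0 + 2 powi k * (x - 0)"
    by (rule dyadic_affineE) (rule that)
  have "f 0 = 0" using f by (simp add: pl_map_def)
  then have "f x = 2 powi k * x" if "0 \<le> x" "x \<le> \<epsilon>" for x using k[OF that] by simp
  then show ?thesis unfolding germ_def using \<epsilon> by (intro exI[of _ k] exI[of _ \<epsilon>]) auto
qed

lemma germ_iff: "pl_map f \<Longrightarrow> germ f k \<longleftrightarrow> log_slope f = k"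
  unfolding log_slope_def using germ_exists germ_unique by (metis the_equality)

lemma log_slope_mult:
  assumes f: "pl_map f" and g: "pl_map g"
  shows "log_slope (compose {0..1} f g) = log_slope f + log_slope g"
proof -
  obtain a where a: "0 < a" "a \<le> 1" "\<And>x. 0 \<le> x \<Longrightarrow> x \<le> a \<Longrightarrow> f x = 2 powi log_slope f * x"
    using germ_iff[OF f] unfolding germ_def by blast
  obtain b where b: "0 < b" "b \<le> 1" "\<And>x. 0 \<le> x \<Longrightarrow> x \<le> b \<Longrightarrow> g x = 2 powi log_slope g * x"
    using germ_iff[OF g] unfolding germ_def by blast
  define k where "k = log_slope g"
  \<comment> \<open>Small enough for \<open>g\<close> to be linear on [0, c] and to map it into
    [0, a], where \<open>f\<close> is linear.\<close>
  define c where "c = min b (2 powi (- k) * a)"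
  have c: "0 < c" "c \<le> b" "c \<le> 2 powi (- k) * a" using a b by (auto simp: c_def)
  have pk: "2 powi k * 2 powi (- k) = (1 :: real)" by (simp add: power_int_add[symmetric])
  have "compose {0..1} f g x = 2 powi (log_slope f + k) * x" if x: "0 \<le> x" "x \<le> c" for x
  proof -
    have gx: "g x = 2 powi k * x" using b(3)[of x] x c by (simp add: k_def)
    have "2 powi k * x \<le> 2 powi k * (2 powi (- k) * a)"
      using x c by (intro mult_left_mono) auto
    also have "\<dots> = a" using pk by (simp add: mult.assoc[symmetric])
    finally have "f (g x) = 2 powi log_slope f * g x" using gx x by (intro a(3)) auto
    also have "2 powi log_slope f * g x = 2 powi (log_slope f + k) * x"
      by (simp add: gx power_int_add)
    finally show ?thesis using x c b by (simp add: compose_def)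
  qed
  then have "germ (compose {0..1} f g) (log_slope f + k)"
    unfolding germ_def using c b by (intro exI[of _ c]) auto
  then show ?thesis by (simp add: germ_iff pl_map_compose f g k_def)
qed

lemma log_slope_shrink: "pl_map f \<Longrightarrow> log_slope (shrink n f) = 0"
proof -
  assume f: "pl_map f"
  have le: "1 / 2 ^ Suc n \<le> (1 :: real)" by (simp add: divide_le_eq del: power_Suc)
  have "germ (shrink n f) 0"
    unfolding germ_def
  proof (intro exI[of _ "1 / 2 ^ Suc n"] conjI allI impI)
    fix x :: real assume x: "0 \<le> x" "x \<le> 1 / 2 ^ Suc n"
    then have "x \<in> {0..1}" using order_trans[OF x(2) le] by (simp del: power_Suc)
    then have "shrink n f x = x" by (rule shrink_out[OF f]) (use x in blast)
    then show "shrink n f x = 2 powi 0 * x" by simp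
  qed (use le in auto)
  then show ?thesis by (simp add: germ_iff pl_map_shrink f)
qed

text \<open>Up to inversion a standard generator of F, with slopes 2, 1 and 1/2. Being concave, it
  is the minimum of its affine pieces.\<close>

definition doubling :: "real \<Rightarrow> real" where
  "doubling = (\<lambda>x\<in>{0..1}. min (2 * x) (min (x + 1 / 4) ((x + 1) / 2)))"

lemma pl_map_doubling: "pl_map doubling"
proof -
  have "breakpoints doubling {1 / 4, 1 / 2}"
    unfolding breakpoints_def
  proof (intro conjI allI impI)
    have "dyadic (1 / 4)" "dyadic (1 / 2)" using dyadicI[of 1 2] dyadicI[of 1 1] by auto
    then show "\<forall>p\<in>{1 / 4, 1 / 2}. dyadic p" by simp
    fix a b :: real assume ab: "0 \<le> a \<and> a < b \<and> b \<le> 1 \<and> {a<..<b} \<inter> {1 / 4, 1 / 2} = {}"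
    then have "1 / 4 \<notin> {a<..<b}" "1 / 2 \<notin> {a<..<b}" by blast+
    then consider "b \<le> 1 / 4" | "1 / 4 \<le> a" "b \<le> 1 / 2" | "1 / 2 \<le> a" by force
    then show "dyadic_affine doubling a b"
    proof cases
      case 1
      then show ?thesis using ab
        by (intro dyadic_affineI[where k = 1 and c = 0]) (auto simp: doubling_def min_def)
    next
      case 2
      then show ?thesis using ab
        by (intro dyadic_affineI[where k = 0 and c = "1 / 4"]) (auto simp: doubling_def min_def)
    next
      case 3
      then show ?thesis using ab
        by (intro dyadic_affineI[where k = "- 1" and c = "1 / 2"])
           (auto simp: doubling_def min_def field_simps)
    qed
  qed simp
  moreover have "continuous_on {0..1} doubling"
    by (rule continuous_on_eq[of _ "\<lambda>x. min (2 * x) (min (x + 1 / 4) ((x + 1) / 2))"])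
       (auto simp: doubling_def intro!: continuous_intros)
  moreover have "strict_mono_on {0..1} doubling"
    by (rule strict_mono_onI) (auto simp: doubling_def min_def)
  ultimately show ?thesis
    unfolding pl_map_def by (auto simp: doubling_def)
qed

lemma log_slope_doubling: "log_slope doubling = 1"
proof -
  have "germ doubling 1"
    unfolding germ_def by (intro exI[of _ "1 / 4"]) (auto simp: doubling_def min_def)
  then show ?thesis by (simp add: germ_iff pl_map_doubling)
qed

text \<open>The supports are disjoint: \<open>shrink n f\<close> preserves [0, 1/2^n] and fixes
  every point beyond, while \<open>g\<close> fixes this interval pointwise and preserves its
  complement.\<close>

lemma commute_shrink:
  assumes f: "pl_map f" and g: "pl_map g"
    and id: "\<And>x. 0 \<le> x \<Longrightarrow> x \<le> 1 / 2 ^ n \<Longrightarrow> g x = x"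
  shows "compose {0..1} (shrink n f) g = compose {0..1} g (shrink n f)"
proof
  fix x
  show "compose {0..1} (shrink n f) g x = compose {0..1} g (shrink n f) x"
  proof (cases "x \<in> {0..1}")
    case x: True
    show ?thesis
    proof (cases "x \<le> 1 / 2 ^ n")
      case True
      have "shrink n f x \<in> {0..1}" by (rule pl_map_in[OF pl_map_shrink[OF f] x])
      then show ?thesis using shrink_le[OF f x True] x True by (simp add: compose_def id)
    next
      case False
      have "g (1 / 2 ^ n) < g x" using False x by (subst pl_map_less_iff[OF g]) auto
      then have "1 / 2 ^ n < g x" by (simp add: id)
      then show ?thesis using pl_map_in[OF g x] x False by (simp add: compose_def shrink_out[OF f])
    qed
  next
    case False
    then show ?thesis unfolding compose_def restrict_apply by (simp only: if_False)
  qed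
qed

text \<open>Slope 1 at 0 means being the identity near 0. Finitely many such maps share an interval
  on which all are the identity, and a copy of F fits into it.\<close>

lemma log_slope_zero_commute:
  assumes "finite K" "\<And>g. g \<in> K \<Longrightarrow> pl_map g \<and> log_slope g = 0"
  shows "\<exists>n. \<forall>f g. pl_map f \<longrightarrow> g \<in> K \<longrightarrow>
    compose {0..1} (shrink n f) g = compose {0..1} g (shrink n f)"
proof -
  have "\<exists>n. \<forall>g\<in>K. \<forall>x. 0 \<le> x \<longrightarrow> x \<le> 1 / 2 ^ n \<longrightarrow> g x = x"
    using assms
  proof (induction K rule: finite_induct)
    case (insert g K)
    then obtain m where m: "\<forall>h\<in>K. \<forall>x. 0 \<le> x \<longrightarrow> x \<le> 1 / 2 ^ m \<longrightarrow> h x = x" by auto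
    have "germ g 0" using insert.prems by (simp add: germ_iff)
    then obtain \<epsilon> where \<epsilon>: "0 < \<epsilon>" "\<And>x. 0 \<le> x \<Longrightarrow> x \<le> \<epsilon> \<Longrightarrow> g x = x"
      unfolding germ_def by auto
    obtain l where l: "(1 / 2) ^ l < \<epsilon>" using real_arch_pow_inv[OF \<epsilon>(1), of "1 / 2"] by auto
    have "1 / 2 ^ max l m \<le> (1 / 2 ^ l :: real)" "1 / 2 ^ max l m \<le> (1 / 2 ^ m :: real)"
      by (auto simp: field_simps)
    then have "\<forall>h\<in>insert g K. \<forall>x. 0 \<le> x \<longrightarrow> x \<le> 1 / 2 ^ max l m \<longrightarrow> h x = x"
      using m \<epsilon>(2) l by (auto simp: power_one_over)
    then show ?case by blast
  qed simp
  then obtain n where n: "\<And>g x. g \<in> K \<Longrightarrow> 0 \<le> x \<Longrightarrow> x \<le> 1 / 2 ^ n \<Longrightarrow> g x = x" by blast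
  show ?thesis
    using commute_shrink assms(2) n by (intro exI[of _ n]) blast
qed

section \<open>The equivalence\<close>

text \<open>As types, the group and its algebra can be made instances of \<open>group_add\<close>
  and \<open>ring_1\<close>, to which the chain-level results apply.\<close>

typedef thompson = "carrier thompson_F" morphisms elt Elt
  using pl_map_id carrier_F by blast

typedef thompson_vN = "carrier (group_vN_algebra thompson_F)" morphisms opr Opr
  using group.vN_one_closed[OF group_F] by blast

interpretation F: group thompson_F by (rule group_F)

interpretation R: ring F.vN by (rule F.ring_vN)

instantiation thompson :: group_add
begin

definition "0 = Elt \<one>\<^bsub>thompson_F\<^esub>"
definition "x + y = Elt (elt x \<otimes>\<^bsub>thompson_F\<^esub> elt y)"
definition "- x = Elt (inv\<^bsub>thompson_F\<^esub> elt x)"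
definition "x - y = x + - y" for x y :: thompson

lemma elt_ops:
  "elt 0 = \<one>\<^bsub>thompson_F\<^esub>"
  "elt (x + y) = elt x \<otimes>\<^bsub>thompson_F\<^esub> elt y"
  "elt (- x) = inv\<^bsub>thompson_F\<^esub> elt x"
  by (simp_all add: zero_thompson_def plus_thompson_def uminus_thompson_def
      Elt_inverse elt)

instance
  by intro_classes
     (simp_all add: elt_inject[symmetric] elt_ops minus_thompson_def
        F.m_assoc elt)

end

instantiation thompson_vN :: ring_1
begin

definition "0 = Opr \<zero>\<^bsub>F.vN\<^esub>"
definition "1 = Opr \<one>\<^bsub>F.vN\<^esub>"
definition "x + y = Opr (opr x \<oplus>\<^bsub>F.vN\<^esub> opr y)"
definition "x * y = Opr (opr x \<otimes>\<^bsub>F.vN\<^esub> opr y)"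
definition "- x = Opr (\<ominus>\<^bsub>F.vN\<^esub> opr x)"
definition "x - y = x + - y" for x y :: thompson_vN

lemma opr_ops:
  "opr 0 = \<zero>\<^bsub>F.vN\<^esub>"
  "opr 1 = \<one>\<^bsub>F.vN\<^esub>"
  "opr (x + y) = opr x \<oplus>\<^bsub>F.vN\<^esub> opr y"
  "opr (x * y) = opr x \<otimes>\<^bsub>F.vN\<^esub> opr y"
  "opr (- x) = \<ominus>\<^bsub>F.vN\<^esub> opr x"
  by (simp_all add: zero_thompson_vN_def one_thompson_vN_def plus_thompson_vN_def
      times_thompson_vN_def uminus_thompson_vN_def Opr_inverse opr)

instance
  by intro_classes
     (simp_all add: opr_inject[symmetric] opr_ops minus_thompson_vN_def
        R.m_assoc R.a_ac R.l_distr R.r_distr R.l_neg R.r_neg opr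
        F.vN_one_neq_zero[symmetric])

end

definition trans_op :: "thompson \<Rightarrow> thompson_vN" where
  "trans_op g = Opr (right_translation thompson_F (elt g))"

lemma opr_trans:
  "opr (trans_op g) = right_translation thompson_F (elt g)"
  by (simp add: trans_op_def Opr_inverse F.rtrans_in_vN elt)

lemma opr_in_ell2:
  "v \<in> ell2 thompson_F \<Longrightarrow> opr T v \<in> ell2 thompson_F"
  by (rule F.vN_D(1)[OF opr])

lemma opr_apply:
  assumes "v \<in> ell2 thompson_F"
  shows "opr 0 v = (\<lambda>x. 0)"
    "opr 1 v = v"
    "opr (S + T) v = (\<lambda>x. opr S v x + opr T v x)"
    "opr (S * T) v = opr S (opr T v)"
    "opr (trans_op g) v = F.rtrans (elt g) v"
  using assms by (simp_all add: opr_ops F.vN_simps opr_trans F.right_translation_eq)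

lemma opr_diff:
  assumes "v \<in> ell2 thompson_F"
  shows "opr (S - T) v = (\<lambda>x. opr S v x - opr T v x)"
proof -
  have "opr S v = (\<lambda>x. opr (S - T) v x + opr T v x)"
    using opr_apply(3)[OF assms, of "S - T" T] by simp
  then show ?thesis by auto
qed

lemma opr_sum:
  assumes "v \<in> ell2 thompson_F"
  shows "opr (\<Sum>i\<in>I. T i) v = (\<lambda>x. \<Sum>i\<in>I. opr (T i) v x)"
  by (induction I rule: infinite_finite_induct) (simp_all add: opr_apply[OF assms])

lemma thompson_vN_eqI:
  assumes "\<And>v. v \<in> ell2 thompson_F \<Longrightarrow> opr S v = opr T v"
  shows "S = T"
  using F.vN_eqI[OF opr opr assms] by (simp add: opr_inject)

lemma sum_gap_apply:
  assumes v: "v \<in> ell2 thompson_F"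
  shows "opr (\<Sum>s\<in>S. T s * (trans_op s - 1)) v =
    (\<lambda>x. \<Sum>s\<in>S. opr (T s) (\<lambda>x. F.rtrans (elt s) v x - v x) x)"
  by (simp add: opr_sum opr_apply opr_diff v)

text \<open>Right translation needs no inverse to be a homomorphism: both R_g R_h v and R_(gh) v
  take the value v(x g h) at x.\<close>

interpretation coeff: right_coefficients trans_op
proof
  show "trans_op (x + y) = trans_op x * trans_op y" for x y
    by (rule thompson_vN_eqI)
       (simp add: opr_apply elt_ops F.rtrans_rtrans elt F.rtrans_ell2)
  show "trans_op 0 = 1"
    by (rule thompson_vN_eqI) (simp add: opr_apply elt_ops F.rtrans_one)
qed

interpretation bar: bar_coordinates trans_op thompson_F F.vN
  "vN_action thompson_F" elt opr
proof
  show "bij_betw elt UNIV (carrier thompson_F)"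
    using type_definition_thompson elt_inject
    by (auto simp: bij_betw_def inj_on_def type_definition.Rep_range)
  show "bij_betw opr UNIV (carrier (F.vN))"
    using type_definition_thompson_vN opr_inject
    by (auto simp: bij_betw_def inj_on_def type_definition.Rep_range)
qed (auto simp: elt_ops opr_ops vN_action_def opr_trans R.abelian_group_axioms)

lemma not_amenable_if_invisible:
  assumes "l2_invisible thompson_F"
  shows "\<not> amenable thompson_F"
proof -
  obtain S T where S: "finite S" and one: "(\<Sum>s\<in>S. T s * (trans_op s - 1)) = 1"
    using bar.trivial_group_homology_0 assms unfolding l2_invisible_def by blast
  have "\<exists>C\<ge>0. \<forall>v\<in>ell2 thompson_F. ell2_norm thompson_F (opr (T s) v) \<le> C * ell2_norm thompson_F v" for s
    by (rule F.vN_D(4)[OF opr])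
  then obtain c where c: "\<And>s. 0 \<le> c s"
    "\<And>s v. v \<in> ell2 thompson_F \<Longrightarrow> ell2_norm thompson_F (opr (T s) v) \<le> c s * ell2_norm thompson_F v"
    by metis
  \<comment> \<open>One constant dominating all the operator bounds \<open>c s\<close>.\<close>
  define C where "C = (\<Sum>s\<in>S. c s)"
  show ?thesis
  proof (rule F.not_amenable_if_gap[of "elt ` S" C])
    fix v assume v: "v \<in> ell2 thompson_F"
    define w where "w s = (\<lambda>x. F.rtrans (elt s) v x - v x)" for s
    have w: "w s \<in> ell2 thompson_F" for s
      unfolding w_def by (intro ell2_diff F.rtrans_ell2 v elt)
    have "v = (\<lambda>x. \<Sum>s\<in>S. opr (T s) (w s) x)"
      using sum_gap_apply[OF v, of T S] one v by (simp add: w_def opr_apply)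
    then have "ell2_norm thompson_F v \<le> (\<Sum>s\<in>S. ell2_norm thompson_F (opr (T s) (w s)))"
      using ell2_sum(2)[of S "\<lambda>s. opr (T s) (w s)" thompson_F]
      by (simp add: opr_in_ell2 w)
    also have "\<dots> \<le> (\<Sum>s\<in>S. C * ell2_norm thompson_F (w s))"
    proof (rule sum_mono)
      fix s assume "s \<in> S"
      then have "c s \<le> C" unfolding C_def using S c(1) by (intro member_le_sum) auto
      then show "ell2_norm thompson_F (opr (T s) (w s)) \<le> C * ell2_norm thompson_F (w s)"
        using c(2)[OF w[of s], of s] mult_right_mono[of "c s" C "ell2_norm thompson_F (w s)"] by simp
    qed
    also have "\<dots> = C * (\<Sum>s\<in>elt ` S. ell2_norm thompson_F (\<lambda>x. F.rtrans s v x - v x))"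
      by (subst sum.reindex) (auto simp: inj_on_def elt_inject w_def sum_distrib_left)
    finally show "ell2_norm thompson_F v \<le>
        C * (\<Sum>s\<in>elt ` S. ell2_norm thompson_F (\<lambda>x. F.rtrans s v x - v x))" .
  qed (use S c(1) elt in \<open>auto simp: C_def intro: sum_nonneg\<close>)
qed

lemma thompson_eq_iff: "x + y = y + x \<longleftrightarrow> elt x \<otimes>\<^bsub>thompson_F\<^esub> elt y =
    elt y \<otimes>\<^bsub>thompson_F\<^esub> elt x"
  by (simp add: elt_inject[symmetric] elt_ops)

lemma pl_map_Rep: "pl_map (elt x)"
  using elt[of x] by (simp add: carrier_F)

lemma invisible_if_not_amenable:
  assumes "\<not> amenable thompson_F"
  shows "l2_invisible thompson_F"
proof -
  define \<tau> where "\<tau> x = log_slope (elt x)" for x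
  have \<tau>_add: "\<tau> (x + y) = \<tau> x + \<tau> y" for x y
    by (simp add: \<tau>_def elt_ops mult_F log_slope_mult pl_map_Rep)
  have \<tau>_t: "\<tau> (Elt doubling) = 1"
    by (simp add: \<tau>_def Elt_inverse carrier_F pl_map_doubling log_slope_doubling)
  \<comment> \<open>The choice depends only on \<open>\<tau> x\<close>, so it is constant on the
    cosets of the kernel.\<close>
  define r where "r x = (SOME y. \<tau> y = \<tau> x)" for x
  have \<tau>_r: "\<tau> (r x) = \<tau> x" for x
    unfolding r_def by (rule someI[of "\<lambda>y. \<tau> y = \<tau> x"]) simp
  have \<tau>_0: "\<tau> 0 = 0" using \<tau>_add[of 0 0] by simp
  have \<tau>_uminus: "\<tau> (- x) = - \<tau> x" for x using \<tau>_add[of x "- x"] \<tau>_0 by simp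
  have "coeff.rel_acyclic {x. \<tau> x = 0}"
  proof (rule coeff.acyclic_if_centralised[where r = r])
    show "r (n + x) = r x" if "n \<in> {x. \<tau> x = 0}" for n x
      using that by (simp add: r_def \<tau>_add)
    show "x - r x \<in> {x. \<tau> x = 0}" for x
      using \<tau>_add[of x "- r x"] by (simp add: \<tau>_uminus \<tau>_r)
    fix K assume K: "finite K" "K \<subseteq> {x. \<tau> x = 0}"
    have "\<exists>n. \<forall>f g. pl_map f \<longrightarrow> g \<in> elt ` K \<longrightarrow>
        compose {0..1} (shrink n f) g = compose {0..1} g (shrink n f)"
      by (rule log_slope_zero_commute) (use K pl_map_Rep in \<open>auto simp: \<tau>_def\<close>)
    then obtain n where n: "\<And>f k. pl_map f \<Longrightarrow> k \<in> K \<Longrightarrow>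
        compose {0..1} (shrink n f) (elt k) = compose {0..1} (elt k) (shrink n f)"
      by blast
    \<comment> \<open>If no finite set had a gap, every finite set would have almost invariant
      vectors for F acting through \<open>shrink n\<close>, and F would be amenable.\<close>
    have "\<exists>S \<epsilon>. finite S \<and> S \<subseteq> carrier thompson_F \<and> 0 < \<epsilon> \<and> (\<forall>v\<in>ell2 thompson_F.
        \<epsilon> * (ell2_norm thompson_F v)\<^sup>2 \<le>
          (\<Sum>s\<in>S. (ell2_norm thompson_F (\<lambda>x. F.rtrans (shrink n s) v x - v x))\<^sup>2))"
    proof (rule ccontr)
      assume neg: "\<not> ?thesis"
      have "amenable thompson_F"
      proof (rule F.amenable_if_almost_invariant_vectors[OF group_F shrink_hom shrink_inj])
        fix S :: "(real \<Rightarrow> real) set" and \<epsilon> :: real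
        assume "finite S" "S \<subseteq> carrier thompson_F" "0 < \<epsilon>"
        with neg show "\<exists>v\<in>ell2 thompson_F.
            (\<Sum>s\<in>S. (ell2_norm thompson_F (\<lambda>x. F.rtrans (shrink n s) v x - v x))\<^sup>2)
              < \<epsilon> * (ell2_norm thompson_F v)\<^sup>2"
          by (meson not_le)
      qed
      with assms show False ..
    qed
    then obtain S0 \<epsilon> where S0: "finite S0" "S0 \<subseteq> carrier thompson_F" "0 < \<epsilon>"
      "\<And>v. v \<in> ell2 thompson_F \<Longrightarrow> \<epsilon> * (ell2_norm thompson_F v)\<^sup>2 \<le>
          (\<Sum>s\<in>S0. (ell2_norm thompson_F (\<lambda>x. F.rtrans (shrink n s) v x - v x))\<^sup>2)"
      by blast
    define S where "S = shrink n ` S0"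
    have S: "finite S" "S \<subseteq> carrier thompson_F"
      using S0 by (auto simp: S_def carrier_F pl_map_shrink)
    have gap: "\<epsilon> * (ell2_norm thompson_F v)\<^sup>2 \<le>
          (\<Sum>s\<in>S. (ell2_norm thompson_F (\<lambda>x. F.rtrans s v x - v x))\<^sup>2)"
      if "v \<in> ell2 thompson_F" for v
      using S0(4)[OF that] inj_on_subset[OF shrink_inj S0(2)]
      unfolding S_def by (subst sum.reindex) auto
    \<comment> \<open>The elements of \<open>K\<close> commute with those of \<open>S\<close>, so
      \<open>T\<close> commutes with their right translations; the same \<open>T\<close> serves
      every element of \<open>S\<close>.\<close>
    obtain T where T: "T \<in> carrier (F.vN)"
      "\<And>k v. k \<in> carrier thompson_F \<Longrightarrow> (\<And>s. s \<in> S \<Longrightarrow> s \<otimes>\<^bsub>thompson_F\<^esub> k = k \<otimes>\<^bsub>thompson_F\<^esub> s) \<Longrightarrow>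
         v \<in> ell2 thompson_F \<Longrightarrow> T (F.rtrans k v) = F.rtrans k (T v)"
      "\<And>v x. v \<in> ell2 thompson_F \<Longrightarrow> (\<Sum>s\<in>S. T (F.rtrans s v) x - T v x) = v x"
      using F.vN_left_inverse[OF S S0(3) gap] by metis
    define A where "A = Elt ` S"
    define B where "B = Opr T"
    have Rep_B: "opr B = T" using T(1) by (simp add: B_def Opr_inverse)
    have Rep_A: "elt (Elt s) = s" if "s \<in> S" for s
      using that S(2) by (simp add: Elt_inverse subset_iff)
    have comm: "s \<otimes>\<^bsub>thompson_F\<^esub> elt k = elt k \<otimes>\<^bsub>thompson_F\<^esub> s"
      if "s \<in> S" "k \<in> K" for s k
      using that S0(2) by (auto simp: S_def carrier_F mult_F pl_map_shrink pl_map_Rep n)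
    have "(\<Sum>s\<in>A. B * (trans_op s - 1)) = 1"
    proof (rule thompson_vN_eqI)
      fix v assume v: "v \<in> ell2 thompson_F"
      have "opr (\<Sum>s\<in>A. B * trans_op s - B) v =
          (\<lambda>x. \<Sum>s\<in>A. T (F.rtrans (elt s) v) x - T v x)"
        by (simp add: opr_sum opr_diff opr_apply Rep_B v)
      also have "\<dots> = (\<lambda>x. \<Sum>s\<in>S. T (F.rtrans s v) x - T v x)"
      proof
        fix x
        have "inj_on Elt S" by (rule inj_on_inverseI[where g = elt]) (rule Rep_A)
        then show "(\<Sum>s\<in>A. T (F.rtrans (elt s) v) x - T v x) =
            (\<Sum>s\<in>S. T (F.rtrans s v) x - T v x)"
          unfolding A_def by (subst sum.reindex) (auto simp: Rep_A intro!: sum.cong)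
      qed
      also have "\<dots> = v" using T(3)[OF v] by auto
      finally show "opr (\<Sum>s\<in>A. B * (trans_op s - 1)) v = opr 1 v"
        by (simp add: opr_apply v right_diff_distrib)
    qed
    moreover have "B * trans_op k = trans_op k * B" if k: "k \<in> K" for k
    proof (rule thompson_vN_eqI)
      fix v assume v: "v \<in> ell2 thompson_F"
      have "T (F.rtrans (elt k) v) = F.rtrans (elt k) (T v)"
        by (rule T(2)[OF elt _ v]) (use comm k in auto)
      then show "opr (B * trans_op k) v = opr (trans_op k * B) v"
        using opr_in_ell2[OF v, of B] by (simp add: opr_apply v Rep_B)
    qed
    moreover have "s + k = k + s" if "s \<in> A" "k \<in> K" for s k
      using that comm by (auto simp: thompson_eq_iff A_def Rep_A)
    moreover have "finite A" "A \<subseteq> {x. \<tau> x = 0}"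
      using S S0(2) by (auto simp: A_def S_def \<tau>_def Rep_A carrier_F log_slope_shrink
          Elt_inverse pl_map_shrink)
    ultimately show "\<exists>S T. finite S \<and> S \<subseteq> {x. \<tau> x = 0} \<and>
        (\<forall>s\<in>S. \<forall>k\<in>K. s + k = k + s \<and> T s * trans_op k = trans_op k * T s) \<and>
        (\<Sum>s\<in>S. T s * (trans_op s - 1)) = 1"
      by (intro exI[of _ A] exI[of _ "\<lambda>_. B"]) auto
  qed
  then have "coeff.rel_acyclic UNIV"
    using coeff.acyclic_UNIV_if_acyclic_kernel[of \<tau>, OF \<tau>_add \<tau>_t] by blast
  then show ?thesis
    unfolding l2_invisible_def using bar.trivial_group_homology by blast
qed

theorem corollary7p17:
  shows "\<not> amenable thompson_F \<longleftrightarrow> l2_invisible thompson_F"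
  using not_amenable_if_invisible invisible_if_not_amenable by blast

end
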